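(* Let $S \subset \mathbb{R}^N$ be a closed set. Then $S$ is $C^0$ removable for the divergence operator if and only if $S$ is $\sigma$-finite for the Hausdorff measure $\mathcal{H}^{N-1}$.
   Context: $N\ge 1$ is an integer. A closed set $S \subset \mathbb{R}^N$ is called $C^0$ removable for the divergence operator if every continuous vector field $V : \mathbb{R}^N \to \mathbb{R}^N$ such that $\operatorname{div} V = 0$ in $\mathbb{R}^N \setminus S$ also satisfies $\operatorname{div} V = 0$ in $\mathbb{R}^N$. Here $\operatorname{div} V = 0$ in an open set $U$ is understood in the sense of distributions: $\int_{U} V \cdot \nabla \varphi = 0$ for every $\varphi \in C_c^\infty(U)$. $\mathcal{H}^{N-1}$ is the (spherical) Hausdorff measure of dimension $s=N-1$: $\mathcal{H}^{s}(A) = \lim_{\delta\to 0} \inf\{\sum_{n=0}^\infty \omega_s r_n^s : A \subset \bigcup_{n=0}^\infty B(x_n;r_n),\ 0\le r_n \le \delta\}$ with $\omega_s = \pi^{s/2}/\Gamma(\frac{s}{2}+1)$ (for $s=0$, $\mathcal{H}^0$ is the counting measure). A set is $\sigma$-finite for $\mathcal{H}^{N-1}$ if it is a countable union of sets of finite $\mathcal{H}^{N-1}$ measure. *)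

theory Defs
  imports "HOL-Analysis.Analysis"
begin

section \<open>Test functions and distributional divergence\<close>

definition partial_deriv :: "'n \<Rightarrow> (real ^ 'n \<Rightarrow> real) \<Rightarrow> real ^ 'n \<Rightarrow> real" where
  "partial_deriv i f x = frechet_derivative f (at x) (axis i 1)"

definition grad :: "(real ^ 'n \<Rightarrow> real) \<Rightarrow> real ^ 'n \<Rightarrow> real ^ 'n" where
  "grad f x = (\<chi> i. partial_deriv i f x)"

lemma GDERIV_grad:
  fixes f :: "real ^ 'n \<Rightarrow> real"
  assumes "f differentiable (at x)"
  shows "GDERIV f x :> grad f x"
proof -
  let ?D = "frechet_derivative f (at x)"
  have D: "(f has_derivative ?D) (at x)"
    using assms by (simp add: frechet_derivative_works)
  then have lin: "linear ?D"
    by (rule has_derivative_linear)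
  have "?D h = h \<bullet> grad f x" for h
  proof -
    have "?D h = ?D (\<Sum>i\<in>UNIV. (h $ i) *\<^sub>R axis i 1)"
      by (simp add: basis_expansion flip: scalar_mult_eq_scaleR)
    also have "\<dots> = (\<Sum>i\<in>UNIV. (h $ i) * ?D (axis i 1))"
      by (simp add: linear_sum[OF lin] linear_cmul[OF lin])
    also have "\<dots> = h \<bullet> grad f x"
      by (simp add: inner_vec_def grad_def partial_deriv_def)
    finally show ?thesis .
  qed
  then have "?D = (\<lambda>h. h \<bullet> grad f x)" by blast
  with D show ?thesis by (simp add: gderiv_def)
qed

primrec C_class :: "nat \<Rightarrow> (real ^ 'n \<Rightarrow> real) \<Rightarrow> bool" where
  "C_class 0 f \<longleftrightarrow> continuous_on UNIV f"
| "C_class (Suc k) f \<longleftrightarrow>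
     f differentiable_on UNIV \<and> (\<forall>i. C_class k (partial_deriv i f))"

definition smooth :: "(real ^ 'n \<Rightarrow> real) \<Rightarrow> bool" where
  "smooth f \<longleftrightarrow> (\<forall>k. C_class k f)"

text \<open>Elements of \<open>C\<^sub>c\<^sup>\<infinity>(U)\<close>, for open \<open>U\<close>, are identified with their
  extensions by zero to the whole space.\<close>

definition test_function :: "(real ^ 'n) set \<Rightarrow> (real ^ 'n \<Rightarrow> real) \<Rightarrow> bool" where
  "test_function U \<phi> \<longleftrightarrow>
     smooth \<phi> \<and> compact (closure {x. \<phi> x \<noteq> 0}) \<and> closure {x. \<phi> x \<noteq> 0} \<subseteq> U"

definition div_zero_on :: "(real ^ 'n) set \<Rightarrow> (real ^ 'n \<Rightarrow> real ^ 'n) \<Rightarrow> bool" where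
  "div_zero_on U V \<longleftrightarrow>
     (\<forall>\<phi>. test_function U \<phi> \<longrightarrow> (LINT x:U|lborel. V x \<bullet> grad \<phi> x) = 0)"

definition C0_removable_div :: "(real ^ 'n) set \<Rightarrow> bool" where
  "C0_removable_div S \<longleftrightarrow>
     (\<forall>V :: real ^ 'n \<Rightarrow> real ^ 'n.
        continuous_on UNIV V \<longrightarrow> div_zero_on (- S) V \<longrightarrow> div_zero_on UNIV V)"

section \<open>Spherical Hausdorff measure\<close>

definition hausdorff_content :: "real \<Rightarrow> real \<Rightarrow> 'a::metric_space set \<Rightarrow> ennreal" where
  "hausdorff_content s \<delta> A =
     (INF (x, r) \<in> {(x :: nat \<Rightarrow> 'a, r :: nat \<Rightarrow> real).
                      A \<subseteq> (\<Union>n. ball (x n) (r n)) \<and> (\<forall>n. 0 \<le> r n \<and> r n \<le> \<delta>)}.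
        \<Sum>n. ennreal (unit_ball_vol s * r n powr s))"

text \<open>The library's \<^const>\<open>unit_ball_vol\<close> is \<open>\<omega>\<^sub>s = \<pi>\<^sup>s\<^sup>/\<^sup>2 / \<Gamma>(s/2 + 1)\<close> for real \<open>s\<close>.
  The case \<open>s = 0\<close> is set apart so that it does not depend on the value of \<open>0\<^sup>0\<close>.\<close>

definition hausdorff_measure :: "real \<Rightarrow> 'a::metric_space set \<Rightarrow> ennreal" where
  "hausdorff_measure s A =
     (if s = 0 then emeasure (count_space UNIV) A
      else Lim (at_right 0) (\<lambda>\<delta>. hausdorff_content s \<delta> A))"

lemma hausdorff_content_antimono:
  assumes "\<delta> \<le> \<delta>'"
  shows "hausdorff_content s \<delta>' A \<le> hausdorff_content s \<delta> A"
  unfolding hausdorff_content_def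
  using assms by (intro INF_superset_mono) (auto intro: order_trans)

text \<open>The limit in \<^const>\<open>hausdorff_measure\<close> always exists.\<close>

lemma hausdorff_content_tendsto:
  "((\<lambda>\<delta>. hausdorff_content s \<delta> A) \<longlongrightarrow> (SUP \<delta>\<in>{0<..}. hausdorff_content s \<delta> A)) (at_right 0)"
proof (rule order_tendstoI)
  fix a assume "a < (SUP \<delta>\<in>{0<..}. hausdorff_content s \<delta> A)"
  then obtain d where d: "d > 0" "a < hausdorff_content s d A"
    by (auto simp: less_SUP_iff)
  have "\<forall>\<^sub>F \<delta> in at_right 0. \<delta> < d"
    using d(1) by (auto simp: eventually_at_right)
  then show "\<forall>\<^sub>F \<delta> in at_right 0. a < hausdorff_content s \<delta> A"
    by eventually_elim (meson d(2) hausdorff_content_antimono less_imp_le order_less_le_trans)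
next
  fix a assume a: "(SUP \<delta>\<in>{0<..}. hausdorff_content s \<delta> A) < a"
  show "\<forall>\<^sub>F \<delta> in at_right 0. hausdorff_content s \<delta> A < a"
    using eventually_at_right_less[of 0]
  proof eventually_elim
    case (elim \<delta>)
    then have "hausdorff_content s \<delta> A \<le> (SUP \<delta>\<in>{0<..}. hausdorff_content s \<delta> A)"
      by (intro SUP_upper) auto
    with a show ?case by (rule order_le_less_trans[rotated])
  qed
qed

lemma hausdorff_measure_eq_SUP:
  assumes "s \<noteq> 0"
  shows "hausdorff_measure s A = (SUP \<delta>\<in>{0<..}. hausdorff_content s \<delta> A)"
  using assms tendsto_Lim[OF _ hausdorff_content_tendsto]
  by (simp add: hausdorff_measure_def)

definition hausdorff_sigma_finite :: "real \<Rightarrow> 'a::metric_space set \<Rightarrow> bool" where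
  "hausdorff_sigma_finite s S \<longleftrightarrow>
     (\<exists>A :: nat \<Rightarrow> 'a set. S = (\<Union>n. A n) \<and> (\<forall>n. hausdorff_measure s (A n) < \<infinity>))"

end

theory Submission
  imports Defs "HOL-Library.Diagonal_Subsequence"
begin

text \<open>
  Let \<open>N\<close> be the dimension and \<open>s = N - 1\<close>.

  If \<open>S\<close> is \<open>\<sigma>\<close>-finite, write \<open>\<integral> V \<bullet> \<nabla>\<phi>\<close> as the sum of \<open>\<integral> V \<bullet> \<nabla>(\<phi> G)\<close> over smoothed
  indicators \<open>G\<close> of dyadic cubes. Each term vanishes if the cube misses \<open>S\<close>, and a cube of side
  \<open>l\<close> contributes at most a constant times \<open>osc(V) l\<^sup>s\<close>, since constant fields contribute nothing.
  As \<open>osc(V)\<close> tends to 0 with \<open>l\<close>, every piece of finite measure can be covered so finely that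
  its total contribution is as small as desired, and compactness selects finitely many cubes.

  If \<open>S\<close> is not \<open>\<sigma>\<close>-finite, there is a gauge \<open>h(l) = o(l\<^sup>s)\<close> whose dyadic content of \<open>S\<close> is positive,
  because lowering the gauge at small scales cannot make the content modulo \<open>\<sigma>\<close>-finite sets drop.
  Frostman's construction gives masses on dyadic cubes bounded by \<open>h\<close>. Between two scales where
  \<open>h(l) \<le> 4\<^sup>-\<^sup>j l\<^sup>s\<close>, max-flow min-cut, with the cut condition provided by the boxing inequality, moves the
  coarse masses to the fine masses by a flow of size \<open>O(4\<^sup>-\<^sup>j)\<close>. The flows, spread out by hat functions,
  sum up uniformly to a continuous field whose divergence is a nonzero measure on \<open>S\<close>.
\<close>

section \<open>Smooth functions\<close>

text \<open>The two halves meet in the gap between O(l^s) and o(l^s). Continuity of \<open>V\<close>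
  gains over the bound l^s per cube a factor that tends to 0 at no fixed rate; against pieces of
  finite measure any rate suffices. Conversely, masses bounded by a multiple of l^s would only give
  a bounded field, so a gauge of strictly smaller order is needed. It is obtained from l^s by
  dividing by 4 from one well chosen scale after another on, which makes the flows between
  consecutive scales summable in the sup norm and the limit continuous. These scales may be
  arbitrarily far apart, so a transfer of mass must be bounded independently of the number of levels
  crossed. This is why a cut criterion over all subsets of a block, fed by the growth of the masses
  at all intermediate scales, takes the place of level by level transport. All subdivisions are
  exact: smoothed indicators of children add up to that of the parent, hats refine into finer hats,
  and half-open cells partition space. Hence no error accumulates across levels, and covers, masses
  and flows are indexed by integer vectors without boundary corrections.\<close>

lemma has_derivative_partial_deriv:
  fixes f :: "real ^ 'n \<Rightarrow> real"
  assumes "f differentiable_on UNIV"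
  shows "((\<lambda>t. f (x + t *\<^sub>R axis i 1)) has_real_derivative partial_deriv i f (x + t *\<^sub>R axis i 1)) (at t)"
proof -
  let ?y = "x + t *\<^sub>R axis i 1"
  let ?D = "frechet_derivative f (at ?y)"
  have D: "(f has_derivative ?D) (at ?y)"
    using assms by (simp add: frechet_derivative_works differentiable_on_def)
  have "((\<lambda>t. x + t *\<^sub>R axis i 1) has_derivative (\<lambda>h. h *\<^sub>R axis i 1)) (at t)"
    by (auto intro!: derivative_eq_intros)
  from diff_chain_at[OF this D]
  have "((\<lambda>t. f (x + t *\<^sub>R axis i 1)) has_derivative (\<lambda>h. ?D (h *\<^sub>R axis i 1))) (at t)"
    by (simp add: o_def)
  moreover have "?D (h *\<^sub>R axis i 1) = partial_deriv i f ?y * h" for h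
    using linear_cmul[OF has_derivative_linear[OF D]] by (simp add: partial_deriv_def)
  ultimately show ?thesis by (simp add: has_field_derivative_def)
qed

lemma partial_deriv_eqI:
  assumes "(f has_derivative D) (at x)"
  shows "partial_deriv i f x = D (axis i 1)"
  using frechet_derivative_at[OF assms] by (simp add: partial_deriv_def)

lemma C_class_Suc_imp: "C_class (Suc k) f \<Longrightarrow> C_class k f"
proof (induction k arbitrary: f)
  case 0
  then show ?case by (simp add: differentiable_imp_continuous_on)
next
  case (Suc k)
  then show ?case by auto
qed

lemma C_class_add:
  "C_class k f \<Longrightarrow> C_class k g \<Longrightarrow> C_class k (\<lambda>x. f x + g x)"
proof (induction k arbitrary: f g)
  case 0
  then show ?case by (auto intro: continuous_intros)
next
  case (Suc k)
  have "partial_deriv i (\<lambda>x. f x + g x) = (\<lambda>x. partial_deriv i f x + partial_deriv i g x)" for i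
  proof
    fix x
    have "(f has_derivative frechet_derivative f (at x)) (at x)"
      "(g has_derivative frechet_derivative g (at x)) (at x)"
      using Suc.prems by (auto simp: frechet_derivative_works differentiable_on_def)
    from partial_deriv_eqI[OF has_derivative_add[OF this]]
    show "partial_deriv i (\<lambda>x. f x + g x) x = partial_deriv i f x + partial_deriv i g x"
      by (simp add: partial_deriv_def)
  qed
  with Suc show ?case by (auto intro: differentiable_on_add)
qed

lemma partial_deriv_mult:
  fixes f g :: "real ^ 'n \<Rightarrow> real"
  assumes "f differentiable_on UNIV" "g differentiable_on UNIV"
  shows "partial_deriv i (\<lambda>x. f x * g x) = (\<lambda>x. f x * partial_deriv i g x + partial_deriv i f x * g x)"
proof
  fix x
  have "(f has_derivative frechet_derivative f (at x)) (at x)"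
    "(g has_derivative frechet_derivative g (at x)) (at x)"
    using assms by (auto simp: frechet_derivative_works differentiable_on_def)
  from partial_deriv_eqI[OF has_derivative_mult[OF this]]
  show "partial_deriv i (\<lambda>x. f x * g x) x = f x * partial_deriv i g x + partial_deriv i f x * g x"
    by (simp add: partial_deriv_def)
qed

lemma C_class_mult:
  "C_class k f \<Longrightarrow> C_class k g \<Longrightarrow> C_class k (\<lambda>x. f x * g x)"
proof (induction k arbitrary: f g)
  case 0
  then show ?case by (auto intro: continuous_intros)
next
  case (Suc k)
  then have d: "f differentiable_on UNIV" "g differentiable_on UNIV" by auto
  have "C_class k f" "C_class k g"
    using Suc.prems C_class_Suc_imp by blast+
  with Suc show ?case
    by (simp only: C_class.simps partial_deriv_mult[OF d])
      (auto intro!: differentiable_on_mult C_class_add)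
qed

lemma C_class_const: "C_class k (\<lambda>x. c)"
proof (induction k arbitrary: c)
  case (Suc k)
  have "partial_deriv i (\<lambda>x. c) = (\<lambda>x. 0)" for i :: 'a
    by (rule ext) (simp add: partial_deriv_eqI[OF has_derivative_const])
  with Suc show ?case by simp
qed simp

lemma C_class_prod:
  "finite A \<Longrightarrow> (\<And>a. a \<in> A \<Longrightarrow> C_class k (f a)) \<Longrightarrow> C_class k (\<lambda>x. \<Prod>a\<in>A. f a x)"
  by (induction A rule: finite_induct) (auto intro: C_class_const C_class_mult)

lemma smooth_mult: "smooth f \<Longrightarrow> smooth g \<Longrightarrow> smooth (\<lambda>x. f x * g x)"
  by (simp add: smooth_def C_class_mult)

lemma smooth_prod:
  "finite A \<Longrightarrow> (\<And>a. a \<in> A \<Longrightarrow> smooth (f a)) \<Longrightarrow> smooth (\<lambda>x. \<Prod>a\<in>A. f a x)"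
  by (simp add: smooth_def C_class_prod)

lemma smooth_differentiable: "smooth f \<Longrightarrow> f differentiable_on UNIV"
  unfolding smooth_def by (metis C_class.simps(2))

lemma smooth_continuous: "smooth f \<Longrightarrow> continuous_on UNIV f"
  unfolding smooth_def by (metis C_class.simps(1))

lemma smooth_continuous_partial_deriv: "smooth f \<Longrightarrow> continuous_on UNIV (partial_deriv i f)"
  unfolding smooth_def by (metis C_class.simps)

section \<open>Smooth functions of one variable, and a smooth step built from them\<close>

primrec C_line :: "nat \<Rightarrow> (real \<Rightarrow> real) \<Rightarrow> bool" where
  "C_line 0 p \<longleftrightarrow> continuous_on UNIV p"
| "C_line (Suc k) p \<longleftrightarrow> (\<exists>p'. (\<forall>t. (p has_real_derivative p' t) (at t)) \<and> C_line k p')"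

lemma C_line_Suc_imp: "C_line (Suc k) p \<Longrightarrow> C_line k p"
proof (induction k arbitrary: p)
  case 0
  then show ?case
    by (auto intro!: continuous_at_imp_continuous_on) (meson DERIV_isCont)
next
  case (Suc k)
  then show ?case by (metis C_line.simps(2))
qed

lemma C_line_add: "C_line k p \<Longrightarrow> C_line k q \<Longrightarrow> C_line k (\<lambda>t. p t + q t)"
proof (induction k arbitrary: p q)
  case 0
  then show ?case by (auto intro: continuous_intros)
next
  case (Suc k)
  then obtain p' q' where
    "\<And>t. (p has_real_derivative p' t) (at t)" "\<And>t. (q has_real_derivative q' t) (at t)"
    "C_line k p'" "C_line k q'"
    by auto
  with Suc.IH show ?case
    by (auto intro!: exI[of _ "\<lambda>t. p' t + q' t"] derivative_eq_intros)
qed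

lemma C_line_mult: "C_line k p \<Longrightarrow> C_line k q \<Longrightarrow> C_line k (\<lambda>t. p t * q t)"
proof (induction k arbitrary: p q)
  case 0
  then show ?case by (auto intro: continuous_intros)
next
  case (Suc k)
  then obtain p' q' where D:
    "\<And>t. (p has_real_derivative p' t) (at t)" "\<And>t. (q has_real_derivative q' t) (at t)"
    "C_line k p'" "C_line k q'"
    by auto
  moreover have "C_line k p" "C_line k q"
    using Suc.prems C_line_Suc_imp by blast+
  ultimately have "C_line k (\<lambda>t. p' t * q t + p t * q' t)"
    by (intro C_line_add Suc.IH)
  with D show ?case
    by (auto intro!: exI[of _ "\<lambda>t. p' t * q t + p t * q' t"] derivative_eq_intros)
qed

lemma C_line_const: "C_line k (\<lambda>t. c)"
proof (induction k arbitrary: c)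
  case (Suc k)
  then show ?case by (auto intro!: exI[of _ "\<lambda>t. 0"])
qed simp

lemma C_line_affine: "C_line k p \<Longrightarrow> C_line k (\<lambda>t. p (c * t + d))"
proof (induction k arbitrary: p)
  case 0
  then show ?case by (auto intro!: continuous_on_compose2[of UNIV p] continuous_intros)
next
  case (Suc k)
  then obtain p' where p': "\<And>t. (p has_real_derivative p' t) (at t)" "C_line k p'"
    by auto
  have "((\<lambda>t. p (c * t + d)) has_real_derivative c * p' (c * t + d)) (at t)" for t
    by (rule DERIV_chain2[OF p'(1), THEN DERIV_cong]) (auto intro!: derivative_eq_intros)
  moreover have "C_line k (\<lambda>t. c * p' (c * t + d))"
    by (intro C_line_mult C_line_const Suc.IH p')
  ultimately show ?case by (auto intro!: exI[of _ "\<lambda>t. c * p' (c * t + d)"])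
qed

text \<open>Every cutoff built below is a product of one-variable functions of the coordinates, so
  together with \<open>smooth_prod\<close> this carries smoothness from the line to space. The
  existential derivative in \<open>C_line\<close> leaves each use free to exhibit a closed
  form.\<close>

lemma C_class_coordinate:
  "C_line k p \<Longrightarrow> C_class k (\<lambda>x :: real ^ 'n. p (x $ i))"
proof (induction k arbitrary: p)
  case 0
  then show ?case by (auto intro!: continuous_on_compose2[of UNIV p] continuous_intros)
next
  case (Suc k)
  then obtain p' where p': "\<And>t. (p has_real_derivative p' t) (at t)" "C_line k p'"
    by auto
  have D: "((\<lambda>x :: real ^ 'n. p (x $ i)) has_derivative (\<lambda>h. p' (x $ i) * h $ i)) (at x)" for x
  proof -
    have "((\<lambda>x :: real ^ 'n. x $ i) has_derivative (\<lambda>h. h $ i)) (at x)"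
      by (rule bounded_linear.has_derivative[OF bounded_linear_vec_nth]) simp
    from diff_chain_at[OF this, of p "\<lambda>h. p' (x $ i) * h"] p'(1)[of "x $ i"]
    show ?thesis by (simp add: o_def has_field_derivative_def)
  qed
  have "partial_deriv j (\<lambda>x :: real ^ 'n. p (x $ i)) = (\<lambda>x. p' (x $ i) * (if j = i then 1 else 0))" for j
    by (rule ext) (auto simp: partial_deriv_eqI[OF D] axis_def)
  moreover have "C_class k (\<lambda>x :: real ^ 'n. p' (x $ i) * (if j = i then 1 else 0))" for j
    by (intro C_class_mult Suc.IH p' C_class_const)
  ultimately show ?case
    using D by (auto simp: differentiable_on_def differentiable_def)
qed

text \<open>Polynomials in 1/t times exp(-1/t), extended by 0: a family closed under differentiation
  that contains exp(-1/t) as \<open>flat 1\<close>, so smoothness is one induction with the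
  polynomial generalised.\<close>

definition flat :: "real poly \<Rightarrow> real \<Rightarrow> real" where
  "flat q t = (if t > 0 then poly q (1 / t) * exp (- (1 / t)) else 0)"

lemma poly_exp_tendsto_0:
  "((\<lambda>t. poly q t * exp (- t)) \<longlongrightarrow> 0) (at_top :: real filter)"
proof -
  have "((\<lambda>t. t ^ n * exp (- t)) \<longlongrightarrow> (0::real)) at_top" for n :: nat
    using tendsto_power_div_exp_0[of n] by (simp add: exp_minus field_simps)
  then have "((\<lambda>t. \<Sum>i\<le>degree q. coeff q i * (t ^ i * exp (- t))) \<longlongrightarrow> (\<Sum>i\<le>degree q. coeff q i * 0)) at_top"
    by (intro tendsto_intros)
  then show ?thesis by (simp add: poly_altdef sum_distrib_right mult.assoc)
qed

lemma flat_tendsto_0: "(flat q \<longlongrightarrow> 0) (at 0)"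
proof -
  have "(flat q \<longlongrightarrow> 0) (at_right 0)"
  proof (rule Lim_transform_eventually)
    show "((\<lambda>t. poly q (inverse t) * exp (- (inverse t))) \<longlongrightarrow> 0) (at_right 0)"
      by (rule filterlim_compose[OF poly_exp_tendsto_0 filterlim_inverse_at_top_right])
    show "\<forall>\<^sub>F t in at_right 0. poly q (inverse t) * exp (- (inverse t)) = flat q t"
      using eventually_at_right_less[of 0]
      by eventually_elim (auto simp: flat_def inverse_eq_divide)
  qed
  moreover have "\<forall>\<^sub>F t in at_left 0. flat q t = 0"
    using eventually_at_left_field[of "\<lambda>t. flat q t = 0" 0] by (auto simp: flat_def intro!: exI[of _ "-1"])
  then have "(flat q \<longlongrightarrow> 0) (at_left 0)"
    by (rule tendsto_eventually)
  ultimately show ?thesis by (simp add: filterlim_split_at)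
qed

text \<open>For t > 0 the product and chain rules give 1/t^2 times (q - q')(1/t), and
  \<open>[:0, 0, 1:]\<close> is the monomial that supplies 1/t^2.\<close>

lemma flat_has_derivative:
  "(flat q has_real_derivative flat ([:0, 0, 1:] * (q - pderiv q)) t) (at t)"
proof -
  consider "t > 0" | "t < 0" | "t = 0" by linarith
  then show ?thesis
  proof cases
    case 1
    let ?g = "\<lambda>t. poly q (1 / t) * exp (- (1 / t))"
    have D: "(?g has_real_derivative
        flat ([:0, 0, 1:] * (q - pderiv q)) t) (at t)"
      using 1
      by (auto intro!: derivative_eq_intros DERIV_chain2[OF poly_DERIV]
          simp: flat_def field_simps power2_eq_square)
    have "\<forall>\<^sub>F s in nhds t. ?g s = flat q s"
      using 1 by (auto simp: flat_def eventually_nhds intro!: exI[of _ "{0<..}"])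
    from DERIV_cong_ev[OF refl this refl] D show ?thesis by blast
  next
    case 2
    have "\<forall>\<^sub>F s in nhds t. 0 = flat q s"
      using 2 by (auto simp: flat_def eventually_nhds intro!: exI[of _ "{..<0}"])
    moreover have "flat ([:0, 0, 1:] * (q - pderiv q)) t = 0"
      using 2 by (simp add: flat_def)
    ultimately show ?thesis using DERIV_cong_ev[of t t "\<lambda>_. 0" "flat q" 0] by simp
  next
    case 3
    \<comment> \<open>Dividing by h multiplies the polynomial by X, so the difference quotient at 0
      is again in the family and tends to 0.\<close>
    have "((\<lambda>h. (flat q h - flat q 0) / h) \<longlongrightarrow> 0) (at 0)"
    proof (rule Lim_transform_eventually)
      show "(flat ([:0, 1:] * q) \<longlongrightarrow> 0) (at 0)" by (rule flat_tendsto_0)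
      show "\<forall>\<^sub>F h in at 0. flat ([:0, 1:] * q) h = (flat q h - flat q 0) / h"
        by (auto simp: flat_def eventually_at intro!: exI[of _ 1])
    qed
    then show ?thesis using 3 by (simp add: has_field_derivative_iff flat_def)
  qed
qed

lemma C_line_flat: "C_line k (flat q)"
proof (induction k arbitrary: q)
  case 0
  then show ?case
    by (auto intro!: continuous_at_imp_continuous_on DERIV_isCont[OF flat_has_derivative])
next
  case (Suc k)
  then show ?case using flat_has_derivative by (metis C_line.simps(2))
qed

text \<open>The step is the normalised primitive of exp(-1/t) exp(-1/(1-t)), a bump supported on the
  unit interval. The slope bound \<open>L\<close> is returned as well because it enters every
  gradient estimate.\<close>

lemma smooth_step_exists:
  obtains P P' :: "real \<Rightarrow> real" and L :: real where
    "\<And>k. C_line k P"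
    "\<And>t. (P has_real_derivative P' t) (at t)"
    "\<And>t. t \<le> 0 \<Longrightarrow> P t = 0" "\<And>t. t \<ge> 1 \<Longrightarrow> P t = 1"
    "mono P" "\<And>t. 0 \<le> P' t" "\<And>t. P' t \<le> L" "\<And>t. t \<notin> {0..1} \<Longrightarrow> P' t = 0"
proof -
  define \<rho> where "\<rho> t = flat 1 t * flat 1 ((-1) * t + 1)" for t
  have C: "C_line k \<rho>" for k
    unfolding \<rho>_def by (intro C_line_mult C_line_affine C_line_flat)
  have nonneg: "0 \<le> \<rho> t" for t by (simp add: \<rho>_def flat_def)
  have zero: "\<rho> t = 0" if "t \<notin> {0..1}" for t using that by (auto simp: \<rho>_def flat_def)
  have cont: "continuous_on A \<rho>" for A
    using C[of 0] continuous_on_subset by auto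
  \<comment> \<open>The lower limit -1 keeps the left end 0 of the support in the interior of the
    interval of integration, where the fundamental theorem yields a two-sided derivative.\<close>
  define R where "R t = integral {-1..t} \<rho>" for t
  have int: "\<rho> integrable_on {a..b}" for a b
    by (intro integrable_continuous_interval cont)
  have R0: "R t = 0" if "t \<le> 0" for t
  proof -
    have "integral {-1..t} \<rho> = integral {-1..t} (\<lambda>_. 0)"
    proof (rule integral_cong)
      fix x assume "x \<in> {-1..t}"
      with that show "\<rho> x = 0" by (cases "x = 0") (auto simp: \<rho>_def flat_def)
    qed
    then show ?thesis by (simp add: R_def)
  qed
  have D: "(R has_real_derivative \<rho> t) (at t)" for t
  proof (cases "t > -1")
    case True
    have "(R has_real_derivative \<rho> t) (at t within {-1..t+1})"
      unfolding R_def using True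
      by (intro integral_has_real_derivative cont) auto
    moreover have "at t within {-1..t+1} = at t"
      by (rule at_within_interior) (use True in auto)
    ultimately show ?thesis by simp
  next
    case False
    have "((\<lambda>_. 0) has_real_derivative 0) (at t)" by simp
    moreover have "\<rho> t = 0" using False zero by auto
    moreover have "\<forall>\<^sub>F s in nhds t. 0 = R s"
      using False R0 by (auto simp: eventually_nhds intro!: exI[of _ "{..<0}"])
    ultimately show ?thesis using DERIV_cong_ev[of t t "\<lambda>_. 0" R 0 "\<rho> t"] by simp
  qed
  have mono: "mono R"
    unfolding mono_def
    by (metis DERIV_nonneg_imp_nondecreasing D nonneg)
  have R1: "R t = R 1" if "t \<ge> 1" for t
  proof (cases "t = 1")
    case False
    with that have "1 < t" by simp
    from MVT2[OF this D] obtain z where "1 < z" "R t - R 1 = (t - 1) * \<rho> z" by auto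
    then show ?thesis using zero[of z] by auto
  qed simp
  \<comment> \<open>If the total were 0, monotonicity would make \<open>R\<close> vanish on the unit
    interval, against its derivative at 1/2.\<close>
  have pos: "R 1 > 0"
  proof (rule ccontr)
    assume "\<not> R 1 > 0"
    with monoD[OF mono, of 0 1] R0[of 0] have R10: "R 1 = 0" by simp
    have z: "R t = 0" if "t \<in> {0..1}" for t
      using monoD[OF mono, of 0 t] monoD[OF mono, of t 1] R10 R0[of 0] that by auto
    have "\<forall>\<^sub>F x in nhds (1/2). R x = 0"
      using z by (auto simp: eventually_nhds intro!: exI[of _ "{0<..<1}"])
    from DERIV_cong_ev[OF refl this refl] D
    have "((\<lambda>_. 0) has_real_derivative \<rho> (1/2)) (at (1/2))" by blast
    then have "\<rho> (1/2) = 0" using DERIV_const DERIV_unique by blast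
    then show False by (simp add: \<rho>_def flat_def)
  qed
  have "compact (\<rho> ` {0..1})" by (intro compact_continuous_image cont) auto
  then have "bounded (\<rho> ` {0..1})" by (rule compact_imp_bounded)
  then obtain B where B: "\<And>t. t \<in> {0..1} \<Longrightarrow> norm (\<rho> t) \<le> B"
    unfolding bounded_iff by blast
  have B0: "B \<ge> 0" using order_trans[OF norm_ge_zero B[of 0]] by simp
  have bnd: "\<rho> t \<le> B" for t
  proof (cases "t \<in> {0..1}")
    case True
    then show ?thesis using B[of t] by simp
  qed (use zero B0 in auto)
  show ?thesis
  proof
    show "((\<lambda>t. 1 / R 1 * R t) has_real_derivative 1 / R 1 * \<rho> t) (at t)" for t
      by (intro DERIV_cmult D)
    show "C_line k (\<lambda>t. 1 / R 1 * R t)" for k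
    proof (rule C_line_Suc_imp)
      show "C_line (Suc k) (\<lambda>t. 1 / R 1 * R t)"
        using C_line_mult[OF C_line_const C, of k "1 / R 1"] D
        by (auto intro!: exI[of _ "\<lambda>t. 1 / R 1 * \<rho> t"] DERIV_cdivide)
    qed
    show "1 / R 1 * R t = 0" if "t \<le> 0" for t using R0[OF that] by simp
    show "1 / R 1 * R t = 1" if "1 \<le> t" for t using R1[OF that] pos by simp
    show "mono (\<lambda>t. 1 / R 1 * R t)"
      using mono pos by (auto simp: mono_def intro!: divide_right_mono)
    show "0 \<le> 1 / R 1 * \<rho> t" for t using nonneg pos by simp
    show "1 / R 1 * \<rho> t \<le> 1 / R 1 * B" for t using bnd pos by (auto intro!: divide_right_mono)
    show "1 / R 1 * \<rho> t = 0" if "t \<notin> {0..1}" for t using zero[OF that] by simp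
  qed
qed

section \<open>Integrals against gradients\<close>

lemma grad_nth [simp]: "grad f x $ i = partial_deriv i f x"
  by (simp add: grad_def)

lemma partial_deriv_outside_support:
  fixes f :: "real ^ 'n \<Rightarrow> real"
  assumes "x \<notin> closure {x. f x \<noteq> 0}"
  shows "partial_deriv i f x = 0"
proof -
  have "((\<lambda>_. 0) has_derivative (\<lambda>_. 0)) (at x)" by simp
  then have "(f has_derivative (\<lambda>_. 0)) (at x)"
  proof (rule has_derivative_transform_within_open)
    show "open (- closure {x. f x \<noteq> 0})" by auto
    show "x \<in> - closure {x. f x \<noteq> 0}" using assms by simp
    show "0 = f y" if "y \<in> - closure {x. f x \<noteq> 0}" for y
      using that closure_subset[of "{x. f x \<noteq> 0}"] by auto
  qed
  from partial_deriv_eqI[OF this] show ?thesis by simp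
qed

lemma grad_outside_support:
  "x \<notin> closure {x. f x \<noteq> 0} \<Longrightarrow> grad f x = 0"
  by (simp add: vec_eq_iff partial_deriv_outside_support)

lemma integrable_continuous_compact_support:
  fixes f :: "'a :: euclidean_space \<Rightarrow> real"
  assumes "continuous_on UNIV f" "compact S" "\<And>x. x \<notin> S \<Longrightarrow> f x = 0"
  shows "integrable lborel f"
proof -
  have "integrable lborel (\<lambda>x. indicator S x *\<^sub>R f x)"
    using assms by (intro borel_integrable_compact) (auto intro: continuous_on_subset)
  moreover have "(\<lambda>x. indicator S x *\<^sub>R f x) = f"
    using assms(3) by (intro ext) (auto simp: indicator_def)
  ultimately show ?thesis by simp
qed

lemma integral_translate_lborel:
  fixes f :: "'a :: euclidean_space \<Rightarrow> real"
  assumes "f \<in> borel_measurable borel"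
  shows "integral\<^sup>L lborel (\<lambda>x. f (c + x)) = integral\<^sup>L lborel f"
proof -
  have "integral\<^sup>L lborel f = integral\<^sup>L (distr lborel borel ((+) c)) f"
    by (simp add: lborel_distr_plus)
  also have "\<dots> = integral\<^sup>L lborel (\<lambda>x. f (c + x))"
    using assms by (intro integral_distr) auto
  finally show ?thesis by simp
qed

text \<open>Difference quotients along \<open>e\<close> integrate to 0 by translation invariance,
  and dominated convergence passes to the derivative. Differentiability is asked along the single
  direction \<open>e\<close> because the lemma is applied to products with \<open>pipe\<close>,
  whose hat factors have corners in the other directions.\<close>

lemma integral_directional_derivative_zero:
  fixes u u' :: "'a :: euclidean_space \<Rightarrow> real"
  assumes D: "\<And>x t. ((\<lambda>t. u (x + t *\<^sub>R e)) has_real_derivative u' (x + t *\<^sub>R e)) (at t)"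
    and cont: "continuous_on UNIV u" "continuous_on UNIV u'"
    and supp: "compact S" "\<And>x. x \<notin> S \<Longrightarrow> u x = 0" "\<And>x. x \<notin> S \<Longrightarrow> u' x = 0"
  shows "integral\<^sup>L lborel u' = 0"
proof -
  obtain R where R: "R > 0" "S \<subseteq> cball 0 R"
    using bounded_subset_ballD[OF compact_imp_bounded[OF supp(1)], of 0] by (meson ball_subset_cball order_trans)
  \<comment> \<open>All steps \<open>h n\<close> are at most 1, so every difference quotient
    vanishes outside this enlarged ball; its indicator times \<open>B\<close> is the dominating
    function.\<close>
  define T where "T = cball (0::'a) (R + norm e)"
  have "bounded (u' ` S)"
    using supp(1) cont(2) by (meson compact_continuous_image compact_imp_bounded continuous_on_subset top_greatest)
  then obtain B0 where B0: "\<And>x. x \<in> S \<Longrightarrow> \<bar>u' x\<bar> \<le> B0"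
    unfolding bounded_iff by auto
  define B where "B = max B0 0"
  have B: "\<bar>u' x\<bar> \<le> B" for x
    using B0[of x] supp(3)[of x] by (cases "x \<in> S") (auto simp: B_def)
  define h :: "nat \<Rightarrow> real" where "h n = 1 / (real n + 1)" for n
  have h: "0 < h n" "h n \<le> 1" for n by (auto simp: h_def)
  define g where "g n x = (u (h n *\<^sub>R e + x) - u x) / h n" for n x
  have meas: "u \<in> borel_measurable borel" "u' \<in> borel_measurable borel"
    using cont by (auto intro: borel_measurable_continuous_onI)
  have int_u: "integrable lborel u"
    by (rule integrable_continuous_compact_support[OF cont(1) supp(1,2)])
  have int_t: "integrable lborel (\<lambda>x. u (c + x))" for c
  proof (rule integrable_continuous_compact_support)
    show "continuous_on UNIV (\<lambda>x. u (c + x))"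
      by (intro continuous_on_compose2[OF cont(1)] continuous_intros) auto
    show "compact ((+) (-c) ` S)" using supp(1) by (rule compact_translation)
    show "u (c + x) = 0" if "x \<notin> (+) (-c) ` S" for x
    proof (rule supp(2))
      show "c + x \<notin> S"
        using that by (metis add.commute add_diff_cancel_left' image_eqI uminus_add_conv_diff)
    qed
  qed
  have zero: "integral\<^sup>L lborel (g n) = 0" for n
    unfolding g_def using int_u int_t[of "h n *\<^sub>R e"] integral_translate_lborel[OF meas(1), of "h n *\<^sub>R e"]
    by simp
  have "(\<lambda>n. integral\<^sup>L lborel (g n)) \<longlonglongrightarrow> integral\<^sup>L lborel u'"
  proof (rule integral_dominated_convergence)
    show "u' \<in> borel_measurable lborel" using meas by simp
    show "g n \<in> borel_measurable lborel" for n
      unfolding g_def using borel_measurable_integrable[OF int_t] meas by simp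
    show "integrable lborel (\<lambda>x. indicator T x *\<^sub>R B)"
      unfolding T_def by (intro borel_integrable_compact) auto
    show "AE x in lborel. (\<lambda>n. g n x) \<longlonglongrightarrow> u' x"
    proof (rule AE_I2)
      fix x
      have "((\<lambda>t. (u (x + t *\<^sub>R e) - u x) / t) \<longlongrightarrow> u' x) (at 0)"
        using D[of x 0] by (simp add: has_field_derivative_iff)
      moreover have "filterlim h (at 0) sequentially"
      proof -
        have "h \<longlonglongrightarrow> 0" unfolding h_def using LIMSEQ_inverse_real_of_nat
          by (simp add: inverse_eq_divide add.commute)
        then show ?thesis using h(1) by (auto simp: filterlim_at intro!: always_eventually less_imp_neq[symmetric])
      qed
      ultimately show "(\<lambda>n. g n x) \<longlonglongrightarrow> u' x"
        unfolding g_def by (subst add.commute) (rule filterlim_compose)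
    qed
    show "AE x in lborel. norm (g n x) \<le> indicator T x *\<^sub>R B" for n
    proof (rule AE_I2)
      fix x
      show "norm (g n x) \<le> indicator T x *\<^sub>R B"
      proof (cases "x \<in> T")
        case True
        obtain z where "u (x + h n *\<^sub>R e) - u (x + 0 *\<^sub>R e) = (h n - 0) * u' (x + z *\<^sub>R e)"
          using MVT2[OF h(1)[of n], of "\<lambda>t. u (x + t *\<^sub>R e)" "\<lambda>t. u' (x + t *\<^sub>R e)"] D by blast
        then have "g n x = u' (x + z *\<^sub>R e)"
          using h(1)[of n] by (simp add: g_def add.commute)
        then show ?thesis using True B by simp
      next
        case False
        then have n: "norm x > R + norm e" by (simp add: T_def)
        have "x \<notin> S"
        proof
          assume "x \<in> S"
          then have "norm x \<le> R" using R by auto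
          then show False using n norm_ge_zero[of e] by linarith
        qed
        moreover have "h n *\<^sub>R e + x \<notin> S"
        proof
          assume "h n *\<^sub>R e + x \<in> S"
          then have "norm (h n *\<^sub>R e + x) \<le> R" using R by auto
          moreover have "norm (h n *\<^sub>R e) \<le> norm e"
            using h[of n] by (simp add: mult_left_le_one_le)
          ultimately show False using n norm_triangle_ineq4[of "h n *\<^sub>R e + x" "h n *\<^sub>R e"] by simp
        qed
        ultimately show ?thesis using False supp(2) by (simp add: g_def)
      qed
    qed
  qed
  with zero show ?thesis by (simp add: LIMSEQ_const_iff)
qed

lemma test_functionD:
  assumes "test_function U \<phi>"
  shows "smooth \<phi>" "compact (closure {x. \<phi> x \<noteq> 0})" "closure {x. \<phi> x \<noteq> 0} \<subseteq> U"
    "x \<notin> closure {x. \<phi> x \<noteq> 0} \<Longrightarrow> \<phi> x = 0"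
  using assms closure_subset[of "{x. \<phi> x \<noteq> 0}"] by (auto simp: test_function_def)

lemma continuous_on_grad: "smooth \<phi> \<Longrightarrow> continuous_on UNIV (grad \<phi>)"
  unfolding grad_def by (intro continuous_on_vec_lambda smooth_continuous_partial_deriv)

lemma integrable_inner_grad:
  assumes "continuous_on UNIV V" "test_function U \<phi>"
  shows "integrable lborel (\<lambda>x. V x \<bullet> grad \<phi> x)"
proof (rule integrable_continuous_compact_support)
  show "continuous_on UNIV (\<lambda>x. V x \<bullet> grad \<phi> x)"
    by (intro continuous_intros continuous_on_grad assms test_functionD(1)[OF assms(2)])
  show "compact (closure {x. \<phi> x \<noteq> 0})" by (rule test_functionD(2)[OF assms(2)])
qed (simp add: grad_outside_support)

lemma integral_const_grad:
  assumes "test_function U \<phi>"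
  shows "(LINT x|lborel. c \<bullet> grad \<phi> x) = 0"
proof -
  note t = test_functionD[OF assms]
  have z: "(LINT x|lborel. partial_deriv i \<phi> x) = 0" for i
  proof (rule integral_directional_derivative_zero[where u = \<phi> and S = "closure {x. \<phi> x \<noteq> 0}"])
    show "((\<lambda>t. \<phi> (x + t *\<^sub>R axis i 1)) has_real_derivative partial_deriv i \<phi> (x + t *\<^sub>R axis i 1)) (at t)" for x t
      by (intro has_derivative_partial_deriv smooth_differentiable t)
  qed (fact smooth_continuous[OF t(1)] smooth_continuous_partial_deriv[OF t(1)] t(2) t(4)
      | rule partial_deriv_outside_support, assumption)+
  have int: "integrable lborel (partial_deriv i \<phi>)" for i
    by (rule integrable_continuous_compact_support[OF smooth_continuous_partial_deriv[OF t(1)] t(2)])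
      (rule partial_deriv_outside_support)
  have "(LINT x|lborel. c \<bullet> grad \<phi> x) = (LINT x|lborel. (\<Sum>i\<in>UNIV. c $ i * partial_deriv i \<phi> x))"
    by (simp add: inner_vec_def)
  also have "\<dots> = 0" using int z by (subst Bochner_Integration.integral_sum) auto
  finally show ?thesis .
qed

text \<open>A gradient vanishes outside the support of its test function, so the domain enters only
  through the choice of test functions and all integrals can be taken over the whole space.\<close>

lemma div_zero_on_iff:
  fixes V :: "real ^ 'n \<Rightarrow> real ^ 'n"
  shows "div_zero_on U V \<longleftrightarrow> (\<forall>\<phi>. test_function U \<phi> \<longrightarrow> (LINT x|lborel. V x \<bullet> grad \<phi> x) = 0)"
proof -
  have "(LINT x:U|lborel. V x \<bullet> grad \<phi> x) = (LINT x|lborel. V x \<bullet> grad \<phi> x)"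
    if "test_function U \<phi>" for \<phi>
    unfolding set_lebesgue_integral_def
  proof (intro Bochner_Integration.integral_cong refl)
    fix x
    show "indicator U x *\<^sub>R (V x \<bullet> grad \<phi> x) = V x \<bullet> grad \<phi> x"
    proof (cases "x \<in> U")
      case False
      then have "grad \<phi> x = 0" using test_functionD(3)[OF that] by (intro grad_outside_support) blast
      then show ?thesis by simp
    qed simp
  qed
  then show ?thesis by (auto simp: div_zero_on_def)
qed

section \<open>Hausdorff measure and ball covers\<close>

text \<open>Sums over finite subfamilies replace the series, so that finite index sets are allowed and
  \<open>s = 0\<close> is not an exception.\<close>

definition ball_covers :: "nat \<Rightarrow> 'a::metric_space set \<Rightarrow> real \<Rightarrow> nat \<Rightarrow> bool" where
  "ball_covers s A C K \<longleftrightarrow>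
     (\<exists>(I :: nat set) x k. A \<subseteq> (\<Union>n\<in>I. ball (x n) ((1/2) ^ k n)) \<and> (\<forall>n\<in>I. K \<le> k n) \<and>
        (\<forall>J. finite J \<longrightarrow> J \<subseteq> I \<longrightarrow> (\<Sum>n\<in>J. (1/2) ^ (k n * s)) \<le> C))"

text \<open>Rounds a radius up to a power of 1/2 by taking the least exponent whose successor power
  is below \<open>r\<close>; the loss is less than a factor 2. The upper bound on \<open>r\<close>
  keeps the chosen level at least \<open>K\<close>.\<close>

lemma dyadic_scale:
  fixes r :: real
  assumes "0 < r" "r \<le> (1/2) ^ K"
  obtains k where "K \<le> k" "(1/2) ^ Suc k < r" "r \<le> (1/2) ^ k"
proof -
  have ex: "\<exists>k. (1/2::real) ^ Suc k < r"
  proof -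
    obtain k where "(1/2::real) ^ k < r" using real_arch_pow_inv[OF assms(1), of "1/2"] by auto
    moreover have "(1/2::real) ^ Suc k \<le> (1/2) ^ k" by (rule power_decreasing) auto
    ultimately show ?thesis by (meson order_le_less_trans)
  qed
  define k where "k = (LEAST k. (1/2::real) ^ Suc k < r)"
  have 1: "(1/2::real) ^ Suc k < r" unfolding k_def using ex by (rule LeastI_ex)
  have "(1/2::real) ^ Suc k < (1/2) ^ K" using 1 assms by simp
  then have "K < Suc k" by (rule power_strict_decreasing_iff[THEN iffD1, rotated 2]) auto
  moreover have "r \<le> (1/2) ^ k"
  proof (cases k)
    case 0
    have "(1/2::real) ^ K \<le> 1" by (rule power_le_one) auto
    then show ?thesis using assms 0 by simp
  next
    case (Suc m)
    then have "m < k" by simp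
    then have "\<not> (1/2::real) ^ Suc m < r" unfolding k_def by (rule not_less_Least)
    then show ?thesis using Suc by simp
  qed
  ultimately show ?thesis using that[of k] 1 by simp
qed

lemma hausdorff_content_le_measure:
  assumes "s \<noteq> 0" "0 < \<delta>"
  shows "hausdorff_content s \<delta> A \<le> hausdorff_measure s A"
  using assms by (auto simp: hausdorff_measure_eq_SUP intro: SUP_upper)

text \<open>Near-optimal covers are rounded to dyadic radii. For s = 0 the measure counts points,
  and balls around the points themselves give the same bound at every scale.\<close>

lemma finite_hausdorff_measure_imp_ball_covers:
  fixes A :: "'a::metric_space set"
  assumes fin: "hausdorff_measure (real s) A < \<infinity>"
  shows "\<exists>C\<ge>0. \<forall>K. ball_covers s A C K"
proof (cases "s = 0")
  case True
  then have "emeasure (count_space UNIV) A < \<infinity>" using fin by (simp add: hausdorff_measure_def)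
  then have "finite A" using emeasure_count_space_infinite[of A UNIV] by (cases "finite A") auto
  then obtain x :: "nat \<Rightarrow> 'a" where x: "A = x ` {..<card A}"
    using ex_bij_betw_nat_finite[of A] by (metis bij_betw_imp_surj_on lessThan_atLeast0)
  have "ball_covers s A (real (card A)) K" for K
    unfolding ball_covers_def
  proof (intro exI conjI allI impI ballI)
    show "A \<subseteq> (\<Union>n\<in>{..<card A}. ball (x n) ((1/2) ^ (\<lambda>_. K) n))"
      by (subst x) auto
    show "(\<Sum>n\<in>J. (1/2) ^ (K * s)) \<le> real (card A)" if "finite J" "J \<subseteq> {..<card A}" for J
      using True card_mono[OF _ that(2)] by simp
  qed simp
  then show ?thesis by (intro exI[of _ "real (card A)"]) auto
next
  case False
  define \<omega> where "\<omega> = unit_ball_vol (real s)"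
  have \<omega>: "\<omega> > 0" by (simp add: \<omega>_def)
  obtain H where H: "hausdorff_measure (real s) A = ennreal H" "H \<ge> 0"
    using fin by (metis ennreal_cases infinity_ennreal_def order_less_irrefl)
  \<comment> \<open>2^s pays for rounding the radii, H + 1 leaves the strict slack that the infimum
    needs, and \<omega> is the normalisation of the measure.\<close>
  define C where "C = 2 ^ s * ((H + 1) / \<omega>)"
  have "ball_covers s A C K" for K
  proof -
    have "hausdorff_content (real s) ((1/2) ^ K) A \<le> ennreal H"
      using hausdorff_content_le_measure[of "real s" "(1/2)^K" A] False H by simp
    also have "\<dots> < ennreal (H + 1)" using H by (simp add: ennreal_less_iff)
    finally obtain x r where xr: "A \<subseteq> (\<Union>n. ball (x n) (r n))"
      "\<And>n. 0 \<le> r n" "\<And>n. r n \<le> (1/2) ^ K"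
      and sum: "(\<Sum>n. ennreal (\<omega> * r n powr real s)) < ennreal (H + 1)"
      unfolding hausdorff_content_def \<omega>_def by (auto simp: INF_less_iff)
    \<comment> \<open>A ball of radius 0 is empty, so discarding these indices keeps the cover and
      leaves only radii that can be rounded.\<close>
    define I where "I = {n. 0 < r n}"
    have "\<exists>k. K \<le> k \<and> (1/2) ^ Suc k < r n \<and> r n \<le> (1/2) ^ k" if "n \<in> I" for n
      using dyadic_scale[of "r n" K] xr(3)[of n] that by (auto simp: I_def)
    then obtain k where k: "\<And>n. n \<in> I \<Longrightarrow> K \<le> k n \<and> (1/2) ^ Suc (k n) < r n \<and> r n \<le> (1/2) ^ k n"
      by metis
    show ?thesis unfolding ball_covers_def
    proof (intro exI conjI allI impI ballI)
      show "A \<subseteq> (\<Union>n\<in>I. ball (x n) ((1/2) ^ k n))"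
      proof
        fix a assume "a \<in> A"
        then obtain n where n: "dist (x n) a < r n" using xr(1) by auto
        then have "n \<in> I" using zero_le_dist[of "x n" a] by (simp add: I_def del: zero_le_dist)
        then show "a \<in> (\<Union>n\<in>I. ball (x n) ((1/2) ^ k n))"
          using k[of n] n by (intro UN_I[of n]) auto
      qed
      show "K \<le> k n" if "n \<in> I" for n using k that by blast
      fix J :: "nat set" assume J: "finite J" "J \<subseteq> I"
      have "(\<Sum>n\<in>J. (1/2) ^ (k n * s)) \<le> (\<Sum>n\<in>J. 2 ^ s * (r n powr real s))"
      proof (rule sum_mono)
        fix n assume "n \<in> J"
        then have n: "n \<in> I" using J by auto
        have "(1/2::real) ^ (k n * s) = 2 ^ s * ((1/2) ^ Suc (k n)) ^ s"
          by (simp add: power_mult power_mult_distrib[symmetric] del: power_mult_distrib)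
        also have "\<dots> \<le> 2 ^ s * (r n ^ s)"
          using k[OF n] by (intro mult_left_mono power_mono) auto
        also have "r n ^ s = r n powr real s"
          using n by (simp add: I_def powr_realpow)
        finally show "(1/2::real) ^ (k n * s) \<le> 2 ^ s * (r n powr real s)" .
      qed
      also have "\<dots> = 2 ^ s * ((\<Sum>n\<in>J. \<omega> * r n powr real s) / \<omega>)"
        using \<omega> by (simp add: sum_distrib_left sum_divide_distrib)
      also have "\<dots> \<le> C"
      proof -
        have "ennreal (\<Sum>n\<in>J. \<omega> * r n powr real s) = (\<Sum>n\<in>J. ennreal (\<omega> * r n powr real s))"
          using \<omega> by (subst sum_ennreal) auto
        also have "\<dots> \<le> (\<Sum>n. ennreal (\<omega> * r n powr real s))"
          by (intro sum_le_suminf J) auto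
        also have "\<dots> \<le> ennreal (H + 1)" using sum by simp
        finally have "(\<Sum>n\<in>J. \<omega> * r n powr real s) \<le> H + 1" using H by (subst (asm) ennreal_le_iff) auto
        then show ?thesis unfolding C_def using \<omega> by (intro mult_left_mono divide_right_mono) auto
      qed
      finally show "(\<Sum>n\<in>J. (1/2) ^ (k n * s)) \<le> C" .
    qed
  qed
  moreover have "C \<ge> 0" using H \<omega> by (auto simp: C_def)
  ultimately show ?thesis by blast
qed

text \<open>For s > 0 the covers become admissible by padding with empty balls. For s = 0, once the
  radii are below half the least distance in a finite subset, each ball holds at most one of its
  points, so \<open>C\<close> bounds the cardinality of every finite subset.\<close>

lemma ball_covers_imp_finite_hausdorff_measure:
  fixes A :: "'a::metric_space set"
  assumes cov: "\<And>K. ball_covers s A C K"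
  shows "hausdorff_measure (real s) A < \<infinity>"
proof (cases "s = 0")
  case True
  have "card T \<le> nat \<lceil>C\<rceil>" if T: "T \<subseteq> A" "finite T" for T
  proof -
    define D where "D = (\<lambda>(a, b). dist a b) ` {(a, b). a \<in> T \<and> b \<in> T \<and> a \<noteq> b}"
    have finD: "finite D"
      unfolding D_def by (intro finite_imageI finite_subset[OF _ finite_cartesian_product[OF T(2) T(2)]]) auto
    obtain d where d: "d > 0" "\<And>a b. a \<in> T \<Longrightarrow> b \<in> T \<Longrightarrow> a \<noteq> b \<Longrightarrow> d \<le> dist a b"
    proof (cases "D = {}")
      case True
      show ?thesis by (rule that[of 1]) (use True in \<open>auto simp: D_def\<close>)
    next
      case False
      show ?thesis
      proof (rule that[of "Min D"])
        show "0 < Min D" using finD False by (subst Min_gr_iff) (auto simp: D_def)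
        show "Min D \<le> dist a b" if "a \<in> T" "b \<in> T" "a \<noteq> b" for a b
        proof (intro Min_le finD)
          show "dist a b \<in> D" unfolding D_def using that by (intro image_eqI[of _ _ "(a, b)"]) auto
        qed
      qed
    qed
    obtain K where K: "(1/2::real) ^ K < d / 2" using real_arch_pow_inv[of "d/2" "1/2"] d by auto
    from cov[of K] obtain I :: "nat set" and x k where
      I: "A \<subseteq> (\<Union>n\<in>I. ball (x n) ((1/2) ^ k n))" "\<And>n. n \<in> I \<Longrightarrow> K \<le> k n"
        "\<And>J. finite J \<Longrightarrow> J \<subseteq> I \<Longrightarrow> (\<Sum>n\<in>J. (1/2) ^ (k n * s)) \<le> C"
      unfolding ball_covers_def by auto
    have "\<forall>a\<in>T. \<exists>n\<in>I. dist (x n) a < (1/2) ^ k n" using I(1) T by fastforce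
    then obtain f where f: "\<And>a. a \<in> T \<Longrightarrow> f a \<in> I \<and> dist (x (f a)) a < (1/2) ^ k (f a)" by metis
    have inj: "inj_on f T"
    proof (rule inj_onI, rule ccontr)
      fix a b assume ab: "a \<in> T" "b \<in> T" "f a = f b" "a \<noteq> b"
      have "(1/2::real) ^ k (f a) \<le> (1/2) ^ K"
        using I(2) f ab by (intro power_decreasing) auto
      moreover have "dist a b \<le> dist (x (f a)) a + dist (x (f a)) b"
        by (metis dist_commute dist_triangle)
      moreover have "dist (x (f a)) a < (1/2) ^ k (f a)" "dist (x (f a)) b < (1/2) ^ k (f a)"
        using f[OF ab(1)] f[OF ab(2)] ab(3) by auto
      ultimately show False using d(2)[OF ab(1,2,4)] K by linarith
    qed
    have "real (card T) = (\<Sum>n\<in>f ` T. (1/2) ^ (k n * s))"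
      using True card_image[OF inj] by simp
    also have "\<dots> \<le> C" using f T by (intro I(3)) auto
    finally show ?thesis by linarith
  qed
  then have "finite A" using finite_if_finite_subsets_card_bdd[of A "nat \<lceil>C\<rceil>"] by blast
  then show ?thesis using True by (simp add: hausdorff_measure_def emeasure_count_space_finite less_top[symmetric])
next
  case False
  define \<omega> where "\<omega> = unit_ball_vol (real s)"
  have \<omega>: "\<omega> > 0" by (simp add: \<omega>_def)
  have "hausdorff_content (real s) \<delta> A \<le> ennreal (\<omega> * C)" if "\<delta> > 0" for \<delta>
  proof -
    obtain K where K: "(1/2::real) ^ K < \<delta>" using real_arch_pow_inv[OF \<open>\<delta> > 0\<close>, of "1/2"] by auto
    from cov[of K] obtain I :: "nat set" and x k where
      I: "A \<subseteq> (\<Union>n\<in>I. ball (x n) ((1/2) ^ k n))" "\<And>n. n \<in> I \<Longrightarrow> K \<le> k n"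
        "\<And>J. finite J \<Longrightarrow> J \<subseteq> I \<Longrightarrow> (\<Sum>n\<in>J. (1/2) ^ (k n * s)) \<le> C"
      unfolding ball_covers_def by auto
    define r :: "nat \<Rightarrow> real" where "r n = (if n \<in> I then (1/2) ^ k n else 0)" for n
    have "hausdorff_content (real s) \<delta> A \<le> (\<Sum>n. ennreal (\<omega> * r n powr real s))"
      unfolding hausdorff_content_def \<omega>_def
    proof (rule INF_lower2)
      show "(x, r) \<in> {(x, r). A \<subseteq> (\<Union>n. ball (x n) (r n)) \<and> (\<forall>n. 0 \<le> r n \<and> r n \<le> \<delta>)}"
      proof (clarify, intro conjI allI)
        show "A \<subseteq> (\<Union>n. ball (x n) (r n))" using I(1) by (fastforce simp: r_def)
        show "0 \<le> r n" for n by (simp add: r_def)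
        show "r n \<le> \<delta>" for n
        proof (cases "n \<in> I")
          case True
          have "(1/2::real) ^ k n \<le> (1/2) ^ K" using I(2)[OF True] by (intro power_decreasing) auto
          then have "(1/2) ^ k n \<le> \<delta>" using K by linarith
          then show ?thesis using True by (simp add: r_def)
        qed (use \<open>\<delta> > 0\<close> in \<open>simp add: r_def\<close>)
      qed
    qed simp
    also have "\<dots> \<le> ennreal (\<omega> * C)"
      unfolding suminf_eq_SUP
    proof (rule SUP_least)
      fix m
      have e: "r n powr real s = (if n \<in> I then (1/2) ^ (k n * s) else 0)" for n
        using False by (simp add: r_def powr_realpow power_mult)
      have "(\<Sum>n<m. ennreal (\<omega> * r n powr real s)) = ennreal (\<Sum>n<m. \<omega> * r n powr real s)"
        using \<omega> by (subst sum_ennreal) auto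
      also have "(\<Sum>n<m. \<omega> * r n powr real s) = \<omega> * (\<Sum>n\<in>{..<m} \<inter> I. (1/2) ^ (k n * s))"
        by (simp add: e sum_distrib_left sum.inter_restrict if_distrib cong: if_cong)
      also have "\<dots> \<le> \<omega> * C" using \<omega> by (intro mult_left_mono I(3)) auto
      finally show "(\<Sum>n<m. ennreal (\<omega> * r n powr real s)) \<le> ennreal (\<omega> * C)"
        by (simp add: ennreal_leI)
    qed
    finally show ?thesis .
  qed
  then have "hausdorff_measure (real s) A \<le> ennreal (\<omega> * C)"
    using False by (auto simp: hausdorff_measure_eq_SUP intro: SUP_least)
  then show ?thesis by (simp add: le_less_trans)
qed

lemma ball_covers_mono: "A \<subseteq> B \<Longrightarrow> ball_covers s B C K \<Longrightarrow> ball_covers s A C K"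
  unfolding ball_covers_def by (meson order_trans)

text \<open>The bound \<open>C n\<close> may vary with the piece but not with the scale
  \<open>K\<close>; in this form finiteness of the measure enters the removability proof. Equality
  weakens to inclusion since ball covers pass to subsets.\<close>

lemma hausdorff_sigma_finite_iff:
  "hausdorff_sigma_finite (real s) S \<longleftrightarrow>
     (\<exists>A C. S \<subseteq> (\<Union>n. A n) \<and> (\<forall>n :: nat. 0 \<le> C n \<and> (\<forall>K. ball_covers s (A n) (C n) K)))"
proof
  assume "hausdorff_sigma_finite (real s) S"
  then obtain A where A: "S = (\<Union>n. A n)" "\<And>n :: nat. hausdorff_measure (real s) (A n) < \<infinity>"
    unfolding hausdorff_sigma_finite_def by blast
  then have "\<exists>C\<ge>0. \<forall>K. ball_covers s (A n) C K" for n
    by (intro finite_hausdorff_measure_imp_ball_covers)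
  then show "\<exists>A C. S \<subseteq> (\<Union>n. A n) \<and> (\<forall>n :: nat. 0 \<le> C n \<and> (\<forall>K. ball_covers s (A n) (C n) K))"
    using A(1) by (metis order_refl)
next
  assume "\<exists>A C. S \<subseteq> (\<Union>n. A n) \<and> (\<forall>n :: nat. 0 \<le> C n \<and> (\<forall>K. ball_covers s (A n) (C n) K))"
  then obtain A C where A1: "S \<subseteq> (\<Union>n. A n)"
    and A2: "\<forall>n :: nat. 0 \<le> C n \<and> (\<forall>K. ball_covers s (A n) (C n) K)"
    by (elim exE conjE)
  have "S = (\<Union>n. A n \<inter> S)" using A1 by auto
  moreover have "hausdorff_measure (real s) (A n \<inter> S) < \<infinity>" for n
    using A2 by (intro ball_covers_imp_finite_hausdorff_measure[where C = "C n"]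
        ball_covers_mono[of "A n \<inter> S" "A n"]) auto
  ultimately show "hausdorff_sigma_finite (real s) S"
    unfolding hausdorff_sigma_finite_def by (intro exI[of _ "\<lambda>n. A n \<inter> S"]) auto
qed

lemma hausdorff_sigma_finite_subset:
  "hausdorff_sigma_finite (real s) B \<Longrightarrow> A \<subseteq> B \<Longrightarrow> hausdorff_sigma_finite (real s) A"
  unfolding hausdorff_sigma_finite_iff by (meson order_trans)

lemma hausdorff_sigma_finite_UN:
  assumes "\<And>n :: nat. hausdorff_sigma_finite t (B n)"
  shows "hausdorff_sigma_finite t (\<Union>n. B n)"
proof -
  from assms obtain A where A: "\<And>n. B n = (\<Union>m. A n m)" "\<And>n m :: nat. hausdorff_measure t (A n m) < \<infinity>"
    unfolding hausdorff_sigma_finite_def by metis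
  have "(\<Union>n. B n) = (\<Union>i. case_prod A (prod_decode i))"
  proof (intro equalityI subsetI)
    fix x assume "x \<in> (\<Union>n. B n)"
    then obtain n m where "x \<in> A n m" using A by auto
    then show "x \<in> (\<Union>i. case_prod A (prod_decode i))"
      by (intro UN_I[of "prod_encode (n, m)"]) auto
  next
    fix x assume "x \<in> (\<Union>i. case_prod A (prod_decode i))"
    then obtain i where "x \<in> case_prod A (prod_decode i)" by (rule UN_E)
    then show "x \<in> (\<Union>n. B n)" by (cases "prod_decode i") (auto simp: A(1))
  qed
  then show ?thesis
    unfolding hausdorff_sigma_finite_def using A(2)
    by (intro exI[of _ "\<lambda>i. case_prod A (prod_decode i)"]) (auto split: prod.splits)
qed

lemma hausdorff_sigma_finite_Un:
  assumes "hausdorff_sigma_finite t A" "hausdorff_sigma_finite t B"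
  shows "hausdorff_sigma_finite t (A \<union> B)"
proof -
  have "(\<Union>n :: nat. if n = 0 then A else B) = A \<union> B" by auto
  then show ?thesis using hausdorff_sigma_finite_UN[of t "\<lambda>n. if n = 0 then A else B"] assms by auto
qed

section \<open>Smoothed indicators of dyadic cubes\<close>

lemma partial_deriv_unique:
  fixes f :: "real ^ 'n \<Rightarrow> real"
  assumes "smooth f" "((\<lambda>t. f (x + t *\<^sub>R axis i 1)) has_real_derivative d) (at 0)"
  shows "partial_deriv i f x = d"
  using has_derivative_partial_deriv[OF smooth_differentiable[OF assms(1)], of x i 0] assms(2)
  by (auto dest: DERIV_unique)

text \<open>Only the part of the support inside \<open>D\<close> has to lie in \<open>U\<close>:
  multiplying by the bump of a cube away from \<open>S\<close> turns a test function on the whole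
  space into one on the complement of \<open>S\<close>.\<close>

lemma test_function_mult:
  assumes "test_function UNIV \<phi>" "smooth g" "closed D" "\<And>x. x \<notin> D \<Longrightarrow> g x = 0"
    "closure {x. \<phi> x \<noteq> 0} \<inter> D \<subseteq> U"
  shows "test_function U (\<lambda>x. \<phi> x * g x)"
proof -
  note t = test_functionD[OF assms(1)]
  have "{x. \<phi> x * g x \<noteq> 0} \<subseteq> closure {x. \<phi> x \<noteq> 0} \<inter> D"
    using closure_subset[of "{x. \<phi> x \<noteq> 0}"] assms(4) by auto
  then have sub: "closure {x. \<phi> x * g x \<noteq> 0} \<subseteq> closure {x. \<phi> x \<noteq> 0} \<inter> D"
    using assms(3) by (intro closure_minimal) auto
  have "compact (closure {x. \<phi> x \<noteq> 0} \<inter> closure {x. \<phi> x * g x \<noteq> 0})"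
    using t(2) by (rule compact_Int_closed) (rule closed_closure)
  moreover have "closure {x. \<phi> x \<noteq> 0} \<inter> closure {x. \<phi> x * g x \<noteq> 0} = closure {x. \<phi> x * g x \<noteq> 0}"
    using sub by (intro Int_absorb1) (erule order_trans, rule Int_lower1)
  ultimately have "compact (closure {x. \<phi> x * g x \<noteq> 0})"
    by (simp only:)
  moreover have "smooth (\<lambda>x. \<phi> x * g x)" using t(1) assms(2) by (rule smooth_mult)
  ultimately show ?thesis using sub assms(5) unfolding test_function_def by auto
qed

lemma C_class_sum:
  "finite A \<Longrightarrow> (\<And>a. a \<in> A \<Longrightarrow> C_class k (f a)) \<Longrightarrow> C_class k (\<lambda>x. \<Sum>a\<in>A. f a x)"
  by (induction A rule: finite_induct) (auto intro: C_class_const C_class_add)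

lemma integral_grad_sum:
  assumes V: "continuous_on UNIV V" and fin: "finite Z"
    and test: "\<And>z. z \<in> Z \<Longrightarrow> test_function UNIV (\<psi> z)"
  shows "(LINT x|lborel. V x \<bullet> grad (\<lambda>x. \<Sum>z\<in>Z. \<psi> z x) x) = (\<Sum>z\<in>Z. LINT x|lborel. V x \<bullet> grad (\<psi> z) x)"
proof -
  note sm = test_functionD(1)[OF test]
  have smooth: "smooth (\<lambda>x. \<Sum>z\<in>Z. \<psi> z x)"
    using sm fin by (auto simp: smooth_def intro: C_class_sum)
  have "grad (\<lambda>x. \<Sum>z\<in>Z. \<psi> z x) x = (\<Sum>z\<in>Z. grad (\<psi> z) x)" for x
    unfolding vec_eq_iff
  proof
    fix i
    have "((\<lambda>t. \<Sum>z\<in>Z. \<psi> z (x + t *\<^sub>R axis i 1)) has_real_derivative (\<Sum>z\<in>Z. partial_deriv i (\<psi> z) x)) (at 0)"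
      using has_derivative_partial_deriv[OF smooth_differentiable[OF sm], of _ x i 0]
      by (intro DERIV_sum) simp
    then show "grad (\<lambda>x. \<Sum>z\<in>Z. \<psi> z x) x $ i = (\<Sum>z\<in>Z. grad (\<psi> z) x) $ i"
      by (simp add: partial_deriv_unique[OF smooth])
  qed
  then show ?thesis
    using integrable_inner_grad[OF V test] by (simp add: inner_sum_right)
qed

text \<open>At level \<open>k\<close> the index \<open>z\<close> stands for the dyadic cube with lower corner \<open>z / 2^k\<close> and side
  \<open>1 / 2^k\<close>; then \<open>half z\<close> is the index of its parent at level \<open>k - 1\<close>.\<close>

definition half :: "('n \<Rightarrow> int) \<Rightarrow> 'n \<Rightarrow> int" where
  "half z = (\<lambda>i. z i div 2)"

lemma half_fibre: "{z'. half z' = z} = PiE UNIV (\<lambda>i. {2 * z i, 2 * z i + 1})"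
proof -
  have *: "m div 2 = l \<longleftrightarrow> m = 2 * l \<or> m = 2 * l + 1" for m l :: int by presburger
  show ?thesis by (auto simp: half_def fun_eq_iff PiE_def Pi_def *)
qed

lemma finite_half_fibre: "finite {z'. half z' = (z :: 'n::finite \<Rightarrow> int)}"
  unfolding half_fibre by (intro finite_PiE) auto

locale smooth_step =
  fixes P P' :: "real \<Rightarrow> real" and L :: real
  assumes C_line_P: "\<And>k. C_line k P"
    and DERIV_P: "\<And>t. (P has_real_derivative P' t) (at t)"
    and P_0: "\<And>t. t \<le> 0 \<Longrightarrow> P t = 0"
    and P_1: "\<And>t. t \<ge> 1 \<Longrightarrow> P t = 1"
    and mono_P: "mono P"
    and P'_nonneg: "\<And>t. 0 \<le> P' t"
    and P'_le: "\<And>t. P' t \<le> L"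
    and P'_0: "\<And>t. t \<notin> {0..1} \<Longrightarrow> P' t = 0"
begin

lemma P_bounds: "0 \<le> P t" "P t \<le> 1"
  using monoD[OF mono_P, of "min t 0" t] monoD[OF mono_P, of t "max t 1"] P_0[of "min t 0"] P_1[of "max t 1"]
  by auto

lemma L_nonneg: "0 \<le> L"
  using P'_nonneg[of 0] P'_le[of 0] by simp

text \<open>Written as a difference of two shifted steps so that cutoffs of adjacent intervals
  telescope exactly. It rises on [a, a + e] and falls on [b, b + e], hence supports spill over on
  the upper side only.\<close>

definition cutoff :: "real \<Rightarrow> real \<Rightarrow> real \<Rightarrow> real \<Rightarrow> real" where
  "cutoff e a b t = P ((t - a) / e) - P ((t - b) / e)"

definition cutoff' :: "real \<Rightarrow> real \<Rightarrow> real \<Rightarrow> real \<Rightarrow> real" where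
  "cutoff' e a b t = (P' ((t - a) / e) - P' ((t - b) / e)) / e"

context
  fixes e :: real
  assumes e: "e > 0"
begin

lemma DERIV_cutoff: "(cutoff e a b has_real_derivative cutoff' e a b t) (at t)"
  unfolding cutoff_def cutoff'_def
  by (rule DERIV_cong[OF DERIV_diff[OF DERIV_chain2[OF DERIV_P] DERIV_chain2[OF DERIV_P]]])
    (use e in \<open>auto intro!: derivative_eq_intros simp: diff_divide_distrib\<close>)

lemma C_line_cutoff: "C_line k (cutoff e a b)"
proof -
  have "C_line k (\<lambda>t. P (1 / e * t + (- a / e)) + (-1) * P (1 / e * t + (- b / e)))"
    by (intro C_line_add C_line_mult C_line_const C_line_affine C_line_P)
  moreover have "(\<lambda>t. P (1 / e * t + (- a / e)) + (-1) * P (1 / e * t + (- b / e))) = cutoff e a b"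
    by (rule ext) (simp add: cutoff_def diff_divide_distrib)
  ultimately show ?thesis by simp
qed

lemma cutoff_nonneg: "a \<le> b \<Longrightarrow> 0 \<le> cutoff e a b t"
  using e unfolding cutoff_def by (auto intro!: monoD[OF mono_P] divide_right_mono)

lemma cutoff_le_1: "cutoff e a b t \<le> 1"
  using P_bounds unfolding cutoff_def by (smt (verit))

lemma cutoff_outside: "a \<le> b \<Longrightarrow> t \<notin> {a..b + e} \<Longrightarrow> cutoff e a b t = 0"
proof -
  assume ab: "a \<le> b" "t \<notin> {a..b + e}"
  then consider "t < a" | "t > b + e" by force
  then show ?thesis
  proof cases
    case 1
    then show ?thesis using e ab by (simp add: cutoff_def P_0 divide_nonpos_pos)
  next
    case 2
    then show ?thesis using e ab by (simp add: cutoff_def P_1 field_simps)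
  qed
qed

lemma cutoff_eq_1: "a + e \<le> t \<Longrightarrow> t \<le> b \<Longrightarrow> cutoff e a b t = 1"
  using e by (simp add: cutoff_def P_0 P_1 field_simps divide_nonpos_pos)

lemma cutoff'_bound:
  "\<bar>cutoff' e a b t\<bar> \<le> L / e * (indicator {a..a + e} t + indicator {b..b + e} t)"
proof -
  have *: "P' ((t - c) / e) \<le> L * indicator {c..c + e} t" for c
    using e P'_le[of "(t - c) / e"] P'_0[of "(t - c) / e"]
    by (auto simp: indicator_def field_simps)
  have "\<bar>P' ((t - a) / e) - P' ((t - b) / e)\<bar> \<le> P' ((t - a) / e) + P' ((t - b) / e)"
    using P'_nonneg by (smt (verit))
  also have "\<dots> \<le> L * (indicator {a..a + e} t + indicator {b..b + e} t)"
    using *[of a] *[of b] by (simp add: distrib_left)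
  finally show ?thesis
    using e unfolding cutoff'_def abs_divide by (simp add: divide_right_mono)
qed

end

lemma sum_cutoff:
  "(\<Sum>m\<in>{-int R..<int R}. cutoff e (real_of_int m) (real_of_int m + 1) t) = cutoff e (- real R) (real R) t"
proof -
  have "(\<Sum>m\<in>{a..<a + int n}. cutoff e (real_of_int m) (real_of_int m + 1) t) = cutoff e (real_of_int a) (real_of_int a + real n) t" for a n
  proof (induction n)
    case 0
    then show ?case by (simp add: cutoff_def)
  next
    case (Suc n)
    have "{a..<a + int (Suc n)} = insert (a + int n) {a..<a + int n}" by auto
    then show ?case using Suc by (simp add: cutoff_def algebra_simps)
  qed
  from this[of "- int R" "2 * R"] show ?thesis by simp
qed

text \<open>The smoothing width \<open>e\<close> is the same at all levels, so that a bump is exactly the sum of the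
  bumps of its children.\<close>

definition gbump :: "real \<Rightarrow> nat \<Rightarrow> ('n \<Rightarrow> int) \<Rightarrow> real ^ 'n \<Rightarrow> real" where
  "gbump e k z x = (\<Prod>i\<in>UNIV. cutoff e (real_of_int (z i) / 2 ^ k) ((real_of_int (z i) + 1) / 2 ^ k) (x $ i))"

definition gbox :: "real \<Rightarrow> nat \<Rightarrow> ('n \<Rightarrow> int) \<Rightarrow> (real ^ 'n) set" where
  "gbox e k z = cbox (\<chi> i. real_of_int (z i) / 2 ^ k) (\<chi> i. (real_of_int (z i) + 1) / 2 ^ k + e)"

lemma mem_gbox: "x \<in> gbox e k z \<longleftrightarrow> (\<forall>i. real_of_int (z i) / 2 ^ k \<le> x $ i \<and> x $ i \<le> (real_of_int (z i) + 1) / 2 ^ k + e)"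
  by (simp add: gbox_def mem_box_cart)

lemma closed_gbox: "closed (gbox e k z)"
  by (simp add: gbox_def closed_cbox)

lemma gbox_half: "gbox e (Suc k) z \<subseteq> gbox e k (half z)"
proof
  fix x assume x: "x \<in> gbox e (Suc k) z"
  show "x \<in> gbox e k (half z)"
    unfolding mem_gbox
  proof
    fix i
    have d: "2 * (z i div 2) \<le> z i" "z i + 1 \<le> 2 * (z i div 2 + 1)" by presburger+
    have "real_of_int (z i div 2) / 2 ^ k = real_of_int (2 * (z i div 2)) / 2 ^ Suc k" by simp
    also have "\<dots> \<le> real_of_int (z i) / 2 ^ Suc k" using d by (intro divide_right_mono) (linarith, simp)
    finally have 1: "real_of_int (z i div 2) / 2 ^ k \<le> real_of_int (z i) / 2 ^ Suc k" .
    have "(real_of_int (z i) + 1) / 2 ^ Suc k \<le> real_of_int (2 * (z i div 2 + 1)) / 2 ^ Suc k"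
      using d by (intro divide_right_mono) (linarith, simp)
    also have "\<dots> = (real_of_int (z i div 2) + 1) / 2 ^ k"
      by (simp add: field_simps)
    finally have 2: "(real_of_int (z i) + 1) / 2 ^ Suc k \<le> (real_of_int (z i div 2) + 1) / 2 ^ k" .
    show "real_of_int (half z i) / 2 ^ k \<le> x $ i \<and> x $ i \<le> (real_of_int (half z i) + 1) / 2 ^ k + e"
      using x[unfolded mem_gbox, rule_format, of i] 1 2 by (auto simp: half_def)
  qed
qed

lemma gbump_half: "gbump e k z x = (\<Sum>z'\<in>{z'. half z' = z}. gbump e (Suc k) z' x)"
proof -
  have "cutoff e (real_of_int (z i) / 2 ^ k) ((real_of_int (z i) + 1) / 2 ^ k) t =
      (\<Sum>m\<in>{2 * z i, 2 * z i + 1}. cutoff e (real_of_int m / 2 ^ Suc k) ((real_of_int m + 1) / 2 ^ Suc k) t)" for i t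
  proof -
    have "real_of_int (z i) / 2 ^ k = real_of_int (2 * z i) / 2 ^ Suc k"
      "(real_of_int (z i) + 1) / 2 ^ k = (real_of_int (2 * z i + 1) + 1) / 2 ^ Suc k"
      "(real_of_int (2 * z i) + 1) / 2 ^ Suc k = real_of_int (2 * z i + 1) / 2 ^ Suc k"
      by (simp_all add: field_simps)
    then show ?thesis by (simp add: cutoff_def)
  qed
  then show ?thesis
    unfolding gbump_def half_fibre by (simp only:) (rule prod_sum_PiE, auto)
qed

context
  fixes e :: real
  assumes e: "e > 0"
begin

lemma smooth_gbump: "smooth (gbump e k z)"
  unfolding gbump_def
  by (intro smooth_prod) (auto simp: smooth_def intro!: C_class_coordinate C_line_cutoff e)

lemma cutoff_args_mono: "real_of_int m / 2 ^ k \<le> (real_of_int m + 1) / 2 ^ k"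
  by (intro divide_right_mono) auto

lemma gbump_outside: "x \<notin> gbox e k z \<Longrightarrow> gbump e k z x = 0"
  using cutoff_outside[OF e cutoff_args_mono]
  by (auto simp: gbump_def mem_gbox)

lemma gbump_bounds: "0 \<le> gbump e k z x" "gbump e k z x \<le> 1"
  unfolding gbump_def using cutoff_nonneg[OF e cutoff_args_mono] cutoff_le_1[OF e]
  by (auto intro!: prod_nonneg prod_le_1)

text \<open>A slab of thickness \<open>e\<close> in which the i-th factor of a bump changes. Its
  volume is \<open>e\<close> times a face area, which cancels the slope L / e; therefore the
  gradient integral of a bump does not blow up as the smoothing width shrinks.\<close>

definition layer :: "nat \<Rightarrow> ('n \<Rightarrow> int) \<Rightarrow> 'n \<Rightarrow> real \<Rightarrow> (real ^ 'n) set" where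
  "layer k z i c = cbox (\<chi> j. if j = i then c else real_of_int (z j) / 2 ^ k)
      (\<chi> j. if j = i then c + e else (real_of_int (z j) + 1) / 2 ^ k + e)"

lemma partial_deriv_gbump_bound:
  "\<bar>partial_deriv i (gbump e k z) x\<bar> \<le>
     L / e * (indicator (layer k z i (real_of_int (z i) / 2 ^ k)) x + indicator (layer k z i ((real_of_int (z i) + 1) / 2 ^ k)) x)"
proof -
  define c where "c j = cutoff e (real_of_int (z j) / 2 ^ k) ((real_of_int (z j) + 1) / 2 ^ k)" for j
  define c' where "c' = cutoff' e (real_of_int (z i) / 2 ^ k) ((real_of_int (z i) + 1) / 2 ^ k) (x $ i)"
  define p where "p = (\<Prod>j\<in>UNIV - {i}. c j (x $ j))"
  have p: "0 \<le> p" "p \<le> 1"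
    unfolding p_def c_def using cutoff_nonneg[OF e cutoff_args_mono] cutoff_le_1[OF e]
    by (auto intro!: prod_nonneg prod_le_1)
  have "gbump e k z (x + t *\<^sub>R axis i 1) = c i (x $ i + t) * p" for t
  proof -
    have "gbump e k z (x + t *\<^sub>R axis i 1) = c i ((x + t *\<^sub>R axis i 1) $ i) * (\<Prod>j\<in>UNIV - {i}. c j ((x + t *\<^sub>R axis i 1) $ j))"
      unfolding gbump_def c_def by (subst prod.remove[of UNIV i]) auto
    also have "(\<Prod>j\<in>UNIV - {i}. c j ((x + t *\<^sub>R axis i 1) $ j)) = p"
      unfolding p_def by (intro prod.cong) (auto simp: axis_def)
    finally show ?thesis by (simp add: axis_def)
  qed
  moreover have "((\<lambda>t. c i (x $ i + t) * p) has_real_derivative c' * p) (at 0)"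
    unfolding c_def c'_def
    by (rule DERIV_cmult_right, rule DERIV_chain2[OF DERIV_cutoff[OF e], THEN DERIV_cong])
      (auto intro!: derivative_eq_intros)
  ultimately have eq: "partial_deriv i (gbump e k z) x = c' * p"
    by (intro partial_deriv_unique smooth_gbump) simp
  have b: "\<bar>c'\<bar> \<le> L / e * (indicator {real_of_int (z i) / 2 ^ k..real_of_int (z i) / 2 ^ k + e} (x $ i) + indicator {(real_of_int (z i) + 1) / 2 ^ k..(real_of_int (z i) + 1) / 2 ^ k + e} (x $ i))"
    unfolding c'_def by (rule cutoff'_bound[OF e])
  show ?thesis
  proof (cases "\<forall>j. j \<noteq> i \<longrightarrow> x $ j \<in> {real_of_int (z j) / 2 ^ k..(real_of_int (z j) + 1) / 2 ^ k + e}")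
    case True
    have "indicator (layer k z i d) x = (indicator {d..d + e} (x $ i) :: real)" for d
      using True by (auto simp: layer_def mem_box_cart indicator_def split: if_splits)
    moreover have "\<bar>c' * p\<bar> \<le> \<bar>c'\<bar>" using p by (simp add: abs_mult mult_left_le)
    ultimately show ?thesis using b eq by simp
  next
    case False
    then obtain j where "j \<noteq> i" "x $ j \<notin> {real_of_int (z j) / 2 ^ k..(real_of_int (z j) + 1) / 2 ^ k + e}" by auto
    then have "p = 0"
      using cutoff_outside[OF e cutoff_args_mono] unfolding p_def c_def
      by (intro prod_zero) auto
    then show ?thesis using eq L_nonneg e by simp
  qed
qed

lemma measure_layer:
  "measure lborel (layer k (z :: 'n::finite \<Rightarrow> int) i c) = e * (1 / 2 ^ k + e) ^ (CARD('n) - 1)"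
proof -
  have "layer k z i c \<noteq> {}"
    using e by (auto simp: layer_def interval_ne_empty_cart add_increasing2 divide_right_mono)
  moreover have "(if j = i then c + e else (real_of_int (z j) + 1) / 2 ^ k + e) -
      (if j = i then c else real_of_int (z j) / 2 ^ k) = (if j = i then e else 1 / 2 ^ k + e)" for j
    by (simp add: add_divide_distrib)
  ultimately have "measure lborel (layer k z i c) = (\<Prod>j\<in>UNIV. if j = i then e else 1 / 2 ^ k + e)"
    unfolding layer_def by (subst content_cbox_cart) simp_all
  also have "\<dots> = e * (\<Prod>j\<in>UNIV - {i}. 1 / 2 ^ k + e)"
    by (subst prod.remove[of UNIV i]) (auto intro!: prod.cong)
  finally show ?thesis by (simp add: card_Diff_singleton)
qed

lemma measure_gbox:
  "measure lborel (gbox e k (z :: 'n::finite \<Rightarrow> int)) = (1 / 2 ^ k + e) ^ CARD('n)"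
proof -
  have "gbox e k z \<noteq> {}"
    using e by (auto simp: gbox_def interval_ne_empty_cart add_increasing2 divide_right_mono)
  then show ?thesis
    unfolding gbox_def by (subst content_cbox_cart) (auto simp: add_divide_distrib)
qed

end

text \<open>After subtracting \<open>c\<close>, the integrand is at most \<open>w\<close> times the
  size of the gradient, whose integral is of the order of a face, (1/2)^(k s). The bound is uniform
  in \<open>e\<close>, so one smoothing width can serve all coarser levels.\<close>

lemma integral_gbump_bound:
  fixes V :: "real ^ 'n \<Rightarrow> real ^ 'n"
  assumes e: "0 < e" "e \<le> 1 / 2 ^ k"
    and V: "continuous_on UNIV V" and \<phi>: "test_function UNIV \<phi>"
    and B: "\<And>x. \<bar>\<phi> x\<bar> \<le> B" "\<And>i x. \<bar>partial_deriv i \<phi> x\<bar> \<le> B"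
    and osc: "\<And>x. x \<in> gbox e k z \<Longrightarrow> norm (V x - c) \<le> w" and w: "0 \<le> w"
  shows "\<bar>LINT x|lborel. V x \<bullet> grad (\<lambda>x. \<phi> x * gbump e k z x) x\<bar>
    \<le> real CARD('n) * B * (2 + 2 * L) * 2 ^ (CARD('n) - 1) * w * (1/2) ^ (k * (CARD('n) - 1))"
proof -
  define s where "s = CARD('n) - 1"
  have N: "CARD('n) = Suc s" by (simp add: s_def)
  define \<psi> where "\<psi> = (\<lambda>x. \<phi> x * gbump e k z x)"
  have \<psi>: "test_function UNIV \<psi>"
    unfolding \<psi>_def
    by (rule test_function_mult[OF \<phi> smooth_gbump[OF e(1)] closed_gbox gbump_outside[OF e(1)]]) auto
  have B0: "0 \<le> B" using order_trans[OF abs_ge_zero B(1)] .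
  define lo where "lo i = layer e k z i (real_of_int (z i) / 2 ^ k)" for i
  define hi where "hi i = layer e k z i ((real_of_int (z i) + 1) / 2 ^ k)" for i
  define b where "b i x = B * indicator (gbox e k z) x + B * (L / e * (indicator (lo i) x + indicator (hi i) x))" for i x
  have b0: "0 \<le> b i x" for i x using B0 L_nonneg e by (simp add: b_def)
  have pd: "\<bar>partial_deriv i \<psi> x\<bar> \<le> b i x" for i x
  proof -
    have "partial_deriv i \<psi> x = \<phi> x * partial_deriv i (gbump e k z) x + partial_deriv i \<phi> x * gbump e k z x"
      unfolding \<psi>_def
      by (subst partial_deriv_mult) (auto intro!: smooth_differentiable smooth_gbump e test_functionD[OF \<phi>])
    also have "\<bar>\<dots>\<bar> \<le> \<bar>\<phi> x\<bar> * \<bar>partial_deriv i (gbump e k z) x\<bar> + \<bar>partial_deriv i \<phi> x\<bar> * \<bar>gbump e k z x\<bar>"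
      by (metis abs_mult abs_triangle_ineq)
    also have "\<dots> \<le> B * (L / e * (indicator (lo i) x + indicator (hi i) x)) + B * indicator (gbox e k z) x"
    proof (intro add_mono mult_mono B B0)
      show "\<bar>partial_deriv i (gbump e k z) x\<bar> \<le> L / e * (indicator (lo i) x + indicator (hi i) x)"
        unfolding lo_def hi_def by (rule partial_deriv_gbump_bound[OF e(1)])
      show "\<bar>gbump e k z x\<bar> \<le> indicator (gbox e k z) x"
        using gbump_bounds[OF e(1), of k z x] gbump_outside[OF e(1), of x k z]
        by (auto simp: indicator_def)
    qed auto
    finally show ?thesis by (simp add: b_def add.commute)
  qed
  have \<psi>_out: "partial_deriv i \<psi> x = 0" if "x \<notin> gbox e k z" for i x
  proof (rule partial_deriv_outside_support)
    have "{x. \<psi> x \<noteq> 0} \<subseteq> gbox e k z"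
      using gbump_outside[OF e(1)] by (auto simp: \<psi>_def)
    then show "x \<notin> closure {x. \<psi> x \<noteq> 0}"
      using closure_minimal[OF _ closed_gbox] that by blast
  qed
  have fin: "emeasure lborel (gbox e k z) < \<infinity>" "emeasure lborel (lo i) < \<infinity>" "emeasure lborel (hi i) < \<infinity>" for i
    unfolding gbox_def lo_def hi_def layer_def[OF e(1)] by (rule emeasure_lborel_cbox_finite)+
  have meas: "gbox e k z \<in> sets lborel" "lo i \<in> sets lborel" "hi i \<in> sets lborel" for i
    by (auto simp: gbox_def lo_def hi_def layer_def[OF e(1)])
  have int_b: "integrable lborel (b i)" for i
    unfolding b_def using fin meas by (intro Bochner_Integration.integrable_add integrable_mult_right integrable_real_indicator) auto
  have bi: "(LINT x|lborel. b i x) \<le> B * (2 + 2 * L) * 2 ^ s * (1/2) ^ (k * s)" for i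
  proof -
    have "(LINT x|lborel. b i x) = B * measure lborel (gbox e k z) + B * (L / e * (measure lborel (lo i) + measure lborel (hi i)))"
      unfolding b_def using fin meas by (simp add: integrable_real_indicator)
    also have "\<dots> = B * (1 / 2 ^ k + e) ^ Suc s + B * (L * (2 * (1 / 2 ^ k + e) ^ s))"
      unfolding lo_def hi_def measure_gbox[OF e(1)] measure_layer[OF e(1)]
      using e by (simp add: N field_simps)
    also have "\<dots> = B * ((1 / 2 ^ k + e) ^ s * (1 / 2 ^ k + e + 2 * L))"
      by (simp add: algebra_simps)
    \<comment> \<open>The assumption on \<open>e\<close> gives 1/2^k + e \<le> 2/2^k inside the
      power, and at most 2 in the remaining factor.\<close>
    also have "\<dots> \<le> B * ((2 * (1 / 2 ^ k)) ^ s * (2 + 2 * L))"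
    proof (intro mult_left_mono mult_mono power_mono B0)
      have "(1::real) / 2 ^ k \<le> 1" by simp
      then show "1 / 2 ^ k + e + 2 * L \<le> 2 + 2 * L" using e by linarith
    qed (use e L_nonneg in auto)
    also have "\<dots> = B * (2 + 2 * L) * 2 ^ s * (1/2) ^ (k * s)"
      by (simp add: power_mult_distrib power_mult power_divide)
    finally show ?thesis .
  qed
  have int1: "integrable lborel (\<lambda>x. V x \<bullet> grad \<psi> x)" "integrable lborel (\<lambda>x. (V x - c) \<bullet> grad \<psi> x)" "integrable lborel (\<lambda>x. c \<bullet> grad \<psi> x)"
    by (auto intro!: integrable_inner_grad[OF _ \<psi>] continuous_intros V)
  have "(LINT x|lborel. V x \<bullet> grad \<psi> x) = (LINT x|lborel. (V x - c) \<bullet> grad \<psi> x) + (LINT x|lborel. c \<bullet> grad \<psi> x)"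
    using int1 by (simp add: inner_diff_left)
  also have "\<dots> = (LINT x|lborel. (V x - c) \<bullet> grad \<psi> x)"
    using integral_const_grad[OF \<psi>] by simp
  finally have "\<bar>LINT x|lborel. V x \<bullet> grad \<psi> x\<bar> = \<bar>LINT x|lborel. (V x - c) \<bullet> grad \<psi> x\<bar>" by simp
  also have "\<dots> \<le> (LINT x|lborel. \<bar>(V x - c) \<bullet> grad \<psi> x\<bar>)" by (rule integral_abs_bound)
  also have "\<dots> \<le> (LINT x|lborel. w * (\<Sum>i\<in>UNIV. b i x))"
  proof (intro integral_mono integrable_mult_right Bochner_Integration.integrable_sum int_b integrable_abs int1)
    fix x
    show "\<bar>(V x - c) \<bullet> grad \<psi> x\<bar> \<le> w * (\<Sum>i\<in>UNIV. b i x)"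
    proof (cases "x \<in> gbox e k z")
      case True
      have "\<bar>(V x - c) \<bullet> grad \<psi> x\<bar> \<le> norm (V x - c) * norm (grad \<psi> x)" by (rule Cauchy_Schwarz_ineq2)
      also have "\<dots> \<le> norm (V x - c) * (\<Sum>i\<in>UNIV. b i x)"
      proof (intro mult_left_mono)
        have "norm (grad \<psi> x) \<le> (\<Sum>i\<in>UNIV. \<bar>partial_deriv i \<psi> x\<bar>)"
          using norm_le_l1_cart[of "grad \<psi> x"] by simp
        also have "\<dots> \<le> (\<Sum>i\<in>UNIV. b i x)" by (intro sum_mono pd)
        finally show "norm (grad \<psi> x) \<le> (\<Sum>i\<in>UNIV. b i x)" .
      qed simp
      also have "\<dots> \<le> w * (\<Sum>i\<in>UNIV. b i x)"
        by (intro mult_right_mono osc True sum_nonneg b0)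
      finally show ?thesis .
    next
      case False
      then have "grad \<psi> x = 0" by (simp add: vec_eq_iff \<psi>_out)
      then show ?thesis using w b0 by (simp add: sum_nonneg)
    qed
  qed
  also have "\<dots> = w * (\<Sum>i\<in>UNIV. LINT x|lborel. b i x)"
    using int_b by simp
  also have "\<dots> \<le> w * (\<Sum>i\<in>(UNIV :: 'n set). B * (2 + 2 * L) * 2 ^ s * (1/2) ^ (k * s))"
    by (intro mult_left_mono sum_mono bi w)
  finally show ?thesis by (simp add: \<psi>_def N mult_ac)
qed

text \<open>A box has side at most 2/2^k and the ball radius 1/2^k, so in each coordinate the index
  lies within 3 of that of the centre; 7 counts these values.\<close>

lemma gbox_touching_ball:
  fixes x :: "real ^ 'n"
  assumes e: "0 < e" "e \<le> 1 / 2 ^ k"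
  defines "T \<equiv> {z. gbox e k z \<inter> ball x ((1/2) ^ k) \<noteq> {}}"
  shows "finite T" "card T \<le> 7 ^ CARD('n)"
proof -
  define a where "a i = \<lfloor>2 ^ k * x $ i\<rfloor>" for i
  define T' where "T' = PiE (UNIV :: 'n set) (\<lambda>i. {a i - 3..a i + 3})"
  have sub: "T \<subseteq> T'"
  proof
    fix z assume "z \<in> T"
    then obtain y where y: "y \<in> gbox e k z" "dist x y < (1/2) ^ k" by (auto simp: T_def)
    have "z i \<in> {a i - 3..a i + 3}" for i
    proof -
      have d: "\<bar>x $ i - y $ i\<bar> < 1 / 2 ^ k"
        using component_le_norm_cart[of "x - y" i] y(2) by (simp add: dist_norm power_one_over)
      have l: "real_of_int (z i) / 2 ^ k \<le> y $ i" and u: "y $ i \<le> (real_of_int (z i) + 2) / 2 ^ k"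
        using y(1) e unfolding mem_gbox by (auto simp: add_divide_distrib intro: order_trans)
      have "real_of_int (z i) / 2 ^ k < x $ i + 1 / 2 ^ k" using d l by linarith
      then have "real_of_int (z i) < 2 ^ k * x $ i + 1" by (simp add: field_simps)
      moreover have "x $ i < (real_of_int (z i) + 2) / 2 ^ k + 1 / 2 ^ k" using d u by linarith
      then have "2 ^ k * x $ i < real_of_int (z i) + 3" by (simp add: field_simps)
      ultimately show ?thesis unfolding a_def atLeastAtMost_iff by linarith
    qed
    then show "z \<in> T'" by (auto simp: T'_def)
  qed
  have "finite T'" unfolding T'_def by (intro finite_PiE) auto
  moreover have "card T' = 7 ^ CARD('n)" unfolding T'_def by (subst card_PiE) auto
  ultimately show "finite T" "card T \<le> 7 ^ CARD('n)" using sub by (auto intro: finite_subset dest: card_mono)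
qed

end

section \<open>Closed sigma-finite sets are removable\<close>

lemma bounded_continuous_compact_support:
  fixes f :: "'a :: t2_space \<Rightarrow> real"
  assumes "continuous_on UNIV f" "compact S" "\<And>x. x \<notin> S \<Longrightarrow> f x = 0"
  obtains B where "\<And>x. \<bar>f x\<bar> \<le> B"
proof -
  have "bounded (f ` S)"
    using assms by (meson compact_continuous_image compact_imp_bounded continuous_on_subset top_greatest)
  then obtain B where B: "\<And>x. x \<in> S \<Longrightarrow> \<bar>f x\<bar> \<le> B"
    unfolding bounded_iff by auto
  have "\<bar>f x\<bar> \<le> max B 0" for x
    using B[of x] assms(3)[of x] by (cases "x \<in> S") auto
  then show ?thesis by (rule that)
qed

text \<open>Overlaps are counted once on the left and repeatedly on the right. It serves both for
  cubes touched by several balls and for unions of covers.\<close>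

lemma sum_UN_le:
  fixes f :: "'b \<Rightarrow> real"
  assumes "finite J" "\<And>j. j \<in> J \<Longrightarrow> finite (T j)" "\<And>x. 0 \<le> f x"
  shows "sum f (\<Union>j\<in>J. T j) \<le> (\<Sum>j\<in>J. sum f (T j))"
proof -
  have "(\<Union>j\<in>J. T j) = snd ` Sigma J T" by force
  then have "sum f (\<Union>j\<in>J. T j) \<le> sum (f \<circ> snd) (Sigma J T)"
    using assms by (simp only:) (rule sum_image_le, auto)
  also have "\<dots> = (\<Sum>j\<in>J. sum f (T j))"
    using assms by (subst sum.Sigma) (auto simp: case_prod_unfold)
  finally show ?thesis .
qed

context smooth_step
begin

lemma gbox_diam:
  fixes x :: "real ^ 'n"
  assumes "e \<le> 1 / 2 ^ k" "x \<in> gbox e k z" "y \<in> gbox e k z"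
  shows "norm (x - y) \<le> 2 * real CARD('n) / 2 ^ k"
proof -
  have "norm (x - y) \<le> (\<Sum>i\<in>UNIV. \<bar>(x - y) $ i\<bar>)" by (rule norm_le_l1_cart)
  also have "\<dots> \<le> (\<Sum>i\<in>(UNIV :: 'n set). 2 / 2 ^ k)"
  proof (rule sum_mono)
    fix i
    have "x $ i \<in> {real_of_int (z i) / 2 ^ k..real_of_int (z i) / 2 ^ k + 2 / 2 ^ k}"
      "y $ i \<in> {real_of_int (z i) / 2 ^ k..real_of_int (z i) / 2 ^ k + 2 / 2 ^ k}"
      using assms unfolding mem_gbox by (auto simp: add_divide_distrib dest!: spec[of _ i])
    then show "\<bar>(x - y) $ i\<bar> \<le> 2 / 2 ^ k" by auto
  qed
  finally show ?thesis by (simp add: field_simps)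
qed

lemma test_function_gbump:
  assumes "test_function UNIV \<phi>" "0 < e" "closure {x. \<phi> x \<noteq> 0} \<inter> gbox e k z \<subseteq> U"
  shows "test_function U (\<lambda>x. \<phi> x * gbump e k z x)"
  by (rule test_function_mult[OF assms(1) smooth_gbump[OF assms(2)] closed_gbox
        gbump_outside[OF assms(2)] assms(3)])

section \<open>The flux of a continuous field through smoothed cubes\<close>

context
  fixes V :: "real ^ 'n \<Rightarrow> real ^ 'n" and \<phi> :: "real ^ 'n \<Rightarrow> real"
  assumes V: "continuous_on UNIV V" and \<phi>: "test_function UNIV \<phi>"
begin

text \<open>The contribution of one cube. The removability proof uses four facts about it: it is
  additive under subdivision, sums to the whole integral at level 0, vanishes when the cube misses
  \<open>S\<close> on the support of \<phi>, and is small compared with (1/2)^(k s).\<close>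

definition flux :: "real \<Rightarrow> nat \<Rightarrow> ('n \<Rightarrow> int) \<Rightarrow> real" where
  "flux e k z = (LINT x|lborel. V x \<bullet> grad (\<lambda>x. \<phi> x * gbump e k z x) x)"

lemma flux_half:
  assumes "0 < e"
  shows "flux e k z = (\<Sum>z'\<in>{z'. half z' = z}. flux e (Suc k) z')"
  unfolding flux_def gbump_half[of e k z] sum_distrib_left
  by (rule integral_grad_sum[OF V finite_half_fibre])
    (use assms in \<open>auto intro: test_function_gbump[OF \<phi>]\<close>)

lemma flux_zero:
  assumes "0 < e" "div_zero_on (- S) V" "closure {x. \<phi> x \<noteq> 0} \<inter> gbox e k z \<inter> S = {}"
  shows "flux e k z = 0"
  using assms test_function_gbump[OF \<phi>, of e k z "- S"] unfolding flux_def div_zero_on_iff by blast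

text \<open>The margin 1 in \<open>R\<close> absorbs the smoothing width, so that over the support
  the bumps of level 0 add up to exactly 1.\<close>

lemma flux_total:
  assumes e: "0 < e" "e \<le> 1"
    and R: "\<And>x i. x \<in> closure {x. \<phi> x \<noteq> 0} \<Longrightarrow> \<bar>x $ i\<bar> + 1 \<le> real R"
  shows "(LINT x|lborel. V x \<bullet> grad \<phi> x) = (\<Sum>z\<in>PiE UNIV (\<lambda>_. {- int R..<int R}). flux e 0 z)"
proof -
  let ?Z = "PiE (UNIV :: 'n set) (\<lambda>_. {- int R..<int R})"
  have fin: "finite ?Z" by (intro finite_PiE) auto
  have "\<phi> x = (\<Sum>z\<in>?Z. \<phi> x * gbump e 0 z x)" for x
  proof (cases "x \<in> closure {x. \<phi> x \<noteq> 0}")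
    case True
    have "(\<Sum>z\<in>?Z. gbump e 0 z x) = (\<Prod>i\<in>UNIV. \<Sum>m\<in>{- int R..<int R}. cutoff e (real_of_int m) (real_of_int m + 1) (x $ i))"
      unfolding gbump_def by (subst prod_sum_PiE) auto
    also have "\<dots> = 1"
    proof (rule prod.neutral, rule ballI)
      fix i
      show "(\<Sum>m\<in>{- int R..<int R}. cutoff e (real_of_int m) (real_of_int m + 1) (x $ i)) = 1"
        unfolding sum_cutoff using R[OF True, of i] e by (intro cutoff_eq_1) auto
    qed
    finally show ?thesis by (simp flip: sum_distrib_left)
  next
    case False
    then have "\<phi> x = 0" using test_functionD(4)[OF \<phi>] by blast
    then show ?thesis by simp
  qed
  then have "(LINT x|lborel. V x \<bullet> grad \<phi> x) = (LINT x|lborel. V x \<bullet> grad (\<lambda>x. \<Sum>z\<in>?Z. \<phi> x * gbump e 0 z x) x)"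
    by (simp flip: fun_eq_iff)
  also have "\<dots> = (\<Sum>z\<in>?Z. flux e 0 z)"
    unfolding flux_def
    by (rule integral_grad_sum[OF V fin]) (use e in \<open>auto intro: test_function_gbump[OF \<phi>]\<close>)
  finally show ?thesis .
qed

text \<open>Uniform continuity gives oscillation at most \<open>w\<close> on all sufficiently small
  boxes near the support. \<open>A\<close> is chosen before \<open>w\<close>, so \<open>w\<close>
  can later be fitted to the measure of each piece.\<close>

lemma flux_bound:
  "\<exists>A\<ge>0. \<forall>w>0. \<exists>K\<ge>1. \<forall>k\<ge>K. \<forall>e z. 0 < e \<longrightarrow> e \<le> 1 / 2 ^ k \<longrightarrow>
     \<bar>flux e k z\<bar> \<le> A * w * (1/2) ^ (k * (CARD('n) - 1))"
proof -
  note t = test_functionD[OF \<phi>]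
  obtain B0 where B0: "\<And>x. \<bar>\<phi> x\<bar> \<le> B0"
    using bounded_continuous_compact_support[OF smooth_continuous[OF t(1)] t(2,4)] by blast
  have "\<exists>B. \<forall>x. \<bar>partial_deriv i \<phi> x\<bar> \<le> B" for i
    using bounded_continuous_compact_support[OF smooth_continuous_partial_deriv[OF t(1)] t(2)
        partial_deriv_outside_support] by blast
  then obtain B1 where B1: "\<And>i x. \<bar>partial_deriv i \<phi> x\<bar> \<le> B1 i" by metis
  have B1_nonneg: "0 \<le> B1 i" for i using order_trans[OF abs_ge_zero B1] .
  have B0_nonneg: "0 \<le> B0" using order_trans[OF abs_ge_zero B0] .
  define B where "B = B0 + (\<Sum>i\<in>UNIV. B1 i)"
  have B: "\<bar>\<phi> x\<bar> \<le> B" "\<bar>partial_deriv i \<phi> x\<bar> \<le> B" for x i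
    using B0[of x] B1[of i x] B1_nonneg B0_nonneg member_le_sum[of i UNIV B1] sum_nonneg[of UNIV B1]
    unfolding B_def by (auto intro: order_trans)
  define A where "A = real CARD('n) * B * (2 + 2 * L) * 2 ^ (CARD('n) - 1)"
  have "0 \<le> B" using order_trans[OF abs_ge_zero B(1)] .
  then have A: "0 \<le> A" using L_nonneg by (simp add: A_def)
  obtain R where R: "closure {x. \<phi> x \<noteq> 0} \<subseteq> cball 0 R"
    using bounded_subset_ballD[OF compact_imp_bounded[OF t(2)], of 0] by (meson ball_subset_cball order_trans)
  define N where "N = real CARD('n)"
  have N: "N \<ge> 1" by (simp add: N_def Suc_leI)
  \<comment> \<open>A box that meets the support has diameter at most 2 N, so enlarging the ball by
    that much keeps the whole box where uniform continuity is available.\<close>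
  let ?D = "cball (0 :: real ^ 'n) (R + 2 * N)"
  have uc: "uniformly_continuous_on ?D V"
    using V by (intro compact_uniformly_continuous) (auto intro: continuous_on_subset)
  have "\<exists>K\<ge>1. \<forall>k\<ge>K. \<forall>e z. 0 < e \<longrightarrow> e \<le> 1 / 2 ^ k \<longrightarrow> \<bar>flux e k z\<bar> \<le> A * w * (1/2) ^ (k * (CARD('n) - 1))"
    if w: "w > 0" for w
  proof -
    obtain d where d: "d > 0" "\<And>x y. x \<in> ?D \<Longrightarrow> y \<in> ?D \<Longrightarrow> dist y x < d \<Longrightarrow> dist (V y) (V x) < w"
      using uc w unfolding uniformly_continuous_on_def by meson
    obtain K0 where K0: "(1/2::real) ^ K0 < d / (2 * N)"
      using real_arch_pow_inv[of "d / (2 * N)" "1/2"] d N by auto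
    \<comment> \<open>The successor of \<open>K0\<close> makes the level at least 1; level 0 is then
      free of balls when the later induction over levels starts.\<close>
    show ?thesis
    proof (intro exI[of _ "Suc K0"] conjI allI impI)
      fix k :: nat and e :: real and z :: "'n \<Rightarrow> int"
      assume k: "Suc K0 \<le> k" and e: "0 < e" "e \<le> 1 / 2 ^ k"
      show "\<bar>flux e k z\<bar> \<le> A * w * (1/2) ^ (k * (CARD('n) - 1))"
      proof (cases "closure {x. \<phi> x \<noteq> 0} \<inter> gbox e k z = {}")
        case True
        have "(\<lambda>x. \<phi> x * gbump e k z x) = (\<lambda>x. 0)"
        proof
          fix x
          show "\<phi> x * gbump e k z x = 0"
            using True t(4)[of x] gbump_outside[OF e(1), of x k z] by (cases "x \<in> gbox e k z") auto
        qed
        moreover have "grad (\<lambda>x. 0 :: real) x = (0 :: real ^ 'n)" for x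
          by (rule grad_outside_support) simp
        ultimately show ?thesis using A w by (simp add: flux_def)
      next
        case False
        then obtain p where p: "p \<in> closure {x. \<phi> x \<noteq> 0}" "p \<in> gbox e k z" by blast
        have "2 * N / 2 ^ k \<le> 2 * N / 1" using N by (intro divide_left_mono) auto
        then have sub: "x \<in> ?D" if "x \<in> gbox e k z" for x
        proof -
          have "norm (x - p) \<le> 2 * N"
            using gbox_diam[OF e(2) that p(2)] \<open>2 * N / 2 ^ k \<le> 2 * N / 1\<close> unfolding N_def by simp
          moreover have "norm p \<le> R" using p(1) R by auto
          ultimately show ?thesis using norm_triangle_sub[of x p] by simp
        qed
        have "(1/2::real) ^ k \<le> (1/2) ^ K0" using k by (intro power_decreasing) auto
        then have "(1/2) ^ k < d / (2 * N)" using K0 by linarith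
        then have "2 * N / 2 ^ k < d" using N by (simp add: field_simps power_one_over)
        then have "norm (V x - V p) \<le> w" if "x \<in> gbox e k z" for x
          using gbox_diam[OF e(2) that p(2)] d(2)[OF sub[OF p(2)] sub[OF that]]
          unfolding N_def by (simp add: dist_norm less_imp_le)
        then show ?thesis
          using integral_gbump_bound[OF e V \<phi> B, of z "V p" w] w
          unfolding flux_def A_def by simp
      qed
    qed simp
  qed
  with A show ?thesis by blast
qed

end

end

lemma ex_smooth_step: "\<exists>P P' L. smooth_step P P' L"
proof (rule smooth_step_exists)
  fix P P' :: "real \<Rightarrow> real" and L :: real
  assume "\<And>k. C_line k P" "\<And>t. (P has_real_derivative P' t) (at t)"
    "\<And>t. t \<le> 0 \<Longrightarrow> P t = 0" "\<And>t. t \<ge> 1 \<Longrightarrow> P t = 1"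
    "mono P" "\<And>t. 0 \<le> P' t" "\<And>t. P' t \<le> L" "\<And>t. t \<notin> {0..1} \<Longrightarrow> P' t = 0"
  then have "smooth_step P P' L" by unfold_locales
  then show ?thesis by blast
qed

lemma geometric_sum_bound:
  assumes "finite M"
  shows "(\<Sum>m\<in>M. (1/2::real) ^ Suc m) \<le> 1"
proof -
  have "(\<Sum>m\<in>M. (1/2::real) ^ Suc m) \<le> (\<Sum>m. (1/2::real) ^ Suc m)"
    using power_half_series by (intro sum_le_suminf assms) (auto simp: sums_iff)
  then show ?thesis using power_half_series by (simp add: sums_iff)
qed

theorem sigma_finite_imp_removable:
  fixes S :: "(real ^ 'n) set"
  assumes S: "closed S" and sf: "hausdorff_sigma_finite (real (CARD('n) - 1)) S"
  shows "C0_removable_div S"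
  unfolding C0_removable_div_def
proof (intro allI impI)
  fix V :: "real ^ 'n \<Rightarrow> real ^ 'n"
  assume V: "continuous_on UNIV V" and dz: "div_zero_on (- S) V"
  obtain P P' L where "smooth_step P P' L" using ex_smooth_step by blast
  then interpret smooth_step P P' L .
  define s where "s = CARD('n) - 1"
  from sf obtain A C where A: "S \<subseteq> (\<Union>m. A m)"
    and C: "\<And>m :: nat. 0 \<le> C m" and cov: "\<And>m K. ball_covers s (A m) (C m) K"
    unfolding hausdorff_sigma_finite_iff s_def[symmetric] by metis
  show "div_zero_on UNIV V"
    unfolding div_zero_on_iff
  proof (intro allI impI)
    fix \<phi> :: "real ^ 'n \<Rightarrow> real" assume \<phi>: "test_function UNIV \<phi>"
    let ?I = "LINT x|lborel. V x \<bullet> grad \<phi> x"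
    let ?T = "closure {x. \<phi> x \<noteq> 0}"
    let ?F = "flux V \<phi>"
    have T: "compact ?T" by (rule test_functionD(2)[OF \<phi>])
    obtain R0 where R0: "?T \<subseteq> cball 0 R0"
      using bounded_subset_ballD[OF compact_imp_bounded[OF T], of 0] by (meson ball_subset_cball order_trans)
    define R where "R = nat \<lceil>R0 + 1\<rceil>"
    have R: "\<bar>x $ i\<bar> + 1 \<le> real R" if "x \<in> ?T" for x i
    proof -
      have "norm x \<le> R0" using that R0 by auto
      then show ?thesis using component_le_norm_cart[of x i] unfolding R_def by linarith
    qed
    obtain a where a: "0 \<le> a" and bnd: "\<And>w. 0 < w \<Longrightarrow> \<exists>K\<ge>1. \<forall>k\<ge>K. \<forall>e z. 0 < e \<longrightarrow> e \<le> 1 / 2 ^ k \<longrightarrow>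
       \<bar>?F e k z\<bar> \<le> a * w * (1/2) ^ (k * s)"
      using flux_bound[OF V \<phi>] unfolding s_def by blast
    have small: "\<bar>?I\<bar> \<le> \<epsilon>" if \<epsilon>: "\<epsilon> > 0" for \<epsilon>
    proof -
      \<comment> \<open>Chosen so that 7^N boxes per ball, the flux constant \<open>a\<close> and
        the cover sum \<open>C m\<close> together cost at most \<epsilon> / 2^(m+1) for piece
        \<open>m\<close>; the added ones keep the denominator positive.\<close>
      define w where "w m = \<epsilon> * (1/2) ^ Suc m / ((a + 1) * 7 ^ CARD('n) * (C m + 1))" for m
      have w: "0 < w m" for m using \<epsilon> a C[of m] by (simp add: w_def)
      from bnd[OF w] obtain K where K: "\<And>m. 1 \<le> K m"
        and FK: "\<And>m k e z. K m \<le> k \<Longrightarrow> 0 < e \<Longrightarrow> e \<le> 1 / 2 ^ k \<Longrightarrow> \<bar>?F e k z\<bar> \<le> a * w m * (1/2) ^ (k * s)"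
        by metis
      define Q where "Q m I x k \<longleftrightarrow> A m \<subseteq> (\<Union>n\<in>I. ball (x n) ((1/2) ^ k n)) \<and> (\<forall>n\<in>I. K m \<le> k n) \<and>
        (\<forall>J. finite J \<longrightarrow> J \<subseteq> I \<longrightarrow> (\<Sum>n\<in>J. (1/2) ^ (k n * s)) \<le> C m)"
        for m and I :: "nat set" and x k
      have "\<forall>m. \<exists>I x k. Q m I x k"
        using cov unfolding ball_covers_def Q_def by blast
      from choice[OF this] obtain I where "\<forall>m. \<exists>x k. Q m (I m) x k" ..
      from choice[OF this] obtain x where "\<forall>m. \<exists>k. Q m (I m) (x m) k" ..
      from choice[OF this] obtain k where Q: "\<forall>m. Q m (I m) (x m) (k m)" ..
      have cover: "A m \<subseteq> (\<Union>n\<in>I m. ball (x m n) ((1/2) ^ k m n))"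
        and k: "n \<in> I m \<Longrightarrow> K m \<le> k m n"
        and sum: "finite J \<Longrightarrow> J \<subseteq> I m \<Longrightarrow> (\<Sum>n\<in>J. (1/2) ^ (k m n * s)) \<le> C m" for m n J
        using Q unfolding Q_def by simp_all
      define b where "b j = ball (x (fst j) (snd j)) ((1/2) ^ k (fst j) (snd j))" for j
      define lev where "lev j = k (fst j) (snd j)" for j
      have "compact (?T \<inter> S)" using T S by (rule compact_Int_closed)
      moreover have "?T \<inter> S \<subseteq> (\<Union>j\<in>Sigma UNIV I. b j)"
      proof
        fix y assume "y \<in> ?T \<inter> S"
        then obtain m where "y \<in> A m" using A by blast
        then obtain n where "n \<in> I m" "y \<in> ball (x m n) ((1/2) ^ k m n)" using cover[of m] by blast
        then show "y \<in> (\<Union>j\<in>Sigma UNIV I. b j)" by (intro UN_I[of "(m, n)"]) (auto simp: b_def)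
      qed
      moreover have "open (b j)" for j by (simp add: b_def)
      ultimately obtain J where J: "J \<subseteq> Sigma UNIV I" "finite J" "?T \<inter> S \<subseteq> (\<Union>j\<in>J. b j)"
        using compactE_image[of "?T \<inter> S" "Sigma UNIV I" b] by metis
      \<comment> \<open>The finest level among the selected balls. With \<open>e\<close> equal to
        the cube side there, the constraint e \<le> 1/2^k holds at every level that occurs.\<close>
      define n0 where "n0 = Max (insert 0 (lev ` J))"
      have n0: "lev j \<le> n0" if "j \<in> J" for j
        using that J(2) unfolding n0_def by (intro Max_ge) auto
      define e where "e = 1 / (2::real) ^ n0"
      have e0: "0 < e" by (simp add: e_def)
      have e: "e \<le> 1 / 2 ^ k" if "k \<le> n0" for k
        using that unfolding e_def by (intro divide_left_mono power_increasing) auto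
      define c where "c j = 7 ^ CARD('n) * (a * w (fst j) * (1/2) ^ (lev j * s))" for j
      have c0: "0 \<le> c j" for j using a w[of "fst j"] by (simp add: c_def)
      have lev1: "1 \<le> lev j" if "j \<in> J" for j
        using that J(1) K[of "fst j"] k[of "snd j" "fst j"] unfolding lev_def by force
      \<comment> \<open>Invariant: \<open>Z\<close> holds the cubes of level \<open>q\<close> not
        yet discarded. Their boxes miss every ball of level up to \<open>q\<close>, and what has
        been discarded costs at most the budgets \<open>c j\<close> of those balls.\<close>
      have "\<exists>Z. finite Z \<and> (\<forall>z\<in>Z. \<forall>j\<in>J. lev j \<le> q \<longrightarrow> gbox e q z \<inter> b j = {}) \<and>
          \<bar>?I - (\<Sum>z\<in>Z. ?F e q z)\<bar> \<le> (\<Sum>j\<in>{j\<in>J. lev j \<le> q}. c j)" if "q \<le> n0" for q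
        using that
      proof (induction q)
        case 0
        let ?Z = "PiE (UNIV :: 'n set) (\<lambda>_. {- int R..<int R})"
        have "?I = (\<Sum>z\<in>?Z. ?F e 0 z)"
          using e[of 0] e0 R by (intro flux_total[OF V \<phi>]) auto
        moreover have "finite ?Z" by (intro finite_PiE) auto
        \<comment> \<open>No ball has level 0, so nothing has to be avoided and the budget is an
          empty sum.\<close>
        ultimately show ?case using lev1 by (intro exI[of _ ?Z]) (fastforce intro: sum_nonneg c0)
      next
        case (Suc q)
        then obtain Z where Z: "finite Z" "\<And>z j. z \<in> Z \<Longrightarrow> j \<in> J \<Longrightarrow> lev j \<le> q \<Longrightarrow> gbox e q z \<inter> b j = {}"
          "\<bar>?I - (\<Sum>z\<in>Z. ?F e q z)\<bar> \<le> (\<Sum>j\<in>{j\<in>J. lev j \<le> q}. c j)"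
          by auto
        define ch where "ch = (\<Union>z\<in>Z. {z'. half z' = z})"
        have ch: "finite ch" unfolding ch_def using Z(1) finite_half_fibre by blast
        define touch where "touch j = {z. gbox e (Suc q) z \<inter> b j \<noteq> {}}" for j
        define J' where "J' = {j\<in>J. lev j = Suc q}"
        have J': "finite J'" using J by (simp add: J'_def)
        \<comment> \<open>A cube is discarded at the level where its side equals the radius of a
          ball that its box meets, hence at most 7^N cubes per ball.\<close>
        define W where "W = ch \<inter> (\<Union>j\<in>J'. touch j)"
        have touch: "finite (touch j)" "card (touch j) \<le> 7 ^ CARD('n)" if "j \<in> J'" for j
          using gbox_touching_ball[OF e0 e[OF Suc.prems], of "x (fst j) (snd j)"] that
          unfolding touch_def b_def J'_def lev_def by auto
        have Fb: "\<bar>?F e (Suc q) z\<bar> \<le> a * w (fst j) * (1/2) ^ (lev j * s)" if "j \<in> J'" for j z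
        proof -
          have "K (fst j) \<le> Suc q"
            using that J(1) k[of "snd j" "fst j"] unfolding J'_def lev_def by force
          then show ?thesis using FK[OF _ e0 e[OF Suc.prems], of "fst j" z] that by (simp add: J'_def)
        qed
        have s1: "(\<Sum>z\<in>Z. ?F e q z) = (\<Sum>z\<in>ch. ?F e (Suc q) z)"
        proof -
          have "(\<Sum>z\<in>ch. ?F e (Suc q) z) = (\<Sum>z\<in>Z. \<Sum>z'\<in>{z'. half z' = z}. ?F e (Suc q) z')"
            unfolding ch_def using Z(1) finite_half_fibre by (intro sum.UNION_disjoint) auto
          then show ?thesis using flux_half[OF V \<phi> e0, of q] by simp
        qed
        have s2: "(\<Sum>z\<in>ch. ?F e (Suc q) z) = (\<Sum>z\<in>ch - W. ?F e (Suc q) z) + (\<Sum>z\<in>W. ?F e (Suc q) z)"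
          using ch by (intro sum.subset_diff) (auto simp: W_def)
        have "\<bar>\<Sum>z\<in>W. ?F e (Suc q) z\<bar> \<le> (\<Sum>z\<in>W. \<bar>?F e (Suc q) z\<bar>)" by (rule sum_abs)
        also have "\<dots> \<le> (\<Sum>z\<in>(\<Union>j\<in>J'. touch j). \<bar>?F e (Suc q) z\<bar>)"
          using J' touch by (intro sum_mono2) (auto simp: W_def)
        also have "\<dots> \<le> (\<Sum>j\<in>J'. \<Sum>z\<in>touch j. \<bar>?F e (Suc q) z\<bar>)"
          using J' touch by (intro sum_UN_le) auto
        also have "\<dots> \<le> (\<Sum>j\<in>J'. c j)"
        proof (rule sum_mono)
          fix j assume j: "j \<in> J'"
          have "(\<Sum>z\<in>touch j. \<bar>?F e (Suc q) z\<bar>) \<le> real (card (touch j)) * (a * w (fst j) * (1/2) ^ (lev j * s))"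
            by (rule sum_bounded_above) (rule Fb[OF j])
          also have "\<dots> \<le> c j"
          proof -
            have "real (card (touch j)) \<le> 7 ^ CARD('n)"
              using touch(2)[OF j] by (metis of_nat_le_iff of_nat_numeral of_nat_power)
            then show ?thesis unfolding c_def using a w[of "fst j"] by (intro mult_right_mono) auto
          qed
          finally show "(\<Sum>z\<in>touch j. \<bar>?F e (Suc q) z\<bar>) \<le> c j" .
        qed
        finally have s3: "\<bar>\<Sum>z\<in>W. ?F e (Suc q) z\<bar> \<le> (\<Sum>j\<in>J'. c j)" .
        have "{j\<in>J. lev j \<le> Suc q} = {j\<in>J. lev j \<le> q} \<union> J'" "{j\<in>J. lev j \<le> q} \<inter> J' = {}"
          by (auto simp: J'_def)
        then have s4: "(\<Sum>j\<in>{j\<in>J. lev j \<le> Suc q}. c j) = (\<Sum>j\<in>{j\<in>J. lev j \<le> q}. c j) + (\<Sum>j\<in>J'. c j)"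
          using J(2) J' by (simp add: sum.union_disjoint)
        show ?case
        proof (intro exI[of _ "ch - W"] conjI ballI impI)
          show "finite (ch - W)" using ch by simp
          show "gbox e (Suc q) z \<inter> b j = {}" if z: "z \<in> ch - W" and j: "j \<in> J" "lev j \<le> Suc q" for z j
          proof (cases "lev j = Suc q")
            case True
            then show ?thesis using z j unfolding W_def J'_def touch_def by blast
          next
            case False
            \<comment> \<open>Balls of smaller level were avoided by the parent, and the box of a
              child lies in that of its parent.\<close>
            then have "gbox e q (half z) \<inter> b j = {}" using z j by (intro Z(2)) (auto simp: ch_def)
            then show ?thesis using gbox_half[of e q z] by blast
          qed
          show "\<bar>?I - (\<Sum>z\<in>ch - W. ?F e (Suc q) z)\<bar> \<le> (\<Sum>j\<in>{j\<in>J. lev j \<le> Suc q}. c j)"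
            using Z(3) s1 s2 s3 s4 by linarith
        qed
      qed
      from this[of n0] obtain Z where Z: "finite Z"
        "\<And>z j. z \<in> Z \<Longrightarrow> j \<in> J \<Longrightarrow> gbox e n0 z \<inter> b j = {}"
        "\<bar>?I - (\<Sum>z\<in>Z. ?F e n0 z)\<bar> \<le> (\<Sum>j\<in>{j\<in>J. lev j \<le> n0}. c j)"
        using n0 by auto
      \<comment> \<open>The remaining boxes miss all selected balls, which cover \<open>S\<close> on
        the support of \<phi>.\<close>
      have "?F e n0 z = 0" if "z \<in> Z" for z
        using J(3) Z(2)[OF that] by (intro flux_zero[OF V \<phi> e0 dz]) blast
      then have "\<bar>?I\<bar> \<le> (\<Sum>j\<in>{j\<in>J. lev j \<le> n0}. c j)" using Z(3) by simp
      also have "\<dots> = (\<Sum>j\<in>J. c j)" using n0 by (intro sum.cong) auto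
      \<comment> \<open>Budgets are regrouped by piece, since the cover sums are bounded piece by
        piece.\<close>
      also have "\<dots> = (\<Sum>m\<in>fst ` J. \<Sum>n\<in>{n. (m, n) \<in> J}. c (m, n))"
      proof -
        have "J = Sigma (fst ` J) (\<lambda>m. {n. (m, n) \<in> J})" by force
        moreover have "finite {n. (m, n) \<in> J}" for m
          using finite_imageI[OF J(2), of snd] by (rule finite_subset[rotated]) force
        ultimately show ?thesis using J(2) sum.Sigma[of "fst ` J" "\<lambda>m. {n. (m, n) \<in> J}" "\<lambda>m n. c (m, n)"]
          by (simp add: case_prod_unfold)
      qed
      also have "\<dots> \<le> (\<Sum>m\<in>fst ` J. \<epsilon> * (1/2) ^ Suc m)"
      proof (rule sum_mono)
        fix m
        let ?J = "{n. (m, n) \<in> J}"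
        have "finite ?J" using finite_imageI[OF J(2), of snd] by (rule finite_subset[rotated]) force
        then have "(\<Sum>n\<in>?J. (1/2) ^ (k m n * s)) \<le> C m" using J(1) by (intro sum) auto
        then have "7 ^ CARD('n) * (a * w m) * (\<Sum>n\<in>?J. (1/2) ^ (k m n * s)) \<le> 7 ^ CARD('n) * (a * w m) * C m"
          using a w[of m] by (intro mult_left_mono) auto
        then have "(\<Sum>n\<in>?J. c (m, n)) \<le> 7 ^ CARD('n) * (a * w m) * C m"
          by (simp add: c_def lev_def sum_distrib_left mult_ac)
        also have "\<dots> \<le> 7 ^ CARD('n) * ((a + 1) * w m) * (C m + 1)"
          using a w[of m] C[of m] by (intro mult_mono mult_left_mono mult_right_mono) auto
        also have "\<dots> = \<epsilon> * (1/2) ^ Suc m"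
        proof -
          define X where "X = (a + 1) * 7 ^ CARD('n) * (C m + 1)"
          have "0 < X" using a C[of m] unfolding X_def by (intro mult_pos_pos) auto
          moreover have "7 ^ CARD('n) * ((a + 1) * w m) * (C m + 1) = w m * X"
            by (simp only: X_def mult_ac)
          ultimately show ?thesis unfolding w_def X_def[symmetric] by simp
        qed
        finally show "(\<Sum>n\<in>?J. c (m, n)) \<le> \<epsilon> * (1/2) ^ Suc m" .
      qed
      also have "\<dots> = \<epsilon> * (\<Sum>m\<in>fst ` J. (1/2) ^ Suc m)" by (simp only: sum_distrib_left)
      also have "\<dots> \<le> \<epsilon> * 1"
        using \<epsilon> J(2) by (intro mult_left_mono geometric_sum_bound) auto
      finally show ?thesis by simp
    qed
    show "?I = 0"
    proof (rule ccontr)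
      assume "?I \<noteq> 0"
      then show False using small[of "\<bar>?I\<bar> / 2"] by simp
    qed
  qed
qed

section \<open>Flows on grids\<close>

text \<open>Tychonoff in the product topology, so that a minimising flow exists. Flows are total
  functions on an edge type that may be infinite.\<close>

lemma compact_function_box: "compact (PiE UNIV (\<lambda>_. {a..b}) :: ('e \<Rightarrow> real) set)"
  using compactin_PiE[of "\<lambda>_. euclideanreal" UNIV "\<lambda>_ :: 'e. {a..b}"]
  by (simp add: euclidean_product_topology)

text \<open>A minimiser of the quadratic defect saturates every edge along which the defect changes,
  so the sets where the defect has a strict sign violate the cut condition unless they are empty.\<close>

lemma max_flow:
  fixes src tgt :: "'e \<Rightarrow> 'v" and \<nu> :: "'v \<Rightarrow> real" and C :: real
  assumes E: "finite E" and B: "finite B" "src ` E \<subseteq> B" "tgt ` E \<subseteq> B" and C: "0 \<le> C"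
    and cut: "\<And>A. A \<subseteq> B \<Longrightarrow> \<bar>sum \<nu> A\<bar> \<le> C * card {e\<in>E. (src e \<in> A) \<noteq> (tgt e \<in> A)}"
  obtains f where "\<And>e. \<bar>f e\<bar> \<le> C"
    "\<And>v. v \<in> B \<Longrightarrow> (\<Sum>e\<in>E. f e * (of_bool (tgt e = v) - of_bool (src e = v))) = \<nu> v"
proof -
  define net where "net f v = (\<Sum>e\<in>E. f e * (of_bool (tgt e = v) - of_bool (src e = v)))" for f :: "'e \<Rightarrow> real" and v
  define J where "J f = (\<Sum>v\<in>B. (\<nu> v - net f v)\<^sup>2)" for f
  let ?X = "PiE UNIV (\<lambda>_. {-C..C}) :: ('e \<Rightarrow> real) set"
  have "continuous_on ?X J"
    unfolding J_def net_def
    by (intro continuous_intros continuous_on_subset[OF continuous_on_product_coordinates]) auto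
  moreover have "(\<lambda>_. 0) \<in> ?X" using C by auto
  ultimately obtain f where f: "f \<in> ?X" and min: "\<And>g. g \<in> ?X \<Longrightarrow> J f \<le> J g"
    using continuous_attains_inf[OF compact_function_box[of "-C" C], of J] by blast
  define \<phi> where "\<phi> v = \<nu> v - net f v" for v
  \<comment> \<open>First variation along one edge: adding \<open>t\<close> changes \<open>J\<close>
    by 2 t (t - D), where D is the defect at the target minus the defect at the source. A loop
    leaves the net flow unchanged and is excluded.\<close>
  have var: "0 \<le> t * (t - (\<phi> (tgt e) - \<phi> (src e)))"
    if e: "e \<in> E" "src e \<noteq> tgt e" and t: "f e + t \<in> {-C..C}" for e t
  proof -
    define d where "d v = (of_bool (tgt e = v) - of_bool (src e = v) :: real)" for v
    define g where "g = f(e := f e + t)"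
    have "g \<in> ?X" using f t by (auto simp: g_def PiE_def Pi_def)
    have net_g: "net g v = net f v + t * d v" for v
      unfolding net_def d_def g_def using E e(1)
      by (simp add: sum.remove[of E e] algebra_simps)
    have sB: "src e \<in> B" "tgt e \<in> B" using B e by auto
    have "(\<Sum>v\<in>B. h v * of_bool (u = v)) = h u" if "u \<in> B" for h :: "'v \<Rightarrow> real" and u
      using B(1) that by (simp add: of_bool_def if_distrib cong: if_cong)
    then have d1: "(\<Sum>v\<in>B. h v * d v) = h (tgt e) - h (src e)" for h :: "'v \<Rightarrow> real"
      unfolding d_def using sB by (simp only: right_diff_distrib sum_subtractf)
    have "(\<Sum>v\<in>B. (d v)\<^sup>2) = 2"
      using d1[of d] e(2) by (simp add: power2_eq_square) (simp add: d_def)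
    have "J g = (\<Sum>v\<in>B. (\<phi> v - t * d v)\<^sup>2)"
      by (simp add: J_def net_g \<phi>_def algebra_simps)
    also have "\<dots> = (\<Sum>v\<in>B. (\<phi> v)\<^sup>2) - 2 * t * (\<Sum>v\<in>B. \<phi> v * d v) + t\<^sup>2 * (\<Sum>v\<in>B. (d v)\<^sup>2)"
      by (simp add: power2_diff power_mult_distrib sum.distrib sum_subtractf sum_distrib_left mult_ac)
    also have "\<dots> = J f + 2 * (t * (t - (\<phi> (tgt e) - \<phi> (src e))))"
    proof -
      have "J f = (\<Sum>v\<in>B. (\<phi> v)\<^sup>2)" by (simp add: J_def \<phi>_def)
      then show ?thesis
        unfolding d1 \<open>(\<Sum>v\<in>B. (d v)\<^sup>2) = 2\<close> by (simp add: algebra_simps power2_eq_square)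
    qed
    finally show ?thesis using min[OF \<open>g \<in> ?X\<close>] by simp
  qed
  have fC: "\<bar>f e\<bar> \<le> C" for e using f by (auto simp: PiE_def Pi_def abs_le_iff minus_le_iff)
  have up: "f e = C" if "e \<in> E" "\<phi> (src e) < \<phi> (tgt e)" for e
  proof (rule ccontr)
    assume "f e \<noteq> C"
    define D where "D = \<phi> (tgt e) - \<phi> (src e)"
    \<comment> \<open>Strictly between 0 and \<open>D\<close> and still within the capacity, so the
      variation would be negative.\<close>
    define t where "t = min (C - f e) (D / 2)"
    have "0 < D" "0 < t" "t < D" using \<open>f e \<noteq> C\<close> fC[of e] that by (auto simp: t_def D_def min_def max_def field_simps)
    moreover have "0 \<le> t * (t - D)"
      unfolding D_def using that fC[of e] \<open>0 < t\<close> by (intro var) (auto simp: t_def)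
    ultimately show False by (simp add: zero_le_mult_iff)
  qed
  have down: "f e = - C" if "e \<in> E" "\<phi> (tgt e) < \<phi> (src e)" for e
  proof (rule ccontr)
    assume "f e \<noteq> - C"
    define D where "D = \<phi> (tgt e) - \<phi> (src e)"
    define t where "t = max (- C - f e) (D / 2)"
    have "D < 0" "t < 0" "D < t" using \<open>f e \<noteq> - C\<close> fC[of e] that by (auto simp: t_def D_def min_def max_def field_simps)
    moreover have "0 \<le> t * (t - D)"
      unfolding D_def using that fC[of e] \<open>t < 0\<close> by (intro var) (auto simp: t_def)
    ultimately show False by (simp add: zero_le_mult_iff)
  qed
  have net_sum: "(\<Sum>v\<in>A. net f v) = (\<Sum>e\<in>E. f e * (of_bool (tgt e \<in> A) - of_bool (src e \<in> A)))" if "A \<subseteq> B" for A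
  proof -
    have fA: "finite A" using that B(1) by (rule finite_subset)
    have ind: "(\<Sum>v\<in>A. of_bool (u = v)) = (of_bool (u \<in> A) :: real)" for u
      using fA by (simp add: of_bool_def)
    have "(\<Sum>v\<in>A. net f v) = (\<Sum>e\<in>E. \<Sum>v\<in>A. f e * (of_bool (tgt e = v) - of_bool (src e = v)))"
      unfolding net_def by (rule sum.swap)
    also have "\<dots> = (\<Sum>e\<in>E. f e * ((\<Sum>v\<in>A. of_bool (tgt e = v)) - (\<Sum>v\<in>A. of_bool (src e = v))))"
      by (simp only: sum_distrib_left[symmetric] sum_subtractf)
    finally show ?thesis by (simp only: ind)
  qed
  have card_cut: "(\<Sum>e\<in>E. c * of_bool ((src e \<in> A) \<noteq> (tgt e \<in> A))) = c * real (card {e\<in>E. (src e \<in> A) \<noteq> (tgt e \<in> A)})" for c :: real and A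
    using E by (simp add: sum_distrib_left[symmetric] of_bool_def sum.If_cases Int_def conj_commute)
  have pos: "{v\<in>B. 0 < \<phi> v} = {}"
  proof (rule ccontr)
    let ?A = "{v\<in>B. 0 < \<phi> v}"
    assume "?A \<noteq> {}"
    then have "0 < sum \<phi> ?A" using B(1) by (intro sum_pos) auto
    have "(\<Sum>v\<in>?A. net f v) = (\<Sum>e\<in>E. C * of_bool ((src e \<in> ?A) \<noteq> (tgt e \<in> ?A)))"
    proof (subst net_sum; (intro sum.cong refl)?)
      fix e assume e: "e \<in> E"
      then have "src e \<in> B" "tgt e \<in> B" using B by auto
      then show "f e * (of_bool (tgt e \<in> ?A) - of_bool (src e \<in> ?A)) = C * of_bool ((src e \<in> ?A) \<noteq> (tgt e \<in> ?A))"
        using up[OF e] down[OF e] by (cases "0 < \<phi> (src e)"; cases "0 < \<phi> (tgt e)") auto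
    qed auto
    then have "sum \<nu> ?A \<le> (\<Sum>v\<in>?A. net f v)" using cut[of ?A] card_cut[of C ?A] by auto
    then have "sum \<phi> ?A \<le> 0" by (simp add: \<phi>_def sum_subtractf)
    then show False using \<open>0 < sum \<phi> ?A\<close> by simp
  qed
  have neg: "{v\<in>B. \<phi> v < 0} = {}"
  proof (rule ccontr)
    let ?A = "{v\<in>B. \<phi> v < 0}"
    assume "?A \<noteq> {}"
    then have "0 < (\<Sum>v\<in>?A. - \<phi> v)" using B(1) by (intro sum_pos) auto
    have "(\<Sum>v\<in>?A. net f v) = (\<Sum>e\<in>E. (- C) * of_bool ((src e \<in> ?A) \<noteq> (tgt e \<in> ?A)))"
    proof (subst net_sum; (intro sum.cong refl)?)
      fix e assume e: "e \<in> E"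
      then have "src e \<in> B" "tgt e \<in> B" using B by auto
      then show "f e * (of_bool (tgt e \<in> ?A) - of_bool (src e \<in> ?A)) = (- C) * of_bool ((src e \<in> ?A) \<noteq> (tgt e \<in> ?A))"
        using up[OF e] down[OF e] by (cases "\<phi> (src e) < 0"; cases "\<phi> (tgt e) < 0") auto
    qed auto
    then have "(\<Sum>v\<in>?A. net f v) \<le> sum \<nu> ?A" using cut[of ?A] card_cut[of "- C" ?A] by auto
    then have "0 \<le> sum \<phi> ?A" by (simp add: \<phi>_def sum_subtractf)
    then show False using \<open>0 < (\<Sum>v\<in>?A. - \<phi> v)\<close> by (simp add: sum_negf)
  qed
  have "net f v = \<nu> v" if "v \<in> B" for v
    using pos neg that unfolding \<phi>_def by (metis (mono_tags, lifting) diff_gt_0_iff_gt empty_iff linorder_neqE_linordered_idom mem_Collect_eq less_iff_diff_less_0)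
  with fC show ?thesis by (intro that[of f]) (auto simp: net_def)
qed

section \<open>Isoperimetry, growth conditions and flows in grid boxes\<close>

definition gridbox :: "('n \<Rightarrow> int) \<Rightarrow> nat \<Rightarrow> ('n \<Rightarrow> int) set" where
  "gridbox a l = PiE UNIV (\<lambda>i. {a i..<a i + int l})"

definition up :: "'n \<Rightarrow> ('n \<Rightarrow> int) \<Rightarrow> 'n \<Rightarrow> int" where
  "up i w = w(i := w i + 1)"

text \<open>The pair (i, w) encodes the edge from \<open>w\<close> to its upper neighbour in
  direction \<open>i\<close>. Both ends must lie in the box, so cut sets of disjoint boxes are
  disjoint.\<close>

definition gedges :: "('n \<Rightarrow> int) \<Rightarrow> nat \<Rightarrow> ('n \<times> ('n \<Rightarrow> int)) set" where
  "gedges a l = {(i, w). w \<in> gridbox a l \<and> up i w \<in> gridbox a l}"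

definition gcutset :: "('n \<Rightarrow> int) \<Rightarrow> nat \<Rightarrow> ('n \<Rightarrow> int) set \<Rightarrow> ('n \<times> ('n \<Rightarrow> int)) set" where
  "gcutset a l A = {e \<in> gedges a l. (snd e \<in> A) \<noteq> (up (fst e) (snd e) \<in> A)}"

lemma mem_gridbox: "w \<in> gridbox a l \<longleftrightarrow> (\<forall>i. a i \<le> w i \<and> w i < a i + int l)"
  by (auto simp: gridbox_def PiE_def Pi_def)

lemma finite_gridbox [simp]: "finite (gridbox a l :: ('n::finite \<Rightarrow> int) set)"
  unfolding gridbox_def by (intro finite_PiE) auto

lemma card_gridbox: "card (gridbox a l :: ('n::finite \<Rightarrow> int) set) = l ^ CARD('n)"
  unfolding gridbox_def by (subst card_PiE) auto

lemma finite_gedges [simp]: "finite (gedges a l :: ('n::finite \<times> _) set)"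
  by (rule finite_subset[of _ "UNIV \<times> gridbox a l"]) (auto simp: gedges_def)

lemma finite_gcutset [simp]: "finite (gcutset a l A :: ('n::finite \<times> _) set)"
  by (rule finite_subset[of _ "gedges a l"]) (auto simp: gcutset_def)

lemma gedges_iff: "(i, w) \<in> gedges a l \<longleftrightarrow> w \<in> gridbox a l \<and> w i + 1 < a i + int l"
  by (auto simp: gedges_def mem_gridbox up_def intro: order_trans)

lemma abs_diff_le_sum_steps:
  fixes h :: "int \<Rightarrow> real"
  assumes "s \<in> {a..<b}" "t \<in> {a..<b}"
  shows "\<bar>h s - h t\<bar> \<le> (\<Sum>r\<in>{a..<b - 1}. \<bar>h r - h (r + 1)\<bar>)"
proof -
  have *: "\<bar>h s - h t\<bar> \<le> (\<Sum>r\<in>{a..<b - 1}. \<bar>h r - h (r + 1)\<bar>)"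
    if st: "a \<le> s" "s \<le> t" "t < b" for s t
  proof -
    have "\<bar>h s - h (s + int n)\<bar> \<le> (\<Sum>r\<in>{s..<s + int n}. \<bar>h r - h (r + 1)\<bar>)" for n
    proof (induction n)
      case (Suc n)
      have "{s..<s + int (Suc n)} = insert (s + int n) {s..<s + int n}" by auto
      then show ?case using Suc by (simp add: ac_simps)
    qed simp
    from this[of "nat (t - s)"] have "\<bar>h s - h t\<bar> \<le> (\<Sum>r\<in>{s..<t}. \<bar>h r - h (r + 1)\<bar>)"
      using st by simp
    also have "\<dots> \<le> (\<Sum>r\<in>{a..<b - 1}. \<bar>h r - h (r + 1)\<bar>)"
      using st by (intro sum_mono2) auto
    finally show ?thesis .
  qed
  show ?thesis
    using *[of s t] *[of t s] assms by (cases "s \<le> t") (auto simp: abs_minus_commute)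
qed

text \<open>A point of \<open>A\<close> and a point outside are joined by changing one coordinate at
  a time, and each change costs at most the cut edges on its line. An edge is used by
  \<open>l\<close> positions on its line and l^N choices of the other point, which gives the power
  l^(N+1).\<close>

lemma grid_isoperimetry:
  fixes a :: "'n::finite \<Rightarrow> int"
  shows "card (A \<inter> gridbox a l) * card (gridbox a l - A) \<le> l ^ (CARD('n) + 1) * card (gcutset a l A)"
proof -
  let ?Q = "gridbox a l"
  define f :: "('n \<Rightarrow> int) \<Rightarrow> real" where "f x = of_bool (x \<in> A)" for x
  define mix where "mix I x y = (\<lambda>j. if j \<in> I then y j else x j)" for I and x y :: "'n \<Rightarrow> int"
  define D where "D i = (\<Sum>x\<in>?Q. \<Sum>y\<in>?Q. \<bar>f x - f (x(i := y i))\<bar>)" for i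
  have step: "(\<Sum>x\<in>?Q. \<Sum>y\<in>?Q. \<bar>f x - f (mix I x y)\<bar>) \<le> (\<Sum>i\<in>I. D i)" if "finite I" for I
    using that
  proof (induction I rule: finite_induct)
    case empty
    then show ?case by (simp add: mix_def)
  next
    case (insert i I)
    have "(\<Sum>x\<in>?Q. \<Sum>y\<in>?Q. \<bar>f (mix I x y) - f ((mix I x y)(i := y i))\<bar>)
        = (\<Sum>(x, y)\<in>?Q \<times> ?Q. \<bar>f (mix I x y) - f ((mix I x y)(i := y i))\<bar>)"
      by (simp add: sum.cartesian_product)
    \<comment> \<open>Exchanging the coordinates in \<open>I\<close> between \<open>x\<close> and
      \<open>y\<close> is an involution of the pairs, and it leaves \<open>y i\<close> alone as
      \<open>i\<close> is not in \<open>I\<close>.\<close>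
    also have "\<dots> = (\<Sum>(x, y)\<in>?Q \<times> ?Q. \<bar>f x - f (x(i := y i))\<bar>)"
      by (rule sum.reindex_bij_witness[of _ "\<lambda>(x, y). (mix I x y, mix I y x)" "\<lambda>(x, y). (mix I x y, mix I y x)"])
        (use insert.hyps in \<open>auto simp: mix_def mem_gridbox fun_eq_iff\<close>)
    also have "\<dots> = D i" by (simp add: sum.cartesian_product D_def)
    finally have *: "(\<Sum>x\<in>?Q. \<Sum>y\<in>?Q. \<bar>f (mix I x y) - f ((mix I x y)(i := y i))\<bar>) = D i" .
    have "mix (insert i I) x y = (mix I x y)(i := y i)" for x y
      by (auto simp: mix_def)
    then have "(\<Sum>x\<in>?Q. \<Sum>y\<in>?Q. \<bar>f x - f (mix (insert i I) x y)\<bar>) \<le>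
        (\<Sum>x\<in>?Q. \<Sum>y\<in>?Q. \<bar>f x - f (mix I x y)\<bar> + \<bar>f (mix I x y) - f ((mix I x y)(i := y i))\<bar>)"
      by (intro sum_mono) simp
    also have "\<dots> \<le> (\<Sum>i\<in>I. D i) + D i"
      using insert.IH * by (simp add: sum.distrib)
    finally show ?case using insert.hyps by (simp add: add.commute)
  qed
  define g where "g i w = \<bar>f w - f (up i w)\<bar>" for i w
  define W where "W i = {w. (i, w) \<in> gedges a l}" for i
  have D: "D i \<le> real (l ^ (CARD('n) + 1)) * (\<Sum>w\<in>W i. g i w)" for i
  proof -
    let ?R = "{a i..<a i + int l - 1}"
    have "D i \<le> (\<Sum>x\<in>?Q. \<Sum>y\<in>?Q. \<Sum>r\<in>?R. g i (x(i := r)))"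
      unfolding D_def
    proof (intro sum_mono)
      fix x y assume "x \<in> ?Q" "y \<in> ?Q"
      then have "x i \<in> {a i..<a i + int l}" "y i \<in> {a i..<a i + int l}" by (auto simp: mem_gridbox)
      from abs_diff_le_sum_steps[OF this, of "\<lambda>r. f (x(i := r))"]
      show "\<bar>f x - f (x(i := y i))\<bar> \<le> (\<Sum>r\<in>?R. g i (x(i := r)))"
        by (simp add: g_def up_def)
    qed
    also have "\<dots> = real (l ^ CARD('n)) * (\<Sum>(x, r)\<in>?Q \<times> ?R. g i (x(i := r)))"
      by (simp add: card_gridbox sum_distrib_left sum.cartesian_product[symmetric])
    \<comment> \<open>The pair (x, r) is traded for the edge position w = x(i := r) and the
      overwritten coordinate t = x i.\<close>
    also have "(\<Sum>(x, r)\<in>?Q \<times> ?R. g i (x(i := r))) = (\<Sum>(w, t)\<in>W i \<times> {a i..<a i + int l}. g i w)"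
      by (rule sum.reindex_bij_witness[of _ "\<lambda>(w, t). (w(i := t), w i)" "\<lambda>(x, r). (x(i := r), x i)"])
        (auto simp: W_def gedges_iff mem_gridbox)
    also have "\<dots> = real l * (\<Sum>w\<in>W i. g i w)"
      by (simp add: sum.cartesian_product[symmetric] sum_distrib_left)
    finally show ?thesis by (simp add: mult_ac)
  qed
  have mixU: "mix UNIV x y = y" for x y by (simp add: mix_def)
  have "real (card (A \<inter> ?Q) * card (?Q - A)) = (\<Sum>x\<in>A \<inter> ?Q. \<Sum>y\<in>?Q - A. \<bar>f x - f y\<bar>)"
    by (simp add: f_def)
  also have "\<dots> \<le> (\<Sum>x\<in>?Q. \<Sum>y\<in>?Q. \<bar>f x - f y\<bar>)"
  proof -
    have "(\<Sum>x\<in>A \<inter> ?Q. \<Sum>y\<in>?Q - A. \<bar>f x - f y\<bar>) \<le> (\<Sum>x\<in>A \<inter> ?Q. \<Sum>y\<in>?Q. \<bar>f x - f y\<bar>)"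
      by (intro sum_mono sum_mono2) auto
    also have "\<dots> \<le> (\<Sum>x\<in>?Q. \<Sum>y\<in>?Q. \<bar>f x - f y\<bar>)"
      by (intro sum_mono2 sum_nonneg) auto
    finally show ?thesis .
  qed
  also have "\<dots> \<le> (\<Sum>i\<in>UNIV. D i)" using step[of UNIV] by (simp add: mixU)
  also have "\<dots> \<le> (\<Sum>i\<in>UNIV. real (l ^ (CARD('n) + 1)) * (\<Sum>w\<in>W i. g i w))" by (intro sum_mono D)
  also have "\<dots> = real (l ^ (CARD('n) + 1)) * (\<Sum>e\<in>gedges a l. g (fst e) (snd e))"
  proof -
    have "gedges a l = Sigma UNIV W" by (auto simp: W_def)
    moreover have "finite (W i)" for i
      by (rule finite_subset[of _ ?Q]) (auto simp: W_def gedges_def)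
    ultimately show ?thesis by (simp add: sum_distrib_left[symmetric] sum.Sigma case_prod_unfold)
  qed
  also have "(\<Sum>e\<in>gedges a l. g (fst e) (snd e)) = real (card (gcutset a l A))"
  proof -
    have "g (fst e) (snd e) = of_bool ((snd e \<in> A) \<noteq> (up (fst e) (snd e) \<in> A))" for e
      by (simp add: g_def f_def)
    then show ?thesis by (simp add: gcutset_def of_bool_def sum.If_cases Int_def)
  qed
  finally show ?thesis by (simp only: of_nat_mult[symmetric] of_nat_le_iff)
qed

text \<open>The discrete Frostman condition with exponent N - 1 at all scales up to 2^p. Boxes are
  aligned relative to the corner \<open>a\<close>, so the condition passes to the dyadic children,
  whose corners differ from \<open>a\<close>.\<close>

definition growth :: "('n::finite \<Rightarrow> int) \<Rightarrow> nat \<Rightarrow> real \<Rightarrow> (('n \<Rightarrow> int) \<Rightarrow> real) \<Rightarrow> bool" where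
  "growth a p \<epsilon> w \<longleftrightarrow> (\<forall>q\<le>p. \<forall>b. (\<forall>i. 2 ^ q dvd b i - a i) \<longrightarrow>
     sum w (gridbox b (2 ^ q)) \<le> \<epsilon> * 2 ^ (q * (CARD('n) - 1)))"

lemma growthD:
  fixes a :: "'n::finite \<Rightarrow> int"
  shows "growth a p \<epsilon> w \<Longrightarrow> q \<le> p \<Longrightarrow> (\<And>i. 2 ^ q dvd b i - a i) \<Longrightarrow>
    sum w (gridbox b (2 ^ q)) \<le> \<epsilon> * 2 ^ (q * (CARD('n) - 1))"
  by (simp add: growth_def)

lemma gridbox_children:
  fixes a :: "'n::finite \<Rightarrow> int" and l :: nat
  defines "Ch \<equiv> PiE UNIV (\<lambda>i. {a i, a i + int l})"
  shows "gridbox a (2 * l) = (\<Union>b\<in>Ch. gridbox b l)"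
    and "b \<in> Ch \<Longrightarrow> c \<in> Ch \<Longrightarrow> b \<noteq> c \<Longrightarrow> gridbox b l \<inter> gridbox c l = {}"
proof -
  have mem: "b \<in> Ch \<longleftrightarrow> (\<forall>i. b i = a i \<or> b i = a i + int l)" for b
    by (auto simp: Ch_def PiE_def Pi_def)
  show "gridbox a (2 * l) = (\<Union>b\<in>Ch. gridbox b l)"
  proof (intro equalityI subsetI)
    fix w assume w: "w \<in> gridbox a (2 * l)"
    show "w \<in> (\<Union>b\<in>Ch. gridbox b l)"
    proof (rule UN_I)
      show "(\<lambda>i. if w i < a i + int l then a i else a i + int l) \<in> Ch" by (simp add: mem)
      show "w \<in> gridbox (\<lambda>i. if w i < a i + int l then a i else a i + int l) l"
        unfolding mem_gridbox
      proof
        fix i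
        have "a i \<le> w i \<and> w i < a i + int (2 * l)" using w by (simp add: mem_gridbox)
        then show "(if w i < a i + int l then a i else a i + int l) \<le> w i \<and>
            w i < (if w i < a i + int l then a i else a i + int l) + int l" by auto
      qed
    qed
  next
    fix w assume "w \<in> (\<Union>b\<in>Ch. gridbox b l)"
    then obtain b where "b \<in> Ch" "w \<in> gridbox b l" by blast
    show "w \<in> gridbox a (2 * l)"
      unfolding mem_gridbox
    proof
      fix i
      have "b i = a i \<or> b i = a i + int l" using \<open>b \<in> Ch\<close> by (simp add: mem)
      moreover have "b i \<le> w i \<and> w i < b i + int l"
        using \<open>w \<in> gridbox b l\<close> by (simp add: mem_gridbox)
      ultimately show "a i \<le> w i \<and> w i < a i + int (2 * l)" by auto
    qed
  qed
  assume "b \<in> Ch" "c \<in> Ch" "b \<noteq> c"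
  then obtain i where "b i \<noteq> c i" by (auto simp: fun_eq_iff)
  moreover have "b i = a i \<or> b i = a i + int l" "c i = a i \<or> c i = a i + int l"
    using \<open>b \<in> Ch\<close> \<open>c \<in> Ch\<close> by (auto simp: mem)
  ultimately show "gridbox b l \<inter> gridbox c l = {}"
    unfolding set_eq_iff Int_iff mem_gridbox by (smt (verit) empty_iff)
qed

text \<open>A dyadic form of the boxing inequality: in a cube where \<open>A\<close> has density between
  \<open>2^(-N-1)\<close> and \<open>1/2\<close> the isoperimetric inequality applies, and in a cube of smaller density
  all children still have density at most \<open>1/2\<close>.\<close>

lemma boxing:
  fixes a :: "'n::finite \<Rightarrow> int"
  assumes nonneg: "\<And>v. 0 \<le> w v" and "growth a p \<epsilon> w"
    and "2 * card (A \<inter> gridbox a (2 ^ p)) \<le> card (gridbox a (2 ^ p))"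
  shows "sum w (A \<inter> gridbox a (2 ^ p)) \<le> 2 ^ (CARD('n) + 2) * \<epsilon> * card (gcutset a (2 ^ p) A)"
  using assms(2,3)
proof (induction p arbitrary: a)
  case 0
  have "sum w (gridbox a (2 ^ 0)) \<le> \<epsilon> * 2 ^ (0 * (CARD('n) - 1))"
    using 0 by (intro growthD[of a 0]) auto
  then have "0 \<le> \<epsilon>" using sum_nonneg[of "gridbox a (2 ^ 0)" w] nonneg by simp
  moreover have "2 * card (A \<inter> gridbox a (2 ^ 0)) \<le> 1" using 0(2) card_gridbox[of a "2 ^ 0"] by simp
  then have "card (A \<inter> gridbox a (2 ^ 0)) = 0" by linarith
  then have "A \<inter> gridbox a (2 ^ 0) = {}"
    using card_0_eq[OF finite_Int[OF disjI2[OF finite_gridbox]]] by blast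
  ultimately show ?case by simp
next
  case (Suc p)
  define N where "N = CARD('n)"
  define s where "s = N - 1"
  have N: "N = Suc s" by (simp add: s_def N_def)
  define l where "l = (2::nat) ^ Suc p"
  let ?Q = "gridbox a l"
  define n where "n = card (A \<inter> ?Q)"
  have l: "l > 0" by (simp add: l_def)
  have cardQ: "card ?Q = l ^ N" by (simp add: card_gridbox N_def)
  have half: "2 * n \<le> l ^ N" using Suc.prems(2) cardQ by (simp add: n_def l_def)
  have "sum w (gridbox a (2 ^ 0)) \<le> \<epsilon> * 2 ^ (0 * (CARD('n) - 1))"
    using Suc.prems(1) by (rule growthD) auto
  then have \<epsilon>: "0 \<le> \<epsilon>" using sum_nonneg[of "gridbox a (2 ^ 0)" w] nonneg by simp
  show ?case
  proof (cases "l ^ N \<le> 2 ^ (N + 1) * n")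
    case True
    have diff: "card (?Q - A) = l ^ N - n"
      using cardQ card_Diff_subset_Int[of ?Q A] by (simp add: n_def Int_commute)
    have "l ^ (N + 1) * card (gcutset a l A) \<ge> n * (l ^ N - n)"
      using grid_isoperimetry[of A a l] by (simp add: diff n_def[symmetric] N_def)
    then have "2 ^ (N + 2) * (l ^ (N + 1) * card (gcutset a l A)) \<ge> (2 ^ (N + 1) * n) * (2 * (l ^ N - n))"
      by (simp add: mult_ac)
    \<comment> \<open>Density at least 2^(-N-1) bounds the first factor below by l^N, density at
      most 1/2 the second.\<close>
    moreover have "(2 ^ (N + 1) * n) * (2 * (l ^ N - n)) \<ge> l ^ N * l ^ N"
      using True half by (intro mult_mono) auto
    ultimately have "l ^ N * l ^ N \<le> 2 ^ (N + 2) * (l ^ (N + 1) * card (gcutset a l A))" by linarith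
    moreover have "l ^ N * l ^ N = l ^ (N + 1) * l ^ s" by (simp add: N power_add[symmetric])
    ultimately have "l ^ (N + 1) * l ^ s \<le> l ^ (N + 1) * (2 ^ (N + 2) * card (gcutset a l A))"
      by (simp only: mult.left_commute)
    then have ls: "l ^ s \<le> 2 ^ (N + 2) * card (gcutset a l A)" using l by simp
    have "sum w (A \<inter> ?Q) \<le> sum w ?Q" using nonneg by (intro sum_mono2) auto
    also have "\<dots> \<le> \<epsilon> * 2 ^ (Suc p * s)"
      using growthD[OF Suc.prems(1), of "Suc p" a] by (simp add: l_def s_def N_def)
    also have "\<dots> = \<epsilon> * real (l ^ s)" unfolding l_def power_mult by simp
    also have "\<dots> \<le> \<epsilon> * real (2 ^ (N + 2) * card (gcutset a l A))"
      using ls \<epsilon> by (intro mult_left_mono) (auto simp only: of_nat_le_iff)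
    finally show ?thesis by (simp add: l_def N_def mult_ac)
  next
    case False
    define Ch where "Ch = PiE UNIV (\<lambda>i. {a i, a i + int (2 ^ p)})"
    have Ch: "finite Ch" unfolding Ch_def by (intro finite_PiE) auto
    have Q: "?Q = (\<Union>b\<in>Ch. gridbox b (2 ^ p))"
      using gridbox_children(1)[of a "2 ^ p"] by (simp add: l_def Ch_def)
    have disj: "gridbox b (2 ^ p) \<inter> gridbox c (2 ^ p) = {}" if "b \<in> Ch" "c \<in> Ch" "b \<noteq> c" for b c
      using gridbox_children(2)[of b a "2 ^ p" c] that by (simp add: Ch_def)
    have child: "sum w (A \<inter> gridbox b (2 ^ p)) \<le> 2 ^ (CARD('n) + 2) * \<epsilon> * card (gcutset b (2 ^ p) A)" if b: "b \<in> Ch" for b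
    proof (rule Suc.IH)
      have db: "2 ^ p dvd b i - a i" for i
      proof -
        have "b i = a i \<or> b i = a i + 2 ^ p" using b by (auto simp: Ch_def PiE_def Pi_def)
        then show ?thesis by auto
      qed
      show "growth b p \<epsilon> w"
        unfolding growth_def
      proof (intro allI impI)
        fix q c assume q: "q \<le> p" and c: "\<forall>i. 2 ^ q dvd c i - b i"
        have "2 ^ q dvd c i - a i" for i
        proof -
          have "(2::int) ^ q dvd 2 ^ p" using q by (rule le_imp_power_dvd)
          then have "2 ^ q dvd (c i - b i) + (b i - a i)"
            using c db[of i] by (intro dvd_add) (auto intro: dvd_trans)
          then show ?thesis by simp
        qed
        then show "sum w (gridbox c (2 ^ q)) \<le> \<epsilon> * 2 ^ (q * (CARD('n) - 1))"
          using q by (intro growthD[OF Suc.prems(1)]) auto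
      qed
      \<comment> \<open>Here \<open>n\<close> is below half the volume of a child, so the induction
        hypothesis applies even if one child holds all the points.\<close>
      have "card (A \<inter> gridbox b (2 ^ p)) \<le> n"
        unfolding n_def Q using b Ch by (intro card_mono) auto
      moreover have "l ^ N = 2 ^ N * (2 ^ p) ^ N" by (simp add: l_def power_mult_distrib)
      ultimately have "2 ^ N * (2 * card (A \<inter> gridbox b (2 ^ p))) \<le> 2 ^ N * (2 ^ p) ^ N"
        using False by (simp add: mult_ac)
      then show "2 * card (A \<inter> gridbox b (2 ^ p)) \<le> card (gridbox b (2 ^ p))"
        by (simp add: card_gridbox N_def)
    qed
    have "A \<inter> ?Q = (\<Union>b\<in>Ch. A \<inter> gridbox b (2 ^ p))" using Q by blast
    then have "sum w (A \<inter> ?Q) = (\<Sum>b\<in>Ch. sum w (A \<inter> gridbox b (2 ^ p)))"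
      using Ch disj by (simp only:) (rule sum.UNION_disjoint, auto)
    also have "\<dots> \<le> (\<Sum>b\<in>Ch. 2 ^ (CARD('n) + 2) * \<epsilon> * card (gcutset b (2 ^ p) A))"
      by (rule sum_mono) (rule child)
    also have "\<dots> = 2 ^ (CARD('n) + 2) * \<epsilon> * real (\<Sum>b\<in>Ch. card (gcutset b (2 ^ p) A))"
      by (simp add: sum_distrib_left)
    \<comment> \<open>Cut sets of the children are disjoint and contained in that of the parent, so
      the bounds add up with the same constant at every level.\<close>
    also have "(\<Sum>b\<in>Ch. card (gcutset b (2 ^ p) A)) = card (\<Union>b\<in>Ch. gcutset b (2 ^ p) A)"
    proof (rule card_UN_disjoint[symmetric])
      show "\<forall>b\<in>Ch. \<forall>c\<in>Ch. b \<noteq> c \<longrightarrow> gcutset b (2 ^ p) A \<inter> gcutset c (2 ^ p) A = {}"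
        using disj by (fastforce simp: gcutset_def gedges_def)
    qed (use Ch in auto)
    also have "2 ^ (CARD('n) + 2) * \<epsilon> * real (card (\<Union>b\<in>Ch. gcutset b (2 ^ p) A)) \<le>
        2 ^ (CARD('n) + 2) * \<epsilon> * real (card (gcutset a l A))"
    proof -
      have "(\<Union>b\<in>Ch. gcutset b (2 ^ p) A) \<subseteq> gcutset a l A"
        using Q by (auto simp: gcutset_def gedges_def)
      then have "card (\<Union>b\<in>Ch. gcutset b (2 ^ p) A) \<le> card (gcutset a l A)" by (rule card_mono[rotated]) simp
      then show ?thesis using \<epsilon> by (intro mult_left_mono) auto
    qed
    finally show ?thesis by (simp add: l_def)
  qed
qed

text \<open>\<open>boxing\<close> supplies the cut condition of \<open>max_flow\<close> for sets of
  at most half the volume. A larger set is replaced by its complement, which has the same cut and,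
  since the totals agree, the opposite imbalance.\<close>

lemma block_flow:
  fixes a :: "'n::finite \<Rightarrow> int"
  assumes w: "\<And>v. 0 \<le> w1 v" "\<And>v. 0 \<le> w2 v" "growth a p \<epsilon> w1" "growth a p \<epsilon> w2"
    and bal: "sum w1 (gridbox a (2 ^ p)) = sum w2 (gridbox a (2 ^ p))"
  obtains f :: "'n \<Rightarrow> ('n \<Rightarrow> int) \<Rightarrow> real" where
    "\<And>i v. \<bar>f i v\<bar> \<le> 2 ^ (CARD('n) + 2) * \<epsilon>"
    "\<And>i v. (i, v) \<notin> gedges a (2 ^ p) \<Longrightarrow> f i v = 0"
    "\<And>v. v \<in> gridbox a (2 ^ p) \<Longrightarrow> (\<Sum>i\<in>UNIV. f i (v(i := v i - 1)) - f i v) = w1 v - w2 v"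
    "\<And>v. v \<notin> gridbox a (2 ^ p) \<Longrightarrow> (\<Sum>i\<in>UNIV. f i (v(i := v i - 1)) - f i v) = 0"
proof -
  define Q where "Q = gridbox a (2 ^ p)"
  define E where "E = gedges a (2 ^ p)"
  define C where "C = 2 ^ (CARD('n) + 2) * \<epsilon>"
  have "sum w1 (gridbox a (2 ^ 0)) \<le> \<epsilon> * 2 ^ (0 * (CARD('n) - 1))"
    using w(3) by (rule growthD) auto
  then have \<epsilon>: "0 \<le> \<epsilon>" using sum_nonneg[of "gridbox a (2 ^ 0)" w1] w(1) by simp
  have small: "\<bar>\<Sum>v\<in>A. w1 v - w2 v\<bar> \<le> C * card (gcutset a (2 ^ p) A)"
    if A: "A \<subseteq> Q" "2 * card A \<le> card Q" for A
  proof -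
    have "A \<inter> gridbox a (2 ^ p) = A" using A by (auto simp: Q_def)
    then have "sum w1 A \<le> C * card (gcutset a (2 ^ p) A)" "sum w2 A \<le> C * card (gcutset a (2 ^ p) A)"
      using boxing[OF w(1,3), of A] boxing[OF w(2,4), of A] A by (auto simp: Q_def C_def)
    moreover have "0 \<le> sum w1 A" "0 \<le> sum w2 A" using w by (auto intro: sum_nonneg)
    ultimately show ?thesis by (simp add: sum_subtractf)
  qed
  have finQ: "finite Q" by (simp add: Q_def)
  have cut: "\<bar>\<Sum>v\<in>A. w1 v - w2 v\<bar> \<le> C * card {e\<in>E. (snd e \<in> A) \<noteq> (up (fst e) (snd e) \<in> A)}"
    if A: "A \<subseteq> Q" for A
  proof (cases "2 * card A \<le> card Q")
    case True
    then show ?thesis using small[OF A] by (simp add: gcutset_def E_def)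
  next
    case False
    have "card (Q - A) = card Q - card A" using A finQ by (intro card_Diff_subset) (auto intro: finite_subset)
    then have "\<bar>\<Sum>v\<in>Q - A. w1 v - w2 v\<bar> \<le> C * card (gcutset a (2 ^ p) (Q - A))"
      using False by (intro small) auto
    moreover have "(\<Sum>v\<in>Q - A. w1 v - w2 v) = - (\<Sum>v\<in>A. w1 v - w2 v)"
      using bal A finQ by (simp add: sum_diff Q_def[symmetric] sum_subtractf)
    moreover have "gcutset a (2 ^ p) (Q - A) = {e\<in>E. (snd e \<in> A) \<noteq> (up (fst e) (snd e) \<in> A)}"
      by (auto simp: gcutset_def E_def gedges_def Q_def)
    ultimately show ?thesis by simp
  qed
  obtain f where f: "\<And>e. \<bar>f e\<bar> \<le> C"
    "\<And>v. v \<in> Q \<Longrightarrow> (\<Sum>e\<in>E. f e * (of_bool (up (fst e) (snd e) = v) - of_bool (snd e = v))) = w1 v - w2 v"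
  proof (rule max_flow[of E Q snd "\<lambda>e. up (fst e) (snd e)" C "\<lambda>v. w1 v - w2 v"])
    show "0 \<le> C" using \<epsilon> by (simp add: C_def)
    show "finite E" by (simp add: E_def)
  qed (use cut finQ in \<open>auto simp: E_def Q_def gedges_def\<close>)
  \<comment> \<open>Extension by 0 off the edge set lets the net inflow be written as a sum over all
    directions, also at the boundary of the box.\<close>
  define g where "g i v = (if (i, v) \<in> E then f (i, v) else 0)" for i v
  have finE: "finite E" by (simp add: E_def)
  have net: "(\<Sum>i\<in>UNIV. g i (v(i := v i - 1)) - g i v) =
      (\<Sum>e\<in>E. f e * (of_bool (up (fst e) (snd e) = v) - of_bool (snd e = v)))" for v
  proof -
    have 1: "(\<Sum>i\<in>UNIV. g i v) = (\<Sum>e\<in>E. f e * of_bool (snd e = v))"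
    proof -
      have "(\<Sum>e\<in>E. f e * of_bool (snd e = v)) = (\<Sum>e\<in>E \<inter> {e. snd e = v}. f e)"
        using finE by (simp add: sum.inter_restrict of_bool_def if_distrib cong: if_cong)
      also have "\<dots> = (\<Sum>i\<in>{i. (i, v) \<in> E}. f (i, v))"
        by (rule sum.reindex_bij_witness[of _ "\<lambda>i. (i, v)" fst]) auto
      also have "\<dots> = (\<Sum>i\<in>UNIV. g i v)"
        unfolding g_def by (simp add: sum.If_cases)
      finally show ?thesis by simp
    qed
    have 2: "(\<Sum>i\<in>UNIV. g i (v(i := v i - 1))) = (\<Sum>e\<in>E. f e * of_bool (up (fst e) (snd e) = v))"
    proof -
      have "(\<Sum>e\<in>E. f e * of_bool (up (fst e) (snd e) = v)) = (\<Sum>e\<in>E \<inter> {e. up (fst e) (snd e) = v}. f e)"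
        using finE by (simp add: sum.inter_restrict of_bool_def if_distrib cong: if_cong)
      also have "\<dots> = (\<Sum>i\<in>{i. (i, v(i := v i - 1)) \<in> E}. f (i, v(i := v i - 1)))"
        by (rule sum.reindex_bij_witness[of _ "\<lambda>i. (i, v(i := v i - 1))" fst]) (auto simp: up_def)
      also have "\<dots> = (\<Sum>i\<in>UNIV. g i (v(i := v i - 1)))"
        unfolding g_def by (simp add: sum.If_cases)
      finally show ?thesis by simp
    qed
    show ?thesis unfolding sum_subtractf 1 2 by (simp add: right_diff_distrib sum_subtractf)
  qed
  show ?thesis
  proof (rule that[of g])
    show "\<bar>g i v\<bar> \<le> 2 ^ (CARD('n) + 2) * \<epsilon>" for i v
      using f(1)[of "(i, v)"] \<epsilon> by (simp add: g_def C_def)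
    show "g i v = 0" if "(i, v) \<notin> gedges a (2 ^ p)" for i v
      using that by (simp add: g_def E_def)
    show "(\<Sum>i\<in>UNIV. g i (v(i := v i - 1)) - g i v) = w1 v - w2 v" if "v \<in> gridbox a (2 ^ p)" for v
      using net f(2) that by (simp add: Q_def)
    show "(\<Sum>i\<in>UNIV. g i (v(i := v i - 1)) - g i v) = 0" if "v \<notin> gridbox a (2 ^ p)" for v
    proof -
      have "g i v = 0" "g i (v(i := v i - 1)) = 0" for i
        using that by (auto simp: g_def E_def gedges_def up_def)
      then show ?thesis by simp
    qed
  qed
qed

section \<open>Dyadic gauges and Frostman masses\<close>

definition idx :: "nat \<Rightarrow> real ^ 'n \<Rightarrow> 'n \<Rightarrow> int" where
  "idx k x = (\<lambda>i. \<lfloor>2 ^ k * x $ i\<rfloor>)"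

text \<open>Half-open, so that every point lies in exactly one cell of each level. The pair consists
  of the level and the index.\<close>

definition cell :: "nat \<times> ('n \<Rightarrow> int) \<Rightarrow> (real ^ 'n) set" where
  "cell q = {x. idx (fst q) x = snd q}"

definition anc :: "nat \<Rightarrow> ('n \<Rightarrow> int) \<Rightarrow> 'n \<Rightarrow> int" where
  "anc d z = (\<lambda>i. z i div 2 ^ d)"

lemma anc_0 [simp]: "anc 0 z = z"
  by (simp add: anc_def)

lemma anc_Suc: "anc (Suc d) z = half (anc d z)"
  unfolding anc_def half_def power_Suc2 by (subst zdiv_zmult2_eq) simp_all

lemma anc_Suc': "anc (Suc d) z = anc d (half z)"
  unfolding anc_def half_def power_Suc by (subst zdiv_zmult2_eq) simp_all

lemma half_idx: "half (idx (Suc k) x) = idx k x"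
proof
  fix i
  have "\<lfloor>2 ^ Suc k * x $ i / real_of_int 2\<rfloor> = \<lfloor>2 ^ Suc k * x $ i\<rfloor> div 2"
    by (rule floor_divide_real_eq_div) simp
  then show "half (idx (Suc k) x) i = idx k x i" by (simp add: half_def idx_def)
qed

lemma anc_idx: "anc k (idx k x) = idx 0 x"
  by (induction k) (simp_all add: anc_Suc' half_idx)

lemma finite_anc_fibre: "finite {w :: 'n::finite \<Rightarrow> int. anc d w = z}"
proof -
  have "{w. anc d w = z} \<subseteq> PiE UNIV (\<lambda>i. {z i * 2 ^ d..z i * 2 ^ d + 2 ^ d})"
  proof
    fix w assume "w \<in> {w. anc d w = z}"
    then have w: "w i div 2 ^ d = z i" for i by (auto simp: anc_def)
    have "z i * 2 ^ d \<le> w i \<and> w i \<le> z i * 2 ^ d + 2 ^ d" for i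
    proof -
      have "0 \<le> w i mod 2 ^ d" "w i mod 2 ^ d < 2 ^ d" by simp_all
      moreover have "z i * 2 ^ d + w i mod 2 ^ d = w i"
        using div_mult_mod_eq[of "w i" "2 ^ d"] w[of i] by simp
      ultimately show ?thesis by linarith
    qed
    then show "w \<in> PiE UNIV (\<lambda>i. {z i * 2 ^ d..z i * 2 ^ d + 2 ^ d})" by auto
  qed
  then show ?thesis by (rule finite_subset) (auto intro: finite_PiE)
qed

text \<open>Descendants of one cell of level 0. Each level contains finitely many of them, which
  lets the bad covers in \<open>robust_step\<close> agree with their limit on all coarse levels at
  once.\<close>

definition tree :: "('n \<Rightarrow> int) \<Rightarrow> (nat \<times> ('n \<Rightarrow> int)) set" where
  "tree z0 = {q. anc (fst q) (snd q) = z0}"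

lemma finite_tree_levels: "finite {q \<in> tree (z0 :: 'n::finite \<Rightarrow> int). fst q < k}"
proof (rule finite_subset)
  show "{q \<in> tree z0. fst q < k} \<subseteq> (SIGMA d:{..<k}. {w. anc d w = z0})" by (auto simp: tree_def)
  show "finite (SIGMA d:{..<k}. {w :: 'n \<Rightarrow> int. anc d w = z0})"
    by (intro finite_SigmaI finite_anc_fibre) simp
qed

lemma cell_tree: "x \<in> cell q \<Longrightarrow> q \<in> tree (idx 0 x)"
  using anc_idx[of "fst q" x] by (simp add: cell_def tree_def)

text \<open>A cell of level \<open>k\<close> fits into a ball of radius 2^p / 2^k as soon as 2^p
  exceeds the dimension, because the norm is estimated by the sum of the coordinates. Covers by
  cells thus become ball covers, with the constant multiplied by 2^(p s).\<close>

lemma hausdorff_sigma_finite_cells: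
  fixes R :: "(real ^ 'n) set" and C :: real
  assumes cov: "\<And>k0. \<exists>Q. R \<subseteq> (\<Union>q\<in>Q. cell q) \<and> (\<forall>q\<in>Q. k0 \<le> fst q) \<and>
     (\<forall>J. finite J \<longrightarrow> J \<subseteq> Q \<longrightarrow> (\<Sum>q\<in>J. (1/2) ^ (fst q * s)) \<le> C)"
  shows "hausdorff_sigma_finite (real s) R"
proof -
  obtain p where p: "real CARD('n) < 2 ^ p" using real_arch_pow[of 2 "real CARD('n)"] by auto
  have "ball_covers s R (2 ^ (p * s) * C) K" for K
  proof -
    obtain Q where Q: "R \<subseteq> (\<Union>q\<in>Q. cell q)" "\<And>q. q \<in> Q \<Longrightarrow> K + p \<le> fst q"
      "\<And>J. finite J \<Longrightarrow> J \<subseteq> Q \<Longrightarrow> (\<Sum>q\<in>J. (1/2) ^ (fst q * s)) \<le> C"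
      using cov[of "K + p"] by blast
    define corner where "corner q = ((\<chi> i. real_of_int (snd q i) / 2 ^ fst q) :: real ^ 'n)" for q :: "nat \<times> ('n \<Rightarrow> int)"
    have cb: "cell q \<subseteq> ball (corner q) ((1/2) ^ (fst q - p))" if "p \<le> fst q" for q
    proof
      fix x assume x: "x \<in> cell q"
      have "norm (corner q - x) \<le> (\<Sum>i\<in>UNIV. \<bar>(corner q - x) $ i\<bar>)" by (rule norm_le_l1_cart)
      also have "\<dots> \<le> (\<Sum>i\<in>(UNIV :: 'n set). 1 / 2 ^ fst q)"
      proof (rule sum_mono)
        fix i
        have "idx (fst q) x i = snd q i" using x by (simp add: cell_def)
        then have "\<lfloor>2 ^ fst q * x $ i\<rfloor> = snd q i" by (simp add: idx_def)
        then have "real_of_int (snd q i) \<le> 2 ^ fst q * x $ i" "2 ^ fst q * x $ i \<le> real_of_int (snd q i) + 1"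
          by linarith+
        then have "real_of_int (snd q i) / 2 ^ fst q \<le> x $ i" "x $ i \<le> real_of_int (snd q i) / 2 ^ fst q + 1 / 2 ^ fst q"
          by (simp_all add: field_simps)
        then show "\<bar>(corner q - x) $ i\<bar> \<le> 1 / 2 ^ fst q" by (simp add: corner_def)
      qed
      also have "\<dots> < 2 ^ p * (1 / 2 ^ fst q)" using p by (simp add: divide_strict_right_mono)
      also have "\<dots> = (1/2) ^ (fst q - p)" using that by (simp add: power_diff power_one_over)
      finally show "x \<in> ball (corner q) ((1/2) ^ (fst q - p))" by (simp add: dist_norm)
    qed
    define g :: "nat \<Rightarrow> nat \<times> ('n \<Rightarrow> int)" where "g = from_nat"
    show ?thesis
      unfolding ball_covers_def
    proof (intro exI conjI ballI allI impI)
      show "R \<subseteq> (\<Union>n\<in>to_nat ` Q. ball (corner (g n)) ((1/2) ^ (fst (g n) - p)))"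
      proof
        fix x assume "x \<in> R"
        then obtain q where q: "q \<in> Q" "x \<in> cell q" using Q(1) by blast
        then have "x \<in> ball (corner q) ((1/2) ^ (fst q - p))" using cb[of q] Q(2)[of q] by auto
        then show "x \<in> (\<Union>n\<in>to_nat ` Q. ball (corner (g n)) ((1/2) ^ (fst (g n) - p)))"
          using q(1) by (intro UN_I[of "to_nat q"]) (auto simp: g_def)
      qed
      show "K \<le> fst (g n) - p" if "n \<in> to_nat ` Q" for n
        using that Q(2) by (force simp: g_def)
      fix J assume J: "finite J" "J \<subseteq> to_nat ` Q"
      have inj: "inj_on g J"
      proof (rule inj_onI)
        fix m n assume "m \<in> J" "n \<in> J" "g m = g n"
        moreover obtain a b :: "nat \<times> ('n \<Rightarrow> int)" where "m = to_nat a" "n = to_nat b" using J(2) calculation by blast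
        ultimately show "m = n" by (simp add: g_def)
      qed
      have "(\<Sum>n\<in>J. (1/2::real) ^ ((fst (g n) - p) * s)) = (\<Sum>n\<in>J. 2 ^ (p * s) * (1/2) ^ (fst (g n) * s))"
      proof (rule sum.cong[OF refl])
        fix n assume "n \<in> J"
        then have "p \<le> fst (g n)" using J(2) Q(2) by (force simp: g_def)
        then have "fst (g n) * s = (fst (g n) - p) * s + p * s" by (simp add: algebra_simps)
        then show "(1/2::real) ^ ((fst (g n) - p) * s) = 2 ^ (p * s) * (1/2) ^ (fst (g n) * s)"
          by (simp add: power_add power_one_over)
      qed
      also have "\<dots> = 2 ^ (p * s) * (\<Sum>q\<in>g ` J. (1/2) ^ (fst q * s))"
        by (simp add: sum_distrib_left sum.reindex[OF inj])
      also have "\<dots> \<le> 2 ^ (p * s) * C"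
        using J by (intro mult_left_mono Q(3)) (auto simp: g_def)
      finally show "(\<Sum>n\<in>J. (1/2) ^ ((fst (g n) - p) * s)) \<le> 2 ^ (p * s) * C" .
    qed
  qed
  then have "hausdorff_measure (real s) R < \<infinity>" by (rule ball_covers_imp_finite_hausdorff_measure)
  then show ?thesis unfolding hausdorff_sigma_finite_def by (intro exI[of _ "\<lambda>_. R"]) auto
qed

section \<open>Gauges of smaller order than l^s with positive content\<close>

lemma hausdorff_sigma_finite_empty: "hausdorff_sigma_finite (real s) ({} :: (real ^ 'n) set)"
  by (rule hausdorff_sigma_finite_cells[of _ _ 0]) (auto intro!: exI[of _ "{}"])

text \<open>Sequential compactness of the power set of a countable type: a diagonal subsequence
  decides the membership of each element in turn.\<close>

lemma stabilizing_subsequence: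
  fixes Q :: "nat \<Rightarrow> 'a :: countable set"
  obtains r where "strict_mono r" "\<And>q. \<exists>b. \<forall>\<^sub>F n in sequentially. (q \<in> Q (r n)) = b"
proof -
  define P where "P n s \<longleftrightarrow> (\<exists>b. \<forall>m :: nat. ((from_nat n :: 'a) \<in> Q (s m)) = b)" for n :: nat and s :: "nat \<Rightarrow> nat"
  interpret subseqs P
  proof
    fix n and s :: "nat \<Rightarrow> nat" assume "strict_mono s"
    define M where "M b = {m. ((from_nat n :: 'a) \<in> Q (s m)) = b}" for b
    have "infinite (M True) \<or> infinite (M False)"
    proof (rule ccontr)
      assume "\<not> ?thesis"
      then have "finite (M True \<union> M False)" by simp
      moreover have "M True \<union> M False = UNIV" by (auto simp: M_def)
      ultimately show False by simp
    qed
    then obtain b where "infinite (M b)" by blast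
    then have "\<exists>r :: nat \<Rightarrow> nat. strict_mono r \<and> (\<forall>m. r m \<in> M b)"
      by (rule infinite_enumerate)
    then obtain r :: "nat \<Rightarrow> nat" where "strict_mono r \<and> (\<forall>m. r m \<in> M b)" ..
    then show "\<exists>r'. strict_mono r' \<and> P n (s \<circ> r')"
      unfolding P_def by (intro exI[of _ r] conjI exI[of _ b]) (auto simp: M_def)
  qed
  show ?thesis
  proof (rule that[of diagseq])
    show "strict_mono diagseq" by (rule subseq_diagseq)
    fix q :: 'a
    have "P (to_nat q) (diagseq \<circ> (+) (Suc (to_nat q)))"
      by (rule diagseq_holds) (auto simp: P_def)
    then obtain b where b: "\<And>m. (q \<in> Q (diagseq (Suc (to_nat q) + m))) = b"
      by (auto simp: P_def)
    show "\<exists>b. \<forall>\<^sub>F n in sequentially. (q \<in> Q (diagseq n)) = b"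
      unfolding eventually_sequentially
      using b by (intro exI[of _ b] exI[of _ "Suc (to_nat q)"]) (metis le_iff_add)
  qed
qed

text \<open>The content of \<open>K\<close> modulo \<open>\<sigma>\<close>-finite sets with gauge \<open>h\<close> is at least \<open>c\<close>.\<close>

definition robust :: "(real ^ 'n) set \<Rightarrow> ('n \<Rightarrow> int) \<Rightarrow> (nat \<Rightarrow> real) \<Rightarrow> real \<Rightarrow> bool" where
  "robust K z0 h c \<longleftrightarrow> (\<forall>F Q. hausdorff_sigma_finite (real (CARD('n) - 1)) F \<longrightarrow> Q \<subseteq> tree z0 \<longrightarrow>
      K - F \<subseteq> (\<Union>q\<in>Q. cell q) \<longrightarrow> (\<exists>Q'. finite Q' \<and> Q' \<subseteq> Q \<and> c \<le> (\<Sum>q\<in>Q'. h (fst q))))"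

lemma robustD:
  fixes K :: "(real ^ 'n) set"
  assumes "robust K z0 h c" "hausdorff_sigma_finite (real (CARD('n) - 1)) F" "Q \<subseteq> tree z0"
    "K - F \<subseteq> (\<Union>q\<in>Q. cell (q :: nat \<times> ('n \<Rightarrow> int)))"
  obtains Q' where "finite Q'" "Q' \<subseteq> Q" "c \<le> (\<Sum>q\<in>Q'. h (fst q))"
  using assms(1)[unfolded robust_def, rule_format, OF assms(2,3,4)] by (elim exE conjE)

lemma not_robustD:
  assumes "\<not> robust (K :: (real ^ 'n) set) z0 h c"
  obtains F Q where "hausdorff_sigma_finite (real (CARD('n) - 1)) F" "Q \<subseteq> tree z0"
    "K - F \<subseteq> (\<Union>q\<in>Q. cell q)" "\<And>Q'. finite Q' \<Longrightarrow> Q' \<subseteq> Q \<Longrightarrow> (\<Sum>q\<in>Q'. h (fst q)) < c"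
  using assms unfolding robust_def by (auto simp: not_le)

text \<open>If no \<open>c\<close> worked, there would be covers of arbitrarily small sum outside
  sigma-finite sets. A small sum excludes coarse cells, since a single cell of level
  \<open>k\<close> already costs (1/2)^(k s), so what is left after removing the exceptional sets
  has finite measure.\<close>

lemma robust_start:
  fixes K :: "(real ^ 'n) set"
  defines "s \<equiv> CARD('n) - 1"
  assumes "\<not> hausdorff_sigma_finite (real s) K"
  obtains c where "c > 0" "robust K z0 (\<lambda>k. (1/2) ^ (k * s)) c"
proof (rule ccontr)
  assume "\<not> thesis"
  then have nr: "\<not> robust K z0 (\<lambda>k. (1/2) ^ (k * s)) (1 / (real n + 1))" for n
    using that[of "1 / (real n + 1)"] by auto
  have "\<exists>F Q. hausdorff_sigma_finite (real s) F \<and> K - F \<subseteq> (\<Union>q\<in>Q. cell q) \<and>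
      (\<forall>Q'. finite Q' \<longrightarrow> Q' \<subseteq> Q \<longrightarrow> (\<Sum>q\<in>Q'. (1/2) ^ (fst q * s)) < 1 / (real n + 1))" for n
    using not_robustD[OF nr[of n]] unfolding s_def by metis
  then obtain F Q where F: "\<And>n. hausdorff_sigma_finite (real s) (F n)"
    and cov: "\<And>n. K - F n \<subseteq> (\<Union>q\<in>Q n. cell q)"
    and small: "\<And>n Q'. finite Q' \<Longrightarrow> Q' \<subseteq> Q n \<Longrightarrow> (\<Sum>q\<in>Q'. (1/2) ^ (fst q * s)) < 1 / (real n + 1)"
    by metis
  have "hausdorff_sigma_finite (real s) (K - (\<Union>n. F n))"
  proof (rule hausdorff_sigma_finite_cells)
    fix k0
    obtain n where n: "1 / (real n + 1) < (1/2) ^ (k0 * s)"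
      using reals_Archimedean[of "(1/2) ^ (k0 * s)"] by (auto simp: inverse_eq_divide add.commute)
    show "\<exists>Q. K - (\<Union>n. F n) \<subseteq> (\<Union>q\<in>Q. cell q) \<and> (\<forall>q\<in>Q. k0 \<le> fst q) \<and>
     (\<forall>J. finite J \<longrightarrow> J \<subseteq> Q \<longrightarrow> (\<Sum>q\<in>J. (1/2) ^ (fst q * s)) \<le> (1::real))"
    proof (intro exI[of _ "Q n"] conjI ballI allI impI)
      show "K - (\<Union>n. F n) \<subseteq> (\<Union>q\<in>Q n. cell q)" using cov[of n] by blast
      show "k0 \<le> fst q" if "q \<in> Q n" for q
      proof -
        have "(1/2::real) ^ (fst q * s) < (1/2) ^ (k0 * s)"
        proof -
          have "(1/2) ^ (fst q * s) < 1 / (real n + 1)" using small[of "{q}" n] that by simp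
          then show ?thesis using n by linarith
        qed
        then have "k0 * s < fst q * s" by (rule power_strict_decreasing_iff[THEN iffD1, rotated 2]) auto
        then show ?thesis by simp
      qed
      show "(\<Sum>q\<in>J. (1/2) ^ (fst q * s)) \<le> (1::real)" if "finite J" "J \<subseteq> Q n" for J
      proof -
        have "1 / (real n + 1) \<le> 1" by simp
        then show ?thesis using small[OF that] by linarith
      qed
    qed
  qed
  then have "hausdorff_sigma_finite (real s) ((K - (\<Union>n. F n)) \<union> (\<Union>n. F n))"
    using F by (intro hausdorff_sigma_finite_Un hausdorff_sigma_finite_UN)
  then have "hausdorff_sigma_finite (real s) K" by (rule hausdorff_sigma_finite_subset) blast
  with assms show False by simp
qed

text \<open>If lowering the gauge below every scale \<open>p\<close> fails, a subsequence of the bad covers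
  stabilises at each scale. The limit cover leaves out a set that has finite measure,
  because it is covered by arbitrarily small cells of bounded total size.\<close>

lemma robust_step:
  fixes K :: "(real ^ 'n) set"
  defines "s \<equiv> CARD('n) - 1"
  assumes rob: "robust K z0 h c" and c': "c' < c" and \<kappa>: "0 < \<kappa>" "\<And>k. \<kappa> * (1/2) ^ (k * s) \<le> h k"
  obtains p where "p0 < p" "robust K z0 (\<lambda>k. if k < p then h k else h k / 4) c'"
proof (rule ccontr)
  assume "\<not> thesis"
  define h' where "h' p k = (if k < p then h k else h k / 4)" for p k
  have nr: "\<not> robust K z0 (h' (p0 + 1 + n)) c'" for n
    using that[of "p0 + 1 + n"] \<open>\<not> thesis\<close> unfolding h'_def by auto
  have h_pos: "0 \<le> h k" for k
  proof -
    have "0 \<le> \<kappa> * (1/2) ^ (k * s)" using \<kappa>(1) by simp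
    then show ?thesis using \<kappa>(2)[of k] by linarith
  qed
  \<comment> \<open>The lowered gauge keeps at least a quarter of \<open>h\<close>, hence of its
    lower bound; this is the source of the constant 4 c' / \<kappa> below.\<close>
  have h_le: "h k \<le> 4 * h' p k" "0 \<le> h' p k" for p k using h_pos[of k] by (auto simp: h'_def)
  have "\<exists>F Q. hausdorff_sigma_finite (real s) F \<and> Q \<subseteq> tree z0 \<and> K - F \<subseteq> (\<Union>q\<in>Q. cell q) \<and>
      (\<forall>Q'. finite Q' \<longrightarrow> Q' \<subseteq> Q \<longrightarrow> (\<Sum>q\<in>Q'. h' (p0 + 1 + n) (fst q)) < c')" for n
    using not_robustD[OF nr[of n]] unfolding s_def by metis
  then obtain F Q where F: "\<And>n. hausdorff_sigma_finite (real s) (F n)"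
    and QT: "\<And>n. Q n \<subseteq> tree z0"
    and cov: "\<And>n. K - F n \<subseteq> (\<Union>q\<in>Q n. cell q)"
    and small: "\<And>n Q'. finite Q' \<Longrightarrow> Q' \<subseteq> Q n \<Longrightarrow> (\<Sum>q\<in>Q'. h' (p0 + 1 + n) (fst q)) < c'"
    by metis
  obtain r where r: "strict_mono r" "\<And>q. \<exists>b. \<forall>\<^sub>F n in sequentially. (q \<in> Q (r n)) = b"
    using stabilizing_subsequence[of Q] by blast
  define B where "B = {q. \<forall>\<^sub>F n in sequentially. q \<in> Q (r n)}"
  have B: "\<forall>\<^sub>F n in sequentially. (q \<in> Q (r n)) = (q \<in> B)" for q
  proof -
    obtain b where b: "\<forall>\<^sub>F n in sequentially. (q \<in> Q (r n)) = b" using r(2) by blast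
    show ?thesis
    proof (cases "q \<in> B")
      case True
      then show ?thesis by (auto simp: B_def elim: eventually_mono)
    next
      case False
      then have "\<not> b" using b by (cases b) (auto simp: B_def)
      then show ?thesis using b False by (auto elim: eventually_mono)
    qed
  qed
  have BT: "B \<subseteq> tree z0"
  proof
    fix q assume "q \<in> B"
    then have "\<exists>n. q \<in> Q (r n)" unfolding B_def by (auto dest: eventually_happens'[OF sequentially_bot])
    then show "q \<in> tree z0" using QT by blast
  qed
  define R where "R = K - (\<Union>n. F n) - (\<Union>q\<in>B. cell q)"
  have "hausdorff_sigma_finite (real s) R"
  proof (rule hausdorff_sigma_finite_cells)
    fix k0
    have "\<forall>\<^sub>F n in sequentially. \<forall>q\<in>{q \<in> tree z0. fst q < k0}. (q \<in> Q (r n)) = (q \<in> B)"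
      using finite_tree_levels B by (intro eventually_ball_finite) auto
    from eventually_happens'[OF sequentially_bot this]
    obtain n where n: "\<And>q. q \<in> tree z0 \<Longrightarrow> fst q < k0 \<Longrightarrow> (q \<in> Q (r n)) = (q \<in> B)"
      by blast
    show "\<exists>Q. R \<subseteq> (\<Union>q\<in>Q. cell q) \<and> (\<forall>q\<in>Q. k0 \<le> fst q) \<and>
     (\<forall>J. finite J \<longrightarrow> J \<subseteq> Q \<longrightarrow> (\<Sum>q\<in>J. (1/2) ^ (fst q * s)) \<le> 4 * c' / \<kappa>)"
    proof (intro exI[of _ "{q \<in> Q (r n). k0 \<le> fst q}"] conjI ballI allI impI)
      show "R \<subseteq> (\<Union>q\<in>{q \<in> Q (r n). k0 \<le> fst q}. cell q)"
      proof
        fix x assume x: "x \<in> R"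
        then obtain q where q: "q \<in> Q (r n)" "x \<in> cell q" using cov[of "r n"] by (auto simp: R_def)
        \<comment> \<open>A coarser cell would belong to the limit cover \<open>B\<close>, whose
          cells a point of \<open>R\<close> avoids.\<close>
        have "k0 \<le> fst q"
        proof (rule ccontr)
          assume "\<not> k0 \<le> fst q"
          then have "q \<in> B" using n[of q] q QT by auto
          then show False using x q by (auto simp: R_def)
        qed
        with q show "x \<in> (\<Union>q\<in>{q \<in> Q (r n). k0 \<le> fst q}. cell q)" by blast
      qed
      fix J assume J: "finite J" "J \<subseteq> {q \<in> Q (r n). k0 \<le> fst q}"
      have "(\<Sum>q\<in>J. (1/2) ^ (fst q * s)) \<le> (\<Sum>q\<in>J. 4 / \<kappa> * h' (p0 + 1 + r n) (fst q))"
      proof (rule sum_mono)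
        fix q
        have "\<kappa> * (1/2) ^ (fst q * s) \<le> 4 * h' (p0 + 1 + r n) (fst q)"
          using \<kappa>(2)[of "fst q"] h_le(1)[of "fst q" "p0 + 1 + r n"] by linarith
        then show "(1/2) ^ (fst q * s) \<le> 4 / \<kappa> * h' (p0 + 1 + r n) (fst q)"
          using \<kappa>(1) by (simp add: field_simps)
      qed
      also have "\<dots> = 4 / \<kappa> * (\<Sum>q\<in>J. h' (p0 + 1 + r n) (fst q))" by (simp add: sum_distrib_left)
      also have "\<dots> \<le> 4 / \<kappa> * c'"
        using small[of J "r n"] J \<kappa> by (intro mult_left_mono less_imp_le) auto
      finally show "(\<Sum>q\<in>J. (1/2) ^ (fst q * s)) \<le> 4 * c' / \<kappa>" by simp
    qed auto
  qed
  then have "hausdorff_sigma_finite (real s) ((\<Union>n. F n) \<union> R)"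
    using F by (intro hausdorff_sigma_finite_Un hausdorff_sigma_finite_UN)
  moreover have "K - ((\<Union>n. F n) \<union> R) \<subseteq> (\<Union>q\<in>B. cell q)" by (auto simp: R_def)
  ultimately obtain B' where B': "finite B'" "B' \<subseteq> B" "c \<le> (\<Sum>q\<in>B'. h (fst q))"
    using robustD[OF rob _ BT] unfolding s_def by metis
  have "\<forall>\<^sub>F n in sequentially. \<forall>q\<in>B'. q \<in> Q (r n)"
    using B'(1,2) by (intro eventually_ball_finite) (auto simp: B_def)
  \<comment> \<open>For large n the levels in \<open>B'\<close> lie below the scale from which the
    lowered gauge differs from \<open>h\<close>, so the sum over \<open>B'\<close> would be at least
    \<open>c\<close> and yet below \<open>c'\<close>.\<close>
  moreover have "\<forall>\<^sub>F n in sequentially. \<forall>q\<in>B'. fst q < n"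
    using B'(1) by (intro eventually_ball_finite) (auto intro: eventually_gt_at_top)
  ultimately have "\<forall>\<^sub>F n in sequentially. \<forall>q\<in>B'. q \<in> Q (r n) \<and> fst q < n"
    by eventually_elim blast
  from eventually_happens'[OF sequentially_bot this]
  obtain n where n: "\<And>q. q \<in> B' \<Longrightarrow> q \<in> Q (r n) \<and> fst q < n" by blast
  have "(\<Sum>q\<in>B'. h (fst q)) = (\<Sum>q\<in>B'. h' (p0 + 1 + r n) (fst q))"
  proof (rule sum.cong[OF refl])
    fix q assume "q \<in> B'"
    then have "fst q < p0 + 1 + r n" using n[of q] seq_suble[OF r(1), of n] by linarith
    then show "h (fst q) = h' (p0 + 1 + r n) (fst q)" by (simp add: h'_def)
  qed
  also have "\<dots> < c'" using n B'(1) by (intro small) auto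
  finally show False using B'(3) c' by simp
qed

text \<open>Each application of \<open>robust_step\<close> divides the gauge by 4 beyond a new
  scale. A fixed level feels only finitely many of these changes, so the gauges converge, and a
  finite cover sees a single stage of the construction.\<close>

lemma gauge_exists:
  fixes K :: "(real ^ 'n) set"
  defines "s \<equiv> CARD('n) - 1"
  assumes nsf: "\<not> hausdorff_sigma_finite (real s) K"
  obtains h :: "nat \<Rightarrow> real" and p c where
    "strict_mono p" "p 0 = 0" "0 < c" "\<And>k. 0 \<le> h k"
    "\<And>j k. p j \<le> k \<Longrightarrow> h k \<le> (1/4) ^ j * (1/2) ^ (k * s)"
    "\<And>Q. finite Q \<Longrightarrow> Q \<subseteq> tree z0 \<Longrightarrow> K \<subseteq> (\<Union>q\<in>Q. cell q) \<Longrightarrow> c \<le> (\<Sum>q\<in>Q. h (fst q))"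
proof -
  obtain c where c: "c > 0" "robust K z0 (\<lambda>k. (1/2) ^ (k * s)) c"
    using robust_start[of K z0] nsf unfolding s_def by blast
  \<comment> \<open>The thresholds c/2 + c/2^(n+1) start at \<open>c\<close>, decrease strictly as
    \<open>robust_step\<close> requires, and stay above c/2. The lower bound on the gauge provides
    \<kappa> for the next step.\<close>
  define P where "P n t \<longleftrightarrow> robust K z0 (fst t) (c / 2 + c / 2 ^ (n + 1)) \<and>
      (\<forall>k. (1/4) ^ n * (1/2) ^ (k * s) \<le> fst t k) \<and> (\<forall>k\<ge>snd t. fst t k \<le> (1/4) ^ n * (1/2) ^ (k * s)) \<and>
      (n = 0 \<longrightarrow> snd t = 0)" for n and t :: "(nat \<Rightarrow> real) \<times> nat"
  define Nx where "Nx t t' \<longleftrightarrow> snd t < snd t' \<and> fst t' = (\<lambda>k. if k < snd t' then fst t k else fst t k / 4)"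
    for t t' :: "(nat \<Rightarrow> real) \<times> nat"
  have "\<exists>t. \<forall>n. P n (t n) \<and> Nx (t n) (t (Suc n))"
  proof (rule dependent_nat_choice)
    show "\<exists>t. P 0 t" using c by (intro exI[of _ "(\<lambda>k. (1/2) ^ (k * s), 0)"]) (auto simp: P_def)
  next
    fix t n assume t: "P n t"
    then have rob: "robust K z0 (fst t) (c / 2 + c / 2 ^ (n + 1))" by (simp add: P_def)
    have less: "c / 2 + c / 2 ^ (Suc n + 1) < c / 2 + c / 2 ^ (n + 1)" using c by (simp add: field_simps)
    have lower: "(1/4) ^ n * (1/2) ^ (k * (CARD('n) - 1)) \<le> fst t k" for k using t by (simp add: P_def s_def)
    have "0 < (1/4 :: real) ^ n" by simp
    from robust_step[OF rob less this lower, of "snd t"] obtain p where p: "snd t < p"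
      "robust K z0 (\<lambda>k. if k < p then fst t k else fst t k / 4) (c / 2 + c / 2 ^ (Suc n + 1))"
      by blast
    show "\<exists>t'. P (Suc n) t' \<and> Nx t t'"
    proof (intro exI[of _ "(\<lambda>k. if k < p then fst t k else fst t k / 4, p)"] conjI)
      have lb: "(1/4) ^ n * (1/2) ^ (k * s) \<le> fst t k" for k using t by (simp add: P_def)
      have ub: "fst t k \<le> (1/4) ^ n * (1/2) ^ (k * s)" if "p \<le> k" for k using t p(1) that by (simp add: P_def)
      have pos: "(0::real) \<le> (1/4) ^ n * (1/2) ^ (k * s)" for k by simp
      have lb': "(1/4) ^ Suc n * (1/2) ^ (k * s) \<le> fst t k" for k
      proof -
        have "(1/4) ^ Suc n * (1/2) ^ (k * s) = ((1/4) ^ n * (1/2) ^ (k * s)) / (4::real)" by simp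
        then show ?thesis using lb[of k] pos[of k] by linarith
      qed
      show "P (Suc n) (\<lambda>k. if k < p then fst t k else fst t k / 4, p)"
        unfolding P_def using p(2) lb lb' ub by auto
      show "Nx t (\<lambda>k. if k < p then fst t k else fst t k / 4, p)"
        using p(1) by (simp add: Nx_def)
    qed
  qed
  then obtain t where t: "\<And>n. P n (t n)" "\<And>n. Nx (t n) (t (Suc n))" by blast
  define H where "H n = fst (t n)" for n
  define p where "p n = snd (t n)" for n
  have mono: "strict_mono p" using t(2) by (auto simp: strict_mono_Suc_iff p_def Nx_def)
  have lb: "(1/4) ^ n * (1/2) ^ (k * s) \<le> H n k" for n k using t(1)[of n] by (simp add: P_def H_def)
  have ub: "H n k \<le> (1/4) ^ n * (1/2) ^ (k * s)" if "p n \<le> k" for n k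
    using t(1)[of n] that by (simp add: P_def H_def p_def)
  have pos: "0 \<le> H n k" for n k
    using lb[of n k] by (rule order_trans[rotated]) simp
  have HS: "H (Suc n) k = (if k < p (Suc n) then H n k else H n k / 4)" for n k
    using t(2)[of n] by (simp add: Nx_def H_def p_def)
  \<comment> \<open>Since \<open>p n\<close> is at least n, the gauge at level \<open>k\<close> is
    final from stage \<open>k\<close> on, and the diagonal is the limit gauge.\<close>
  have stable: "H (k + m) k = H k k" for k m
  proof (induction m)
    case (Suc m)
    have "k < p (Suc (k + m))" using seq_suble[OF mono, of "Suc (k + m)"] by linarith
    then show ?case using Suc HS[of "k + m" k] by simp
  qed simp
  have dec: "H (n + m) k \<le> H n k" for n m k
  proof (induction m)
    case (Suc m)
    have "H (Suc (n + m)) k \<le> H (n + m) k" unfolding HS using pos[of "n + m" k] by auto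
    then show ?case using Suc by simp
  qed simp
  show ?thesis
  proof (rule that[of p "c / 2" "\<lambda>k. H k k"])
    show "strict_mono p" by (rule mono)
    show "p 0 = 0" using t(1)[of 0] by (simp add: P_def p_def)
    show "0 < c / 2" using c by simp
    show "0 \<le> H k k" for k by (rule pos)
    show "H k k \<le> (1/4) ^ j * (1/2) ^ (k * s)" if "p j \<le> k" for j k
    proof -
      have "H k k = H (k + j) k" by (simp add: stable)
      also have "\<dots> \<le> H j k" using dec[of j k k] by (simp add: add.commute)
      finally show ?thesis using ub[OF that] by linarith
    qed
    fix Q :: "(nat \<times> ('n \<Rightarrow> int)) set" assume Q: "finite Q" "Q \<subseteq> tree z0" "K \<subseteq> (\<Union>q\<in>Q. cell q)"
    \<comment> \<open>Stage \<open>n\<close> already agrees with the limit gauge on every level that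
      occurs in \<open>Q\<close>.\<close>
    define n where "n = Max (insert 0 (fst ` Q))"
    have n: "fst q \<le> n" if "q \<in> Q" for q using that Q(1) unfolding n_def by (intro Max_ge) auto
    have "robust K z0 (H n) (c / 2 + c / 2 ^ (n + 1))" using t(1)[of n] by (simp add: P_def H_def)
    moreover have "K - {} \<subseteq> (\<Union>q\<in>Q. cell q)" using Q by simp
    ultimately obtain Q' where Q': "finite Q'" "Q' \<subseteq> Q" "c / 2 + c / 2 ^ (n + 1) \<le> (\<Sum>q\<in>Q'. H n (fst q))"
      using robustD[OF _ hausdorff_sigma_finite_empty Q(2)] by metis
    have "c / 2 \<le> c / 2 + c / 2 ^ (n + 1)" using c by simp
    also have "\<dots> \<le> (\<Sum>q\<in>Q'. H n (fst q))" by (rule Q')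
    also have "\<dots> \<le> (\<Sum>q\<in>Q. H n (fst q))" using Q' Q pos by (intro sum_mono2) auto
    also have "\<dots> = (\<Sum>q\<in>Q. H (fst q) (fst q))"
    proof (rule sum.cong[OF refl])
      fix q assume "q \<in> Q"
      then show "H n (fst q) = H (fst q) (fst q)" using stable[of "fst q" "n - fst q"] n[of q] by simp
    qed
    finally show "c / 2 \<le> (\<Sum>q\<in>Q. H (fst q) (fst q))" .
  qed
qed

section \<open>Dyadic content and the distribution of mass\<close>

definition dcontent :: "(nat \<Rightarrow> real) \<Rightarrow> (real ^ 'n) set \<Rightarrow> nat \<Rightarrow> ('n \<Rightarrow> int) \<Rightarrow> real" where
  "dcontent h K k z = Inf {\<Sum>q\<in>Q. h (fst q) | Q. finite Q \<and> K \<inter> cell (k, z) \<subseteq> (\<Union>q\<in>Q. cell q)}"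

context
  fixes h :: "nat \<Rightarrow> real" and K :: "(real ^ 'n) set"
  assumes h: "\<And>k. 0 \<le> h k"
begin

lemma dcontent_le:
  "finite Q \<Longrightarrow> K \<inter> cell (k, z) \<subseteq> (\<Union>q\<in>Q. cell q) \<Longrightarrow> dcontent h K k z \<le> (\<Sum>q\<in>Q. h (fst q))"
  unfolding dcontent_def using h
  by (intro cInf_lower) (auto intro!: bdd_belowI[of _ 0] sum_nonneg)

lemma dcontent_geI:
  assumes "\<And>Q. finite Q \<Longrightarrow> K \<inter> cell (k, z) \<subseteq> (\<Union>q\<in>Q. cell q) \<Longrightarrow> c \<le> (\<Sum>q\<in>Q. h (fst q))"
  shows "c \<le> dcontent h K k z"
  unfolding dcontent_def
proof (rule cInf_greatest)
  show "{\<Sum>q\<in>Q. h (fst q) | Q. finite Q \<and> K \<inter> cell (k, z) \<subseteq> (\<Union>q\<in>Q. cell q)} \<noteq> {}"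
    by (auto intro!: exI[of _ "{(k, z)}"])
qed (use assms in auto)

lemma dcontent_nonneg: "0 \<le> dcontent h K k z"
  by (rule dcontent_geI) (simp add: sum_nonneg h)

lemma dcontent_le_gauge: "dcontent h K k z \<le> h k"
  using dcontent_le[of "{(k, z)}" k z] by simp

lemma dcontent_empty: "K \<inter> cell (k, z) = {} \<Longrightarrow> dcontent h K k z = 0"
  using dcontent_le[of "{}" k z] dcontent_nonneg[of k z] by simp

text \<open>Near-optimal covers of the children are united. The content, unlike the gauge in
  general, is subadditive under subdivision while still bounded by the gauge; distributing mass
  downwards takes both.\<close>

lemma dcontent_half: "dcontent h K k z \<le> (\<Sum>z'\<in>{z'. half z' = z}. dcontent h K (Suc k) z')"
proof (rule field_le_epsilon)
  fix e :: real assume e: "0 < e"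
  let ?Z = "{z'. half z' = z}"
  have fin: "finite ?Z" by (rule finite_half_fibre)
  define d where "d = e / real (card ?Z + 1)"
  have d: "d > 0" using e by (simp add: d_def)
  have "\<exists>Q. finite Q \<and> K \<inter> cell (Suc k, z') \<subseteq> (\<Union>q\<in>Q. cell q) \<and> (\<Sum>q\<in>Q. h (fst q)) < dcontent h K (Suc k) z' + d" for z'
  proof (rule ccontr)
    assume "\<not> ?thesis"
    then have "dcontent h K (Suc k) z' + d \<le> dcontent h K (Suc k) z'"
      by (intro dcontent_geI) (auto simp: not_less)
    then show False using d by simp
  qed
  then obtain Q where Q: "\<And>z'. finite (Q z')" "\<And>z'. K \<inter> cell (Suc k, z') \<subseteq> (\<Union>q\<in>Q z'. cell q)"
    "\<And>z'. (\<Sum>q\<in>Q z'. h (fst q)) < dcontent h K (Suc k) z' + d" by metis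
  have "dcontent h K k z \<le> (\<Sum>q\<in>(\<Union>z'\<in>?Z. Q z'). h (fst q))"
  proof (rule dcontent_le)
    show "finite (\<Union>z'\<in>?Z. Q z')" using fin Q(1) by blast
    show "K \<inter> cell (k, z) \<subseteq> (\<Union>q\<in>(\<Union>z'\<in>?Z. Q z'). cell q)"
    proof
      fix x assume x: "x \<in> K \<inter> cell (k, z)"
      then have "x \<in> K \<inter> cell (Suc k, idx (Suc k) x)" "half (idx (Suc k) x) = z"
        by (auto simp: cell_def half_idx)
      then show "x \<in> (\<Union>q\<in>(\<Union>z'\<in>?Z. Q z'). cell q)" using Q(2)[of "idx (Suc k) x"] by blast
    qed
  qed
  also have "\<dots> \<le> (\<Sum>z'\<in>?Z. \<Sum>q\<in>Q z'. h (fst q))" by (intro sum_UN_le fin Q h)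
  also have "\<dots> \<le> (\<Sum>z'\<in>?Z. dcontent h K (Suc k) z' + d)" by (intro sum_mono less_imp_le Q)
  also have "\<dots> = (\<Sum>z'\<in>?Z. dcontent h K (Suc k) z') + real (card ?Z) * d" by (simp add: sum.distrib)
  also have "real (card ?Z) * d \<le> e" using e by (simp add: d_def field_simps)
  finally show "dcontent h K k z \<le> (\<Sum>z'\<in>?Z. dcontent h K (Suc k) z') + e" by simp
qed

end

text \<open>A cell divides its mass among its children in proportion to their contents
  \<open>M\<close>. If these are all 0, the quotient by 0 gives them mass 0; under the assumptions
  of \<open>mass_bounds\<close> the mass of the parent is then 0 as well.\<close>

primrec mass :: "(nat \<Rightarrow> ('n \<Rightarrow> int) \<Rightarrow> real) \<Rightarrow> ('n \<Rightarrow> int) \<Rightarrow> nat \<Rightarrow> ('n \<Rightarrow> int) \<Rightarrow> real" where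
  "mass M z0 0 z = (if z = z0 then M 0 z0 else 0)"
| "mass M z0 (Suc k) z = mass M z0 k (half z) * (M (Suc k) z / (\<Sum>w\<in>{w. half w = half z}. M (Suc k) w))"

text \<open>By induction the mass of a parent is at most its content, hence at most the total
  content of its children, so a child receives at most its own content.\<close>

lemma mass_bounds:
  fixes M :: "nat \<Rightarrow> ('n::finite \<Rightarrow> int) \<Rightarrow> real"
  assumes M: "\<And>k z. 0 \<le> M k z" "\<And>k z. M k z \<le> (\<Sum>w\<in>{w. half w = z}. M (Suc k) w)"
  shows "0 \<le> mass M z0 k z \<and> mass M z0 k z \<le> M k z"
proof (induction k arbitrary: z)
  case 0
  then show ?case using M(1) by simp
next
  case (Suc k)
  define D where "D = (\<Sum>w\<in>{w. half w = half z}. M (Suc k) w)"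
  have D: "mass M z0 k (half z) \<le> D" "0 \<le> mass M z0 k (half z)"
    using Suc[of "half z"] M(2)[of k "half z"] by (auto simp: D_def)
  have eq: "mass M z0 (Suc k) z = mass M z0 k (half z) * (M (Suc k) z / D)" by (simp add: D_def)
  have "mass M z0 (Suc k) z \<le> M (Suc k) z"
  proof (cases "D = 0")
    case False
    then have "0 < D" using D by simp
    then have "mass M z0 k (half z) * (M (Suc k) z / D) \<le> D * (M (Suc k) z / D)"
      using D M(1) by (intro mult_right_mono) auto
    moreover have "D * (M (Suc k) z / D) = M (Suc k) z" using \<open>0 < D\<close> by simp
    ultimately show ?thesis unfolding eq by linarith
  next
    case True
    then show ?thesis unfolding eq using M(1) by simp
  qed
  moreover have "0 \<le> mass M z0 (Suc k) z" unfolding eq using D M(1) by simp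
  ultimately show ?case by simp
qed

lemma mass_half:
  fixes M :: "nat \<Rightarrow> ('n::finite \<Rightarrow> int) \<Rightarrow> real"
  assumes M: "\<And>k z. 0 \<le> M k z" "\<And>k z. M k z \<le> (\<Sum>w\<in>{w. half w = z}. M (Suc k) w)"
  shows "mass M z0 k z = (\<Sum>w\<in>{w. half w = z}. mass M z0 (Suc k) w)"
proof -
  define D where "D = (\<Sum>w\<in>{w. half w = z}. M (Suc k) w)"
  have "(\<Sum>w\<in>{w. half w = z}. mass M z0 (Suc k) w) = (\<Sum>w\<in>{w. half w = z}. mass M z0 k z / D * M (Suc k) w)"
    by (rule sum.cong) (auto simp: D_def)
  also have "\<dots> = mass M z0 k z / D * D" by (simp add: D_def sum_distrib_left)
  also have "\<dots> = mass M z0 k z"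
    using mass_bounds[of M z0 k z, OF M] M(2)[of k z] by (cases "D = 0") (auto simp: D_def)
  finally show ?thesis by simp
qed

text \<open>One of the countably many unit cells meets \<open>S\<close> in a set that is not
  sigma-finite, and its content is the mass to be distributed. Masses are at most contents, which
  gives both the growth bound and the absence of mass away from \<open>S\<close>.\<close>

lemma frostman_masses:
  fixes S :: "(real ^ 'n) set"
  defines "s \<equiv> CARD('n) - 1"
  assumes nsf: "\<not> hausdorff_sigma_finite (real s) S"
  obtains m :: "nat \<Rightarrow> ('n \<Rightarrow> int) \<Rightarrow> real" and p z0 where
    "strict_mono p" "p 0 = 0" "\<And>k z. 0 \<le> m k z"
    "\<And>k z. m k z = (\<Sum>w\<in>{w. half w = z}. m (Suc k) w)"
    "\<And>j k z. p j \<le> k \<Longrightarrow> m k z \<le> (1/4) ^ j * (1/2) ^ (k * s)"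
    "\<And>k z. m k z \<noteq> 0 \<Longrightarrow> S \<inter> cell (k, z) \<noteq> {}"
    "0 < m 0 z0"
proof -
  obtain z0 where z0: "\<not> hausdorff_sigma_finite (real s) (S \<inter> cell (0, z0))"
  proof (rule ccontr)
    assume "\<not> thesis"
    then have "hausdorff_sigma_finite (real s) (S \<inter> cell (0, z))" for z using that by blast
    then have "hausdorff_sigma_finite (real s) (\<Union>n. S \<inter> cell (0, from_nat n))"
      by (intro hausdorff_sigma_finite_UN)
    then have "hausdorff_sigma_finite (real s) S"
    proof (rule hausdorff_sigma_finite_subset)
      show "S \<subseteq> (\<Union>n. S \<inter> cell (0, from_nat n))"
      proof
        fix x assume "x \<in> S"
        then show "x \<in> (\<Union>n. S \<inter> cell (0, from_nat n))"
          by (intro UN_I[of "to_nat (idx 0 x)"]) (auto simp: cell_def)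
      qed
    qed
    then show False using nsf by simp
  qed
  define K where "K = S \<inter> cell (0, z0)"
  obtain h :: "nat \<Rightarrow> real" and p c where p: "strict_mono p" "p 0 = 0" and c: "0 < c" and h: "\<And>k. 0 \<le> h k"
    and hp: "\<And>j k. p j \<le> k \<Longrightarrow> h k \<le> (1/4) ^ j * (1/2) ^ (k * s)"
    and cov: "\<And>Q. finite Q \<Longrightarrow> Q \<subseteq> tree z0 \<Longrightarrow> K \<subseteq> (\<Union>q\<in>Q. cell q) \<Longrightarrow> c \<le> (\<Sum>q\<in>Q. h (fst q))"
    using gauge_exists[OF z0[unfolded s_def], of z0] unfolding s_def K_def by metis
  define M where "M = dcontent h K"
  have M: "0 \<le> M k z" "M k z \<le> (\<Sum>w\<in>{w. half w = z}. M (Suc k) w)" for k z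
    unfolding M_def by (rule dcontent_nonneg[of h, OF h], rule dcontent_half[of h, OF h])
  define m where "m = mass M z0"
  have "c \<le> M 0 z0"
    unfolding M_def
  proof (rule dcontent_geI[OF h])
    fix Q :: "(nat \<times> ('n \<Rightarrow> int)) set"
    assume Q: "finite Q" "K \<inter> cell (0, z0) \<subseteq> (\<Union>q\<in>Q. cell q)"
    \<comment> \<open>Cells outside the tree miss \<open>K\<close> and are dropped from the cover,
      as \<open>cov\<close> speaks of tree cells.\<close>
    have "K \<subseteq> (\<Union>q\<in>Q \<inter> tree z0. cell q)"
    proof
      fix x assume x: "x \<in> K"
      then have "x \<in> cell (0, z0)" by (simp add: K_def)
      then have "idx 0 x = z0" by (simp add: cell_def)
      moreover obtain q where "q \<in> Q" "x \<in> cell q" using x Q(2) by (auto simp: K_def)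
      ultimately show "x \<in> (\<Union>q\<in>Q \<inter> tree z0. cell q)" using cell_tree[of x q] by blast
    qed
    then have "c \<le> (\<Sum>q\<in>Q \<inter> tree z0. h (fst q))" using Q(1) by (intro cov) auto
    also have "\<dots> \<le> (\<Sum>q\<in>Q. h (fst q))" using Q(1) h by (intro sum_mono2) auto
    finally show "c \<le> (\<Sum>q\<in>Q. h (fst q))" .
  qed
  then have pos: "0 < m 0 z0" using c by (simp add: m_def)
  have mb: "0 \<le> m k z" "m k z \<le> M k z" for k z
    using mass_bounds[of M z0 k z, OF M] by (auto simp: m_def)
  show ?thesis
  proof (rule that[of p m z0])
    show "m k z = (\<Sum>w\<in>{w. half w = z}. m (Suc k) w)" for k z
      unfolding m_def by (rule mass_half[of M z0 k z, OF M])
    show "m k z \<le> (1/4) ^ j * (1/2) ^ (k * s)" if "p j \<le> k" for j k z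
      using mb(2)[of k z] dcontent_le_gauge[of h K k z, OF h] hp[OF that] by (simp add: M_def)
    show "S \<inter> cell (k, z) \<noteq> {}" if "m k z \<noteq> 0" for k z
    proof
      assume "S \<inter> cell (k, z) = {}"
      then have "M k z = 0" unfolding M_def by (intro dcontent_empty h) (auto simp: K_def)
      then show False using mb[of k z] that by simp
    qed
  qed (use p pos mb in auto)
qed

section \<open>Hat functions and fields of grid flows\<close>

definition hat :: "real \<Rightarrow> real" where
  "hat t = max 0 (1 - \<bar>t\<bar>)"

lemma hat_nonneg: "0 \<le> hat t" and hat_le_1: "hat t \<le> 1"
  by (auto simp: hat_def)

lemma hat_eq_0: "1 \<le> \<bar>t\<bar> \<Longrightarrow> hat t = 0"
  by (auto simp: hat_def)

lemma continuous_on_hat: "continuous_on A hat"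
  unfolding hat_def by (intro continuous_intros)

text \<open>Starting the integral at \<open>-2\<close> keeps the derivative formula valid at the left end \<open>-1\<close>
  of the support.\<close>

definition ramp :: "real \<Rightarrow> real" where
  "ramp t = integral {-2..t} hat"

lemma ramp_0: "t \<le> -1 \<Longrightarrow> ramp t = 0"
proof -
  assume "t \<le> -1"
  then have "integral {-2..t} hat = integral {-2..t} (\<lambda>_. 0)"
    by (intro integral_cong) (auto simp: hat_def)
  then show ?thesis by (simp add: ramp_def)
qed

lemma DERIV_ramp: "(ramp has_real_derivative hat t) (at t)"
proof (cases "t > -2")
  case True
  have "(ramp has_real_derivative hat t) (at t within {-2..t+1})"
    unfolding ramp_def using True by (intro integral_has_real_derivative continuous_on_hat) auto
  moreover have "at t within {-2..t+1} = at t"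
    by (rule at_within_interior) (use True in auto)
  ultimately show ?thesis by simp
next
  case False
  have "\<forall>\<^sub>F s in nhds t. 0 = ramp s"
    using False ramp_0 by (auto simp: eventually_nhds intro!: exI[of _ "{..<-1}"])
  moreover have "hat t = 0" using False by (simp add: hat_def)
  ultimately show ?thesis using DERIV_cong_ev[of t t "\<lambda>_. 0" ramp 0 "hat t"] by simp
qed

lemma mono_ramp: "mono ramp"
  unfolding mono_def by (metis DERIV_nonneg_imp_nondecreasing DERIV_ramp hat_nonneg)

lemma ramp_bounds: "0 \<le> ramp t" "ramp t \<le> ramp 1"
proof -
  show "0 \<le> ramp t" using monoD[OF mono_ramp, of "min t (-1)" t] ramp_0[of "min t (-1)"] by simp
  show "ramp t \<le> ramp 1"
  proof (cases "t \<le> 1")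
    case True
    then show ?thesis by (rule monoD[OF mono_ramp])
  next
    case False
    then have "1 < t" by simp
    from MVT2[OF this DERIV_ramp] obtain z where "1 < z" "ramp t - ramp 1 = (t - 1) * hat z" by auto
    then show ?thesis using hat_eq_0[of z] by simp
  qed
qed

lemma continuous_on_ramp: "continuous_on A ramp"
  by (meson DERIV_ramp DERIV_isCont continuous_at_imp_continuous_on)

text \<open>At most the two hats around \<open>t\<close> are nonzero at \<open>t\<close>, so the sum
  is linear interpolation between neighbouring integers. As \<open>g\<close> vanishes off
  \<open>A\<close>, the formula holds whether or not these two lie in \<open>A\<close>.\<close>

lemma sum_hat:
  assumes A: "finite A" and g: "\<And>m. m \<notin> A \<Longrightarrow> g m = 0"
  shows "(\<Sum>m\<in>A. g m * hat (t - real_of_int m)) =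
    (1 - frac t) * g \<lfloor>t\<rfloor> + frac t * g (\<lfloor>t\<rfloor> + 1)"
proof -
  let ?n = "\<lfloor>t\<rfloor>"
  have 0: "hat (t - real_of_int m) = 0" if "m \<noteq> ?n" "m \<noteq> ?n + 1" for m
  proof (rule hat_eq_0)
    have "m \<le> ?n - 1 \<or> ?n + 2 \<le> m" using that by linarith
    then show "1 \<le> \<bar>t - real_of_int m\<bar>" by linarith
  qed
  have "(\<Sum>m\<in>A. g m * hat (t - real_of_int m)) = (\<Sum>m\<in>A \<union> {?n, ?n + 1}. g m * hat (t - real_of_int m))"
    using A g by (intro sum.mono_neutral_left) auto
  also have "\<dots> = (\<Sum>m\<in>{?n, ?n + 1}. g m * hat (t - real_of_int m))"
    using A 0 by (intro sum.mono_neutral_right) auto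
  also have "\<dots> = (1 - frac t) * g ?n + frac t * g (?n + 1)"
  proof -
    have "hat (t - real_of_int ?n) = 1 - frac t" "hat (t - real_of_int (?n + 1)) = frac t"
      using frac_ge_0[of t] frac_lt_1[of t] by (auto simp: hat_def frac_def)
    then show ?thesis by simp
  qed
  finally show ?thesis .
qed

lemma sum_hat_le_1: "finite A \<Longrightarrow> (\<Sum>m\<in>A. hat (t - real_of_int m)) \<le> 1"
proof -
  assume A: "finite A"
  let ?g = "\<lambda>m. of_bool (m \<in> A) :: real"
  have "(\<Sum>m\<in>A. hat (t - real_of_int m)) = (\<Sum>m\<in>A. ?g m * hat (t - real_of_int m))" by simp
  also have "\<dots> = (1 - frac t) * ?g \<lfloor>t\<rfloor> + frac t * ?g (\<lfloor>t\<rfloor> + 1)"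
    by (rule sum_hat[OF A]) simp
  also have "\<dots> \<le> (1 - frac t) * 1 + frac t * 1"
    using frac_ge_0[of t] frac_lt_1[of t] by (intro add_mono mult_left_mono) auto
  finally show ?thesis by simp
qed

text \<open>The widened hat is linear between consecutive integers, since its corners lie at
  multiples of \<open>M\<close>, and linear interpolation reproduces it exactly.\<close>

lemma hat_refine:
  fixes M c :: int and t :: real
  assumes M: "0 < M"
  shows "hat (t / M - c) = (\<Sum>m\<in>{(c - 1) * M..<(c + 1) * M}. hat (m / M - c) * hat (t - m))"
proof -
  have "(\<Sum>m\<in>{(c - 1) * M..<(c + 1) * M}. hat (m / M - c) * hat (t - m)) =
     (1 - frac t) * hat (\<lfloor>t\<rfloor> / M - c) + frac t * hat ((\<lfloor>t\<rfloor> + 1) / M - c)"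
  proof (subst sum_hat)
    fix m assume "m \<notin> {(c - 1) * M..<(c + 1) * M}"
    then have "m \<le> (c - 1) * M \<or> (c + 1) * M \<le> m" by auto
    then have "real_of_int m \<le> (c - 1) * M \<or> real_of_int ((c + 1) * M) \<le> real_of_int m"
      by (simp only: of_int_le_iff)
    then have "real_of_int m / M \<le> c - 1 \<or> c + 1 \<le> real_of_int m / M"
      using M by (simp add: field_simps)
    then show "hat (m / M - c) = 0" by (intro hat_eq_0) linarith
  qed auto
  also have "\<dots> = hat (t / M - c)"
  proof -
    define j where "j = \<lfloor>t\<rfloor> - c * M"
    define \<theta> where "\<theta> = frac t"
    have \<theta>: "0 \<le> \<theta>" "\<theta> < 1" by (auto simp: \<theta>_def frac_lt_1)
    define g where "g u = max 0 (real_of_int M - \<bar>u\<bar>)" for u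
    have hat_g: "hat (u / M - c) = g (u - real_of_int (c * M)) / M" for u
    proof -
      have "u / M - c = (u - real_of_int (c * M)) / M" using M by (simp add: field_simps)
      moreover have "1 - \<bar>v / M\<bar> = (M - \<bar>v\<bar>) / M" for v :: real using M by (simp add: field_simps)
      ultimately show ?thesis using M by (simp add: hat_def g_def max_def field_simps)
    qed
    have t: "t - real_of_int (c * M) = j + \<theta>" by (simp add: j_def \<theta>_def frac_def)
    have t1: "real_of_int \<lfloor>t\<rfloor> - real_of_int (c * M) = j" "real_of_int (\<lfloor>t\<rfloor> + 1) - real_of_int (c * M) = j + 1"
      by (simp_all add: j_def)
    have "g (j + \<theta>) = (1 - \<theta>) * g j + \<theta> * g (j + 1)"
    proof -
      \<comment> \<open>The unit interval around \<open>t\<close> lies left of the hat, on its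
        rising side, on its falling side, or right of it; corners are integers, so no interval
        straddles one.\<close>
      consider "j + 1 \<le> - M" | "- M \<le> j" "j + 1 \<le> 0" | "0 \<le> j" "j + 1 \<le> M" | "M \<le> j" by linarith
      then show ?thesis
      proof cases
        case 1
        then have r: "real_of_int j + 1 \<le> - real_of_int M" by linarith
        have "g (j + \<theta>) = 0" "g j = 0" "g (j + 1) = 0" using r \<theta> M by (auto simp: g_def)
        then show ?thesis by simp
      next
        case 2
        then have r: "- real_of_int M \<le> j" "real_of_int j + 1 \<le> 0" by linarith+
        have e: "g (j + \<theta>) = M + j + \<theta>" "g j = M + j" "g (j + 1) = M + j + 1" using r \<theta> M by (auto simp: g_def)
        show ?thesis unfolding e by (simp add: algebra_simps)
      next
        case 3
        then have r: "0 \<le> real_of_int j" "real_of_int j + 1 \<le> M" by linarith+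
        have e: "g (j + \<theta>) = M - j - \<theta>" "g j = M - j" "g (j + 1) = M - j - 1" using r \<theta> M by (auto simp: g_def)
        show ?thesis unfolding e by (simp add: algebra_simps)
      next
        case 4
        then have r: "real_of_int M \<le> j" by linarith
        have "g (j + \<theta>) = 0" "g j = 0" "g (j + 1) = 0" using r \<theta> M by (auto simp: g_def)
        then show ?thesis by simp
      qed
    qed
    then show ?thesis
      unfolding hat_g t t1 \<theta>_def[symmetric] by (simp add: add_divide_distrib)
  qed
  finally show ?thesis by simp
qed

text \<open>The rising half has the weights j / M and the falling half 1 - j / M, which pair up to 1
  for each of the \<open>M\<close> values of j.\<close>

lemma sum_hat_weights:
  fixes M c :: int
  assumes M: "0 < M"
  shows "(\<Sum>m\<in>{(c - 1) * M..<(c + 1) * M}. hat (m / M - c)) = M"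
proof -
  have split: "{(c - 1) * M..<(c + 1) * M} = {(c - 1) * M..<c * M} \<union> {c * M..<(c + 1) * M}"
    using M by (auto simp: algebra_simps)
  have "(\<Sum>m\<in>{c * M..<(c + 1) * M}. hat (m / M - c)) = (\<Sum>j\<in>{0..<M}. 1 - j / M)"
  proof (rule sum.reindex_bij_witness[of _ "\<lambda>j. j + c * M" "\<lambda>m. m - c * M"])
    fix m assume m: "m \<in> {c * M..<(c + 1) * M}"
    then have "0 \<le> m - c * M" "m - c * M \<le> M" by (auto simp: algebra_simps)
    then have *: "0 \<le> real_of_int (m - c * M) / M" "real_of_int (m - c * M) / M \<le> 1"
      using M by (simp_all del: of_int_diff of_int_mult)
    have "m / M - c = real_of_int (m - c * M) / M" using M by (simp add: field_simps)
    moreover have "hat (real_of_int (m - c * M) / M) = 1 - real_of_int (m - c * M) / M"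
      unfolding hat_def using * by linarith
    ultimately show "1 - real_of_int (m - c * M) / M = hat (m / M - c)" by (simp only:)
  qed (auto simp: algebra_simps)
  moreover have "(\<Sum>m\<in>{(c - 1) * M..<c * M}. hat (m / M - c)) = (\<Sum>j\<in>{0..<M}. j / M)"
  proof (rule sum.reindex_bij_witness[of _ "\<lambda>j. j + (c - 1) * M" "\<lambda>m. m - (c - 1) * M"])
    fix m assume m: "m \<in> {(c - 1) * M..<c * M}"
    then have "0 \<le> m - (c - 1) * M" "m - (c - 1) * M \<le> M" by (auto simp: algebra_simps)
    then have *: "0 \<le> real_of_int (m - (c - 1) * M) / M" "real_of_int (m - (c - 1) * M) / M \<le> 1"
      using M by (simp_all del: of_int_diff of_int_mult)
    have "m / M - c = real_of_int (m - (c - 1) * M) / M - 1" using M by (simp add: field_simps)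
    moreover have "hat (real_of_int (m - (c - 1) * M) / M - 1) = real_of_int (m - (c - 1) * M) / M"
    proof -
      have "hat (y - 1) = y" if "0 \<le> y" "y \<le> 1" for y using that by (simp add: hat_def)
      from this[OF *] show ?thesis .
    qed
    ultimately show "real_of_int (m - (c - 1) * M) / M = hat (m / M - c)" by (simp only:)
  qed (auto simp: algebra_simps)
  ultimately have "(\<Sum>m\<in>{(c - 1) * M..<(c + 1) * M}. hat (m / M - c)) = (\<Sum>j\<in>{0..<M}. j / M + (1 - j / M))"
    unfolding split sum.distrib by (subst sum.union_disjoint) auto
  then show ?thesis using M by simp
qed

section \<open>Hats in space, and continuous fields from grid flows\<close>

definition hatn :: "nat \<Rightarrow> ('n::finite \<Rightarrow> int) \<Rightarrow> real ^ 'n \<Rightarrow> real" where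
  "hatn k z x = (\<Prod>i\<in>UNIV. hat (2 ^ k * x $ i - real_of_int (z i)))"

text \<open>A primitive of 2^k \<open>hatn k z\<close> in direction \<open>i\<close>. Past the hat
  it stays constant along \<open>i\<close> instead of returning to 0, but the difference of two
  pipes with neighbouring indices in that direction has compact support and carries mass from one
  hat to the next.\<close>

definition pipe :: "nat \<Rightarrow> 'n \<Rightarrow> ('n::finite \<Rightarrow> int) \<Rightarrow> real ^ 'n \<Rightarrow> real" where
  "pipe k i z x = ramp (2 ^ k * x $ i - real_of_int (z i)) *
     (\<Prod>j\<in>UNIV - {i}. hat (2 ^ k * x $ j - real_of_int (z j)))"

lemma hatn_nonneg: "0 \<le> hatn k z x"
  by (simp add: hatn_def prod_nonneg hat_nonneg)

lemma hatn_split: "hatn k z x = hat (2 ^ k * x $ i - real_of_int (z i)) *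
     (\<Prod>j\<in>UNIV - {i}. hat (2 ^ k * x $ j - real_of_int (z j)))"
  unfolding hatn_def by (subst prod.remove[of UNIV i]) auto

lemma continuous_on_hatn: "continuous_on UNIV (hatn k z)"
  unfolding hatn_def
  by (intro continuous_on_prod continuous_on_compose2[OF continuous_on_hat[of UNIV]] continuous_intros) auto

lemma continuous_on_pipe: "continuous_on UNIV (pipe k i z)"
  unfolding pipe_def
  by (intro continuous_on_mult continuous_on_prod continuous_on_compose2[OF continuous_on_hat[of UNIV]]
      continuous_on_compose2[OF continuous_on_ramp[of UNIV]] continuous_intros) auto

lemma DERIV_pipe:
  "((\<lambda>t. pipe k i z (x + t *\<^sub>R axis i 1)) has_real_derivative 2 ^ k * hatn k z (x + t *\<^sub>R axis i 1)) (at t)"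
proof -
  define c where "c = (\<Prod>j\<in>UNIV - {i}. hat (2 ^ k * x $ j - real_of_int (z j)))"
  have c: "(\<Prod>j\<in>UNIV - {i}. hat (2 ^ k * (x + t *\<^sub>R axis i 1) $ j - real_of_int (z j))) = c" for t
    unfolding c_def by (intro prod.cong) (auto simp: axis_def)
  have "((\<lambda>t. ramp (2 ^ k * (x $ i + t) - real_of_int (z i)) * c) has_real_derivative
     hat (2 ^ k * (x $ i + t) - real_of_int (z i)) * 2 ^ k * c) (at t)"
    by (intro DERIV_cmult_right DERIV_chain2[OF DERIV_ramp]) (auto intro!: derivative_eq_intros)
  then show ?thesis
    unfolding hatn_split[of _ _ _ i] pipe_def c by (simp add: axis_def mult_ac)
qed

lemma integrable_mult_test:
  assumes "continuous_on UNIV f" "test_function U \<phi>"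
  shows "integrable lborel (\<lambda>x. f x * \<phi> x)" "integrable lborel (\<lambda>x. f x * partial_deriv i \<phi> x)"
proof -
  note t = test_functionD[OF assms(2)]
  show "integrable lborel (\<lambda>x. f x * \<phi> x)"
  proof (rule integrable_continuous_compact_support[OF _ t(2)])
    show "continuous_on UNIV (\<lambda>x. f x * \<phi> x)"
      by (intro continuous_on_mult assms(1) smooth_continuous t(1))
    show "f x * \<phi> x = 0" if "x \<notin> closure {x. \<phi> x \<noteq> 0}" for x using t(4)[OF that] by simp
  qed
  show "integrable lborel (\<lambda>x. f x * partial_deriv i \<phi> x)"
  proof (rule integrable_continuous_compact_support[OF _ t(2)])
    show "continuous_on UNIV (\<lambda>x. f x * partial_deriv i \<phi> x)"
      by (intro continuous_on_mult assms(1) smooth_continuous_partial_deriv t(1))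
    show "f x * partial_deriv i \<phi> x = 0" if "x \<notin> closure {x. \<phi> x \<noteq> 0}" for x
      using partial_deriv_outside_support[OF that] by simp
  qed
qed

lemma integral_pipe:
  assumes \<phi>: "test_function U \<phi>"
  shows "(LINT x|lborel. pipe k i z x * partial_deriv i \<phi> x) = - (2 ^ k * (LINT x|lborel. hatn k z x * \<phi> x))"
proof -
  note t = test_functionD[OF \<phi>]
  note int = integrable_mult_test[OF continuous_on_hatn \<phi>, of k z] integrable_mult_test(2)[OF continuous_on_pipe \<phi>, of k i z i]
  let ?S = "closure {x. \<phi> x \<noteq> 0}"
  let ?u = "\<lambda>x. pipe k i z x * \<phi> x"
  let ?u' = "\<lambda>x. 2 ^ k * (hatn k z x * \<phi> x) + pipe k i z x * partial_deriv i \<phi> x"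
  have "(LINT x|lborel. ?u' x) = 0"
  proof (rule integral_directional_derivative_zero[where u = ?u and S = ?S and e = "axis i 1"])
    show "((\<lambda>t. ?u (x + t *\<^sub>R axis i 1)) has_real_derivative ?u' (x + t *\<^sub>R axis i 1)) (at t)" for x t
      by (rule DERIV_cong[OF DERIV_mult[OF DERIV_pipe has_derivative_partial_deriv[OF smooth_differentiable[OF t(1)]]]])
        (simp add: mult_ac)
    show "continuous_on UNIV ?u" "continuous_on UNIV ?u'"
      by (intro continuous_intros continuous_on_hatn continuous_on_pipe smooth_continuous
          smooth_continuous_partial_deriv t(1))+
    show "compact ?S" by (rule t(2))
    show "?u x = 0" if "x \<notin> ?S" for x using t(4)[OF that] by simp
    show "?u' x = 0" if "x \<notin> ?S" for x
      using t(4)[OF that] partial_deriv_outside_support[OF that, of i] by simp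
  qed
  then show ?thesis using int by simp
qed

text \<open>Tensor product of \<open>hat_refine\<close>. A coarse hat spans two coarse cubes in each
  direction, hence the box of side 2^(d+1) in which mass will have to be moved.\<close>

lemma hatn_refine:
  fixes z :: "'n::finite \<Rightarrow> int"
  shows "hatn k z x = (\<Sum>v\<in>gridbox (\<lambda>i. (z i - 1) * 2 ^ d) (2 ^ Suc d).
     (\<Prod>i\<in>UNIV. hat (v i / 2 ^ d - z i)) * hatn (k + d) v x)"
proof -
  have "hat (2 ^ k * x $ i - real_of_int (z i)) = (\<Sum>m\<in>{(z i - 1) * 2 ^ d..<(z i - 1) * 2 ^ d + int (2 ^ Suc d)}.
     hat (m / 2 ^ d - z i) * hat (2 ^ (k + d) * x $ i - m))" for i
  proof -
    have "2 ^ k * x $ i = 2 ^ (k + d) * x $ i / real_of_int (2 ^ d)" by (simp add: power_add)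
    moreover have "(z i - 1) * 2 ^ d + int (2 ^ Suc d) = (z i + 1) * 2 ^ d" by (simp add: algebra_simps)
    ultimately show ?thesis using hat_refine[of "2 ^ d" "2 ^ (k + d) * x $ i" "z i"] by simp
  qed
  then show ?thesis
    unfolding hatn_def[of k z x] gridbox_def by (simp add: prod_sum_PiE prod.distrib hatn_def)
qed

lemma sum_hatn_weights:
  fixes z :: "'n::finite \<Rightarrow> int"
  shows "(\<Sum>v\<in>gridbox (\<lambda>i. (z i - 1) * 2 ^ d) (2 ^ Suc d). \<Prod>i\<in>UNIV. hat (v i / 2 ^ d - z i)) = (2 ^ d) ^ CARD('n)"
proof -
  have "(\<Sum>m\<in>{(z i - 1) * 2 ^ d..<(z i - 1) * 2 ^ d + int (2 ^ Suc d)}. hat (m / 2 ^ d - z i)) = 2 ^ d" for i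
  proof -
    have "(z i - 1) * 2 ^ d + int (2 ^ Suc d) = (z i + 1) * 2 ^ d" by (simp add: algebra_simps)
    then show ?thesis using sum_hat_weights[of "2 ^ d" "z i"] by simp
  qed
  moreover have "(\<Sum>v\<in>gridbox (\<lambda>i. (z i - 1) * 2 ^ d) (2 ^ Suc d). \<Prod>i\<in>UNIV. hat (v i / 2 ^ d - z i)) =
     (\<Prod>i\<in>UNIV. \<Sum>m\<in>{(z i - 1) * 2 ^ d..<(z i - 1) * 2 ^ d + int (2 ^ Suc d)}. hat (m / 2 ^ d - z i))"
    unfolding gridbox_def by (rule prod_sum_PiE[symmetric]) auto
  ultimately show ?thesis by simp
qed

definition flow_field :: "nat \<Rightarrow> ('n::finite \<Rightarrow> int) set \<Rightarrow> ('n \<Rightarrow> ('n \<Rightarrow> int) \<Rightarrow> real) \<Rightarrow> real ^ 'n \<Rightarrow> real ^ 'n" where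
  "flow_field k Z f x = (\<chi> i. \<Sum>v\<in>Z. f i v * (pipe k i v x - pipe k i (up i v) x))"

lemma finite_subset_gridbox:
  fixes Z :: "('n::finite \<Rightarrow> int) set"
  assumes "finite Z"
  obtains a l where "Z \<subseteq> gridbox a l"
proof -
  define B where "B = Max (insert 0 ((\<lambda>(v, i). \<bar>v i\<bar>) ` (Z \<times> UNIV)))"
  have B: "\<bar>v i\<bar> \<le> B" if "v \<in> Z" for v i
    unfolding B_def using assms that by (intro Max_ge) auto
  have "0 \<le> B" unfolding B_def using assms by (intro Max_ge) auto
  then have "Z \<subseteq> gridbox (\<lambda>_. - B) (nat (2 * B + 1))"
    using B by (auto simp: mem_gridbox abs_le_iff) (smt (verit))+
  then show ?thesis by (rule that)
qed

lemma pipe_up_diff: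
  "pipe k i v x - pipe k i (up i v) x =
     (\<Prod>j\<in>UNIV. if j = i then ramp (2 ^ k * x $ i - v i) - ramp (2 ^ k * x $ i - v i - 1) else hat (2 ^ k * x $ j - v j))"
proof -
  have 1: "(\<Prod>j\<in>UNIV - {i}. hat (2 ^ k * x $ j - real_of_int (up i v j))) = (\<Prod>j\<in>UNIV - {i}. hat (2 ^ k * x $ j - real_of_int (v j)))"
    by (intro prod.cong) (auto simp: up_def)
  have 2: "2 ^ k * x $ i - real_of_int (up i v i) = 2 ^ k * x $ i - v i - 1" by (simp add: up_def)
  have 3: "(\<Prod>j\<in>UNIV. if j = i then ramp (2 ^ k * x $ i - v i) - ramp (2 ^ k * x $ i - v i - 1) else hat (2 ^ k * x $ j - v j)) =
     (ramp (2 ^ k * x $ i - v i) - ramp (2 ^ k * x $ i - v i - 1)) * (\<Prod>j\<in>UNIV - {i}. hat (2 ^ k * x $ j - v j))"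
    by (subst prod.remove[of UNIV i]) (auto intro!: prod.cong)
  show ?thesis unfolding pipe_def 1 2 3 by (simp only: left_diff_distrib)
qed

lemma pipe_up_diff_nonneg: "0 \<le> pipe k i v x - pipe k i (up i v) x"
  unfolding pipe_up_diff by (intro prod_nonneg) (auto simp: hat_nonneg intro: monoD[OF mono_ramp])

text \<open>In direction \<open>i\<close> the ramp differences telescope, and in the other
  directions the hats sum to at most 1. The bound does not depend on how many edges carry flow, so
  the field is controlled by the largest edge value.\<close>

lemma sum_pipe_up_diff:
  fixes Z :: "('n::finite \<Rightarrow> int) set"
  assumes "finite Z"
  shows "(\<Sum>v\<in>Z. pipe k i v x - pipe k i (up i v) x) \<le> ramp 1"
proof -
  obtain a l where Z: "Z \<subseteq> gridbox a l" using finite_subset_gridbox[OF assms] by blast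
  define g where "g j m = (if j = i then ramp (2 ^ k * x $ i - real_of_int m) - ramp (2 ^ k * x $ i - real_of_int m - 1) else hat (2 ^ k * x $ j - real_of_int m))" for j m
  have g: "pipe k i v x - pipe k i (up i v) x = (\<Prod>j\<in>UNIV. g j (v j))" for v
    unfolding pipe_up_diff g_def by (rule prod.cong) auto
  have g0: "0 \<le> g j m" for j m by (auto simp: g_def hat_nonneg intro: monoD[OF mono_ramp])
  have "(\<Sum>v\<in>Z. pipe k i v x - pipe k i (up i v) x) \<le> (\<Sum>v\<in>gridbox a l. pipe k i v x - pipe k i (up i v) x)"
    using Z by (intro sum_mono2 pipe_up_diff_nonneg) auto
  also have "\<dots> = (\<Prod>j\<in>UNIV. \<Sum>m\<in>{a j..<a j + int l}. g j m)"
    unfolding g gridbox_def by (subst prod_sum_PiE) auto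
  also have "\<dots> = (\<Sum>m\<in>{a i..<a i + int l}. g i m) * (\<Prod>j\<in>UNIV - {i}. \<Sum>m\<in>{a j..<a j + int l}. g j m)"
    by (subst prod.remove[of UNIV i]) auto
  also have "\<dots> \<le> ramp 1 * 1"
  proof (intro mult_mono)
    have tele: "(\<Sum>m\<in>{b..<b + int n}. ramp (y - real_of_int m) - ramp (y - real_of_int m - 1)) = ramp (y - b) - ramp (y - b - real n)" for b n y
    proof (induction n)
      case (Suc n)
      have "{b..<b + int (Suc n)} = insert (b + int n) {b..<b + int n}" by auto
      then show ?case using Suc by (simp add: algebra_simps)
    qed simp
    have "(\<Sum>m\<in>{a i..<a i + int l}. g i m) = ramp (2 ^ k * x $ i - a i) - ramp (2 ^ k * x $ i - a i - real l)"
      unfolding g_def by (simp add: tele)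
    then show "(\<Sum>m\<in>{a i..<a i + int l}. g i m) \<le> ramp 1"
      using ramp_bounds(2)[of "2 ^ k * x $ i - a i"] ramp_bounds(1)[of "2 ^ k * x $ i - a i - real l"] by linarith
    show "(\<Prod>j\<in>UNIV - {i}. \<Sum>m\<in>{a j..<a j + int l}. g j m) \<le> 1"
    proof (intro prod_le_1 conjI sum_nonneg g0)
      fix j assume "j \<in> UNIV - {i}"
      then show "(\<Sum>m\<in>{a j..<a j + int l}. g j m) \<le> 1"
        unfolding g_def using sum_hat_le_1[of "{a j..<a j + int l}" "2 ^ k * x $ j"] by simp
    qed
  qed (auto intro!: ramp_bounds prod_nonneg sum_nonneg g0)
  finally show ?thesis by simp
qed

lemma norm_flow_field:
  fixes Z :: "('n::finite \<Rightarrow> int) set"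
  assumes "finite Z" and f: "\<And>i v. \<bar>f i v\<bar> \<le> C"
  shows "norm (flow_field k Z f x) \<le> real CARD('n) * (C * ramp 1)"
proof -
  have C: "0 \<le> C" using order_trans[OF abs_ge_zero f] .
  have "norm (flow_field k Z f x) \<le> (\<Sum>i\<in>UNIV. \<bar>flow_field k Z f x $ i\<bar>)" by (rule norm_le_l1_cart)
  also have "\<dots> \<le> (\<Sum>i\<in>(UNIV :: 'n set). C * ramp 1)"
  proof (rule sum_mono)
    fix i
    have "\<bar>flow_field k Z f x $ i\<bar> \<le> (\<Sum>v\<in>Z. \<bar>f i v * (pipe k i v x - pipe k i (up i v) x)\<bar>)"
      unfolding flow_field_def by (simp add: sum_abs)
    also have "\<dots> \<le> (\<Sum>v\<in>Z. C * (pipe k i v x - pipe k i (up i v) x))"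
      unfolding abs_mult abs_of_nonneg[OF pipe_up_diff_nonneg]
      by (intro sum_mono mult_right_mono f pipe_up_diff_nonneg)
    also have "\<dots> \<le> C * ramp 1"
      unfolding sum_distrib_left[symmetric] by (intro mult_left_mono sum_pipe_up_diff assms C)
    finally show "\<bar>flow_field k Z f x $ i\<bar> \<le> C * ramp 1" .
  qed
  finally show ?thesis by simp
qed

lemma continuous_on_flow_field: "continuous_on UNIV (flow_field k Z f)"
  unfolding flow_field_def
  by (intro continuous_on_vec_lambda continuous_intros continuous_on_pipe)

text \<open>Integration by parts on each pipe, then a shift of the summation index. The support
  condition on \<open>f\<close> keeps the shifted index inside \<open>Z\<close>, so no boundary
  terms arise, and each hat is weighted with its net inflow.\<close>

lemma integral_flow_field:
  fixes Z :: "('n::finite \<Rightarrow> int) set"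
  assumes \<phi>: "test_function U \<phi>" and Z: "finite Z"
    and f: "\<And>i v. f i v \<noteq> 0 \<Longrightarrow> v \<in> Z \<and> up i v \<in> Z"
  shows "(LINT x|lborel. flow_field k Z f x \<bullet> grad \<phi> x) =
     2 ^ k * (\<Sum>v\<in>Z. (\<Sum>i\<in>UNIV. f i (v(i := v i - 1)) - f i v) * (LINT x|lborel. hatn k v x * \<phi> x))"
proof -
  define I where "I v = (LINT x|lborel. hatn k v x * \<phi> x)" for v
  note int = integrable_mult_test(2)[OF continuous_on_pipe \<phi>]
  have "(LINT x|lborel. flow_field k Z f x \<bullet> grad \<phi> x) =
      (LINT x|lborel. (\<Sum>i\<in>UNIV. \<Sum>v\<in>Z. f i v * (pipe k i v x * partial_deriv i \<phi> x - pipe k i (up i v) x * partial_deriv i \<phi> x)))"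
    by (simp add: inner_vec_def flow_field_def sum_distrib_right left_diff_distrib mult.assoc)
  also have "\<dots> = (\<Sum>i\<in>UNIV. \<Sum>v\<in>Z. f i v * ((LINT x|lborel. pipe k i v x * partial_deriv i \<phi> x) - (LINT x|lborel. pipe k i (up i v) x * partial_deriv i \<phi> x)))"
    using int by simp
  also have "\<dots> = (\<Sum>i\<in>UNIV. \<Sum>v\<in>Z. 2 ^ k * (f i v * I (up i v) - f i v * I v))"
    unfolding integral_pipe[OF \<phi>] I_def[symmetric] by (simp add: algebra_simps)
  also have "\<dots> = 2 ^ k * (\<Sum>i\<in>UNIV. (\<Sum>v\<in>Z. f i v * I (up i v)) - (\<Sum>v\<in>Z. f i v * I v))"
    by (simp add: sum_distrib_left[symmetric] sum_subtractf)
  also have "(\<Sum>i\<in>UNIV. (\<Sum>v\<in>Z. f i v * I (up i v)) - (\<Sum>v\<in>Z. f i v * I v)) =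
      (\<Sum>i\<in>UNIV. \<Sum>v\<in>Z. (f i (v(i := v i - 1)) - f i v) * I v)"
  proof (rule sum.cong[OF refl])
    fix i
    have "(\<Sum>v\<in>Z. f i v * I (up i v)) = (\<Sum>v\<in>Z. f i (v(i := v i - 1)) * I v)"
      by (rule sum.reindex_bij_witness_not_neutral[of "{v\<in>Z. f i v = 0}" "{v\<in>Z. f i (v(i := v i - 1)) = 0}"
            _ "\<lambda>v. v(i := v i - 1)" "up i"])
        (use Z f in \<open>auto simp: up_def\<close>)
    then show "(\<Sum>v\<in>Z. f i v * I (up i v)) - (\<Sum>v\<in>Z. f i v * I v) = (\<Sum>v\<in>Z. (f i (v(i := v i - 1)) - f i v) * I v)"
      by (simp add: left_diff_distrib sum_subtractf)
  qed
  also have "\<dots> = (\<Sum>v\<in>Z. (\<Sum>i\<in>UNIV. f i (v(i := v i - 1)) - f i v) * I v)"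
    by (subst sum.swap) (simp add: sum_distrib_right)
  finally show ?thesis by (simp add: I_def)
qed

section \<open>A nonremovable field for a set that is not sigma-finite\<close>

lemma anc_add: "anc (k + d) z = anc k (anc d z)"
  by (induction k) (simp_all add: anc_Suc)

lemma sum_fibres:
  fixes f :: "'b \<Rightarrow> real"
  assumes "finite A" "\<And>v. finite {w. g w = v}"
  shows "(\<Sum>v\<in>A. \<Sum>w\<in>{w. g w = v}. f w) = (\<Sum>w\<in>{w. g w \<in> A}. f w)"
proof -
  have "{w. g w \<in> A} = (\<Union>v\<in>A. {w. g w = v})" by auto
  then show ?thesis using assms by (simp only:) (rule sum.UNION_disjoint[symmetric], auto)
qed

lemma int_div_eq_iff:
  fixes v c M :: int
  assumes "0 < M"
  shows "v div M = c \<longleftrightarrow> c * M \<le> v \<and> v < c * M + M"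
proof
  assume c: "v div M = c"
  have "0 \<le> v mod M" "v mod M < M" using assms by simp_all
  moreover have "c * M + v mod M = v" using div_mult_mod_eq[of v M] c by simp
  ultimately show "c * M \<le> v \<and> v < c * M + M" by linarith
next
  assume "c * M \<le> v \<and> v < c * M + M"
  then have "(v - c * M) div M = 0" by (intro div_pos_pos_trivial) auto
  moreover have "v div M = c + (v - c * M) div M"
    using div_mult_self1[of M "v - c * M" c] assms by simp
  ultimately show "v div M = c" by simp
qed

lemma gridbox_eq_fibre:
  assumes "\<And>i. 2 ^ q dvd b i"
  shows "gridbox b (2 ^ q) = {v. anc q v = (\<lambda>i. b i div 2 ^ q)}"
proof -
  have "b i div 2 ^ q * 2 ^ q = b i" for i using assms[of i] by simp
  then have "v i div 2 ^ q = b i div 2 ^ q \<longleftrightarrow> b i \<le> v i \<and> v i < b i + 2 ^ q" for v i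
    using int_div_eq_iff[of "2 ^ q" "v i" "b i div 2 ^ q"] by simp
  then show ?thesis by (auto simp: mem_gridbox anc_def fun_eq_iff)
qed

locale dyadic_mass =
  fixes m :: "nat \<Rightarrow> ('n::finite \<Rightarrow> int) \<Rightarrow> real" and z0 :: "'n \<Rightarrow> int"
  assumes m_nonneg: "0 \<le> m k z"
    and m_half: "m k z = (\<Sum>w\<in>{w. half w = z}. m (Suc k) w)"
begin

lemma m_anc: "m k z = (\<Sum>w\<in>{w. anc d w = z}. m (k + d) w)"
proof (induction d)
  case (Suc d)
  have "(\<Sum>w\<in>{w. anc d w = z}. m (k + d) w) = (\<Sum>v\<in>{w. anc d w = z}. \<Sum>w\<in>{w. half w = v}. m (Suc (k + d)) w)"
    by (rule sum.cong[OF refl]) (rule m_half)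
  also have "\<dots> = (\<Sum>w\<in>{w. half w \<in> {v. anc d v = z}}. m (Suc (k + d)) w)"
    by (rule sum_fibres[OF finite_anc_fibre finite_half_fibre])
  finally show ?case using Suc by (simp add: anc_Suc')
qed simp

text \<open>Tests \<phi> against the masses of level \<open>k\<close> spread out by hats; 2^(k N)
  normalises each hat to integral 1. The hat of a cell is centred at its lower corner, hence stays
  within a few cube sides of the cell.\<close>

definition pairing :: "nat \<Rightarrow> (real ^ 'n \<Rightarrow> real) \<Rightarrow> real" where
  "pairing k \<phi> = 2 ^ (k * CARD('n)) * (\<Sum>z\<in>{z. anc k z = z0}. m k z * (LINT x|lborel. hatn k z x * \<phi> x))"

text \<open>The mass of a coarse cell placed on its fine cells, and the same mass placed by the
  refinement weights of its hat, have equal totals. \<open>block_flow\<close> carries one to the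
  other, and the sum over all cells turns the coarse pairing into the fine one. The bound is free of
  \<open>d\<close> because the growth condition holds at all levels from \<open>k\<close>
  on.\<close>

lemma transition:
  assumes gr: "\<And>k' z. k \<le> k' \<Longrightarrow> m k' z \<le> \<epsilon> * (1/2) ^ (k' * (CARD('n) - 1))"
  shows "\<exists>W :: real ^ 'n \<Rightarrow> real ^ 'n. continuous_on UNIV W \<and>
     (\<forall>x. norm (W x) \<le> real CARD('n) * 2 ^ (2 * CARD('n) + 3) * ramp 1 * \<epsilon>) \<and>
     (\<forall>U \<phi>. test_function U \<phi> \<longrightarrow> (LINT x|lborel. W x \<bullet> grad \<phi> x) = pairing (k + d) \<phi> - pairing k \<phi>)"
proof -
  define N where "N = CARD('n)"
  define s where "s = N - 1"
  have N: "N = Suc s" by (simp add: s_def N_def)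
  \<comment> \<open>The growth constant in units of fine cells. The factor 2 pays for blocks with
    twice the side of a coarse cube: the hat weights use it up in the largest box.\<close>
  define e where "e = 2 * \<epsilon> * (1/2) ^ ((k + d) * s)"
  have gr': "m k' z \<le> \<epsilon> * (1/2) ^ (k' * s)" if "k \<le> k'" for k' z
    using gr[OF that] by (simp add: s_def N_def)
  have "0 \<le> \<epsilon> * (1/2) ^ (k * s)" using order_trans[OF m_nonneg gr'[of k]] by simp
  then have \<epsilon>: "0 \<le> \<epsilon>" using mult_neg_pos[of \<epsilon> "(1/2) ^ (k * s)"] by force
  then have e0: "0 \<le> e" by (simp add: e_def)
  have scale: "\<epsilon> * (1/2) ^ ((k + d - q) * s) * 2 = e * 2 ^ (q * s)" if "q \<le> k + d" for q
  proof -
    have "k + d = (k + d - q) + q" using that by simp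
    then have "(k + d) * s = (k + d - q) * s + q * s" by (metis add_mult_distrib)
    then show ?thesis by (simp add: e_def power_add power_one_over)
  qed
  define T where "T = {z. anc k z = z0}"
  have T: "finite T" unfolding T_def by (rule finite_anc_fibre)
  define a where "a z = (\<lambda>i. (z i - 1) * 2 ^ d)" for z :: "'n \<Rightarrow> int"
  define G where "G z = gridbox (a z) (2 ^ Suc d)" for z
  define w1 where "w1 z v = (if anc d v = z then m (k + d) v else 0)" for z v
  define w2 where "w2 z v = m k z / (2 ^ d) ^ N * (\<Prod>i\<in>UNIV. hat (v i / 2 ^ d - z i))" for z v :: "'n \<Rightarrow> int"
  have fibre_G: "{v. anc d v = z} \<subseteq> G z" for z
  proof
    fix v assume "v \<in> {v. anc d v = z}"
    then have v: "v i div 2 ^ d = z i" for i by (auto simp: anc_def)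
    have "a z i \<le> v i \<and> v i < a z i + int (2 ^ Suc d)" for i
    proof -
      have "z i * 2 ^ d \<le> v i \<and> v i < z i * 2 ^ d + 2 ^ d"
        using int_div_eq_iff[of "2 ^ d" "v i" "z i"] v[of i] by simp
      moreover have "a z i = z i * 2 ^ d - 2 ^ d" by (simp add: a_def algebra_simps)
      moreover have "int (2 ^ Suc d) = 2 ^ d + 2 ^ d" "(0::int) < 2 ^ d" by simp_all
      ultimately show ?thesis by linarith
    qed
    then show "v \<in> G z" by (simp add: G_def mem_gridbox)
  qed
  have w1_nonneg: "0 \<le> w1 z v" for z v by (simp add: w1_def m_nonneg)
  have w2_nonneg: "0 \<le> w2 z v" for z v
    unfolding w2_def
    by (intro mult_nonneg_nonneg divide_nonneg_nonneg prod_nonneg hat_nonneg ballI m_nonneg) auto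
  have sum_w1: "sum (w1 z) A \<le> (\<Sum>v\<in>A \<inter> {v. anc d v = z}. m (k + d) v)" if "finite A" for z A
    using that by (simp add: w1_def sum.inter_restrict)
  have w1_G: "(\<Sum>v\<in>G z. w1 z v * h v) = (\<Sum>v\<in>{v. anc d v = z}. m (k + d) v * h v)" for z and h :: "('n \<Rightarrow> int) \<Rightarrow> real"
  proof -
    have "(\<Sum>v\<in>G z. w1 z v * h v) = (\<Sum>v\<in>{v. anc d v = z}. w1 z v * h v)"
      by (rule sum.mono_neutral_right) (use fibre_G in \<open>auto simp: w1_def G_def\<close>)
    then show ?thesis by (simp add: w1_def)
  qed
  have growth1: "growth (a z) (Suc d) e (w1 z)" for z
    unfolding growth_def N_def[symmetric] s_def[symmetric]
  proof (intro allI impI)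
    fix q b assume q: "q \<le> Suc d" and b: "\<forall>i. 2 ^ q dvd b i - a z i"
    show "sum (w1 z) (gridbox b (2 ^ q)) \<le> e * 2 ^ (q * s)"
    proof (cases "q \<le> d")
      case True
      \<comment> \<open>The corner \<open>a z\<close> is a multiple of 2^d, so these boxes are cells
        of level k + d - q and their mass is a value of \<open>m\<close>.\<close>
      have "2 ^ q dvd b i" for i
      proof -
        have "(2::int) ^ q dvd 2 ^ d" using True by (rule le_imp_power_dvd)
        then have "2 ^ q dvd a z i" unfolding a_def by (rule dvd_mult)
        then have "2 ^ q dvd (b i - a z i) + a z i" using b by (intro dvd_add) auto
        then show ?thesis by simp
      qed
      then have box: "gridbox b (2 ^ q) = {v. anc q v = (\<lambda>i. b i div 2 ^ q)}" by (rule gridbox_eq_fibre)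
      have "sum (w1 z) (gridbox b (2 ^ q)) \<le> (\<Sum>v\<in>gridbox b (2 ^ q). m (k + d) v)"
        by (intro sum_mono) (auto simp: w1_def m_nonneg)
      also have "\<dots> = m (k + d - q) (\<lambda>i. b i div 2 ^ q)"
        unfolding box using m_anc[of "k + d - q" _ q] True by simp
      also have "\<dots> \<le> \<epsilon> * (1/2) ^ ((k + d - q) * s)" using True by (intro gr') auto
      also have "\<dots> \<le> \<epsilon> * (1/2) ^ ((k + d - q) * s) * 2" using \<epsilon> by simp
      also have "\<dots> = e * 2 ^ (q * s)" using True by (intro scale) auto
      finally show ?thesis .
    next
      case False
      \<comment> \<open>A box of the largest size can carry at most the whole fibre, whose mass is
        that of one coarse cell.\<close>
      then have qd: "q = Suc d" using q by simp
      have "sum (w1 z) (gridbox b (2 ^ q)) \<le> (\<Sum>v\<in>gridbox b (2 ^ q) \<inter> {v. anc d v = z}. m (k + d) v)"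
        by (rule sum_w1) simp
      also have "\<dots> \<le> (\<Sum>v\<in>{v. anc d v = z}. m (k + d) v)"
        by (intro sum_mono2 finite_anc_fibre) (auto simp: m_nonneg)
      also have "\<dots> = m k z" by (rule m_anc[symmetric])
      also have "\<dots> \<le> \<epsilon> * (1/2) ^ (k * s)" by (rule gr') simp
      also have "\<dots> \<le> \<epsilon> * (1/2) ^ (k * s) * 2" using \<epsilon> by simp
      also have "\<dots> = e * 2 ^ (d * s)" using scale[of d] by simp
      also have "\<dots> \<le> e * 2 ^ (q * s)" using qd e0 by (intro mult_left_mono power_increasing) auto
      finally show ?thesis .
    qed
  qed
  have w2_le: "w2 z v \<le> m k z / (2 ^ d) ^ N" for z v
  proof -
    have "(\<Prod>i\<in>UNIV. hat (v i / 2 ^ d - z i)) \<le> 1" by (intro prod_le_1) (auto simp: hat_nonneg hat_le_1)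
    then show ?thesis unfolding w2_def by (intro mult_left_le) (simp_all add: m_nonneg)
  qed
  have growth2: "growth (a z) (Suc d) e (w2 z)" for z
    unfolding growth_def N_def[symmetric] s_def[symmetric]
  proof (intro allI impI)
    fix q b assume q: "q \<le> Suc d"
    have "sum (w2 z) (gridbox b (2 ^ q)) \<le> real (card (gridbox b (2 ^ q))) * (m k z / (2 ^ d) ^ N)"
      by (rule sum_bounded_above) (rule w2_le)
    also have "\<dots> \<le> (2 ^ q) ^ N * ((\<epsilon> * (1/2) ^ (k * s)) / (2 ^ d) ^ N)"
      unfolding card_gridbox N_def[symmetric] of_nat_power of_nat_numeral
      by (intro mult_left_mono divide_right_mono gr') auto
    also have "\<dots> = (2 ^ q) ^ N * ((e * 2 ^ (d * s) / 2) / (2 ^ d) ^ N)"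
    proof -
      have "\<epsilon> * (1/2) ^ (k * s) = e * 2 ^ (d * s) / 2" using scale[of d] by simp
      then show ?thesis by (simp only:)
    qed
    also have "\<dots> = e * 2 ^ (q * s) * (2 ^ q / (2 * 2 ^ d))"
      by (simp add: N power_mult)
    also have "\<dots> \<le> e * 2 ^ (q * s) * 1"
    proof -
      have "(2::real) ^ q \<le> 2 ^ Suc d" using q by (intro power_increasing) auto
      then show ?thesis using e0 by (intro mult_left_mono) auto
    qed
    finally show "sum (w2 z) (gridbox b (2 ^ q)) \<le> e * 2 ^ (q * s)" by simp
  qed
  have bal: "sum (w1 z) (G z) = sum (w2 z) (G z)" for z
  proof -
    have "sum (w1 z) (G z) = m k z" using w1_G[of z "\<lambda>_. 1"] m_anc[of k z d] by simp
    moreover have "sum (w2 z) (G z) = m k z"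
      unfolding w2_def G_def a_def sum_distrib_left[symmetric] sum_hatn_weights by (simp add: N_def)
    ultimately show ?thesis by simp
  qed
  define good where "good z f \<longleftrightarrow> (\<forall>i v. \<bar>f i v\<bar> \<le> 2 ^ (N + 2) * e) \<and>
      (\<forall>i v. (i, v) \<notin> gedges (a z) (2 ^ Suc d) \<longrightarrow> f i v = 0) \<and>
      (\<forall>v. (\<Sum>i\<in>UNIV. f i (v(i := v i - 1)) - f i v) = (if v \<in> G z then w1 z v - w2 z v else 0))"
    for z and f :: "'n \<Rightarrow> ('n \<Rightarrow> int) \<Rightarrow> real"
  have "\<exists>f. good z f" for z
  proof (rule block_flow[of "w1 z" "w2 z" "a z" "Suc d" e])
    show "sum (w1 z) (gridbox (a z) (2 ^ Suc d)) = sum (w2 z) (gridbox (a z) (2 ^ Suc d))"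
      using bal[of z] by (simp only: G_def)
    fix f :: "'n \<Rightarrow> ('n \<Rightarrow> int) \<Rightarrow> real"
    assume f: "\<And>i v. \<bar>f i v\<bar> \<le> 2 ^ (CARD('n) + 2) * e"
      "\<And>i v. (i, v) \<notin> gedges (a z) (2 ^ Suc d) \<Longrightarrow> f i v = 0"
      "\<And>v. v \<in> gridbox (a z) (2 ^ Suc d) \<Longrightarrow> (\<Sum>i\<in>UNIV. f i (v(i := v i - 1)) - f i v) = w1 z v - w2 z v"
      "\<And>v. v \<notin> gridbox (a z) (2 ^ Suc d) \<Longrightarrow> (\<Sum>i\<in>UNIV. f i (v(i := v i - 1)) - f i v) = 0"
    show ?thesis
      using f by (intro exI[of _ f]) (simp add: good_def G_def N_def)
  qed (rule w1_nonneg w2_nonneg growth1 growth2)+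
  then have "\<forall>z. \<exists>f. good z f" by blast
  from choice[OF this] obtain F where good: "\<forall>z. good z (F z)" ..
  have F: "\<bar>F z i v\<bar> \<le> 2 ^ (N + 2) * e"
    "(i, v) \<notin> gedges (a z) (2 ^ Suc d) \<Longrightarrow> F z i v = 0"
    "(\<Sum>i\<in>UNIV. F z i (v(i := v i - 1)) - F z i v) = (if v \<in> G z then w1 z v - w2 z v else 0)" for z i v
    using good[unfolded good_def, THEN spec, of z] by blast+
  \<comment> \<open>The factor is the normalisation 2^((k+d) N) of the fine pairing divided by the
    2^(k+d) that differentiating the pipes produces.\<close>
  define f where "f i v = 2 ^ ((k + d) * s) * (\<Sum>z\<in>T. F z i v)" for i v
  define Z where "Z = (\<Union>z\<in>T. G z)"
  have Z: "finite Z" using T by (auto simp: Z_def G_def)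
  have supp: "v \<in> Z \<and> up i v \<in> Z" if "f i v \<noteq> 0" for i v
  proof -
    have "(\<Sum>z\<in>T. F z i v) \<noteq> 0" using that by (simp add: f_def)
    then obtain z where "z \<in> T" "F z i v \<noteq> 0" by (rule sum.not_neutral_contains_not_neutral)
    then have "z \<in> T" "(i, v) \<in> gedges (a z) (2 ^ Suc d)" using F(2) by blast+
    then show ?thesis by (auto simp: Z_def G_def gedges_def)
  qed
  have f_bound: "\<bar>f i v\<bar> \<le> 2 ^ (2 * N + 3) * \<epsilon>" for i v
  proof -
    \<comment> \<open>Blocks overlap: a fine cell lies in the block of \<open>z\<close> only if each
      coordinate of \<open>z\<close> is that of its coarse ancestor or one more, which bounds the
      overlap by 2^N.\<close>
    define A where "A = PiE (UNIV :: 'n set) (\<lambda>i. {v i div 2 ^ d, v i div 2 ^ d + 1})"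
    have A: "finite A" "card A = 2 ^ N"
      unfolding A_def by (auto simp: card_PiE N_def numeral_2_eq_2 intro!: finite_PiE)
    have inA: "z \<in> A" if "v \<in> G z" for z
    proof -
      have "z j = v j div 2 ^ d \<or> z j = v j div 2 ^ d + 1" for j
      proof -
        have v: "(z j - 1) * 2 ^ d \<le> v j \<and> v j < (z j - 1) * 2 ^ d + int (2 ^ Suc d)"
          using that by (simp add: G_def mem_gridbox a_def)
        show ?thesis
        proof (cases "v j < z j * 2 ^ d")
          case True
          then have "v j div 2 ^ d = z j - 1" using v by (subst int_div_eq_iff) (auto simp: algebra_simps)
          then show ?thesis by simp
        next
          case False
          then have "v j div 2 ^ d = z j" using v by (subst int_div_eq_iff) (auto simp: algebra_simps)
          then show ?thesis by simp
        qed
      qed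
      then show ?thesis by (auto simp: A_def PiE_def Pi_def)
    qed
    have "\<bar>\<Sum>z\<in>T. F z i v\<bar> \<le> (\<Sum>z\<in>T. \<bar>F z i v\<bar>)" by (rule sum_abs)
    also have "\<dots> = (\<Sum>z\<in>T \<inter> A. \<bar>F z i v\<bar>)"
    proof (rule sum.mono_neutral_right[OF T], blast, rule ballI)
      fix z assume "z \<in> T - T \<inter> A"
      then have "v \<notin> G z" using inA by blast
      then show "\<bar>F z i v\<bar> = 0" using F(2)[of i v z] by (auto simp: gedges_def G_def)
    qed
    also have "\<dots> \<le> real (card (T \<inter> A)) * (2 ^ (N + 2) * e)" by (rule sum_bounded_above) (rule F(1))
    also have "\<dots> \<le> real (2 ^ N) * (2 ^ (N + 2) * e)"
    proof -
      have "card (T \<inter> A) \<le> 2 ^ N" using card_mono[OF A(1), of "T \<inter> A"] A(2) by simp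
      then have "real (card (T \<inter> A)) \<le> real (2 ^ N)" by (simp only: of_nat_le_iff)
      then show ?thesis using e0 by (intro mult_right_mono) auto
    qed
    finally have "\<bar>\<Sum>z\<in>T. F z i v\<bar> \<le> 2 ^ N * (2 ^ (N + 2) * e)" by simp
    then have "\<bar>f i v\<bar> \<le> 2 ^ ((k + d) * s) * (2 ^ N * (2 ^ (N + 2) * e))"
      unfolding f_def abs_mult by (simp add: mult_left_mono)
    \<comment> \<open>The constant collects 2^N from the overlap, 2^(N+2) from boxing, and 2 from
      \<open>e\<close>.\<close>
    also have "\<dots> = 2 ^ (2 * N + 3) * \<epsilon>"
    proof -
      have 1: "2 ^ ((k + d) * s) * e = 2 * \<epsilon>" unfolding e_def by (simp add: power_one_over)
      have "2 * N + 3 = N + (N + 2) + 1" by simp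
      then have 2: "(2::real) ^ (2 * N + 3) = 2 ^ N * 2 ^ (N + 2) * 2" by (simp only: power_add power_one_right)
      have "2 ^ ((k + d) * s) * (2 ^ N * (2 ^ (N + 2) * e)) = 2 ^ N * 2 ^ (N + 2) * (2 ^ ((k + d) * s) * e)"
        by (simp only: mult_ac)
      then show ?thesis unfolding 1 2 by (simp only: mult.assoc)
    qed
    finally show ?thesis .
  qed
  show ?thesis
  proof (intro exI[of _ "flow_field (k + d) Z f"] conjI allI impI)
    show "continuous_on UNIV (flow_field (k + d) Z f)" by (rule continuous_on_flow_field)
    show "norm (flow_field (k + d) Z f x) \<le> real CARD('n) * 2 ^ (2 * CARD('n) + 3) * ramp 1 * \<epsilon>" for x
      using norm_flow_field[OF Z f_bound, where k = "k + d" and x = x] by (simp add: N_def mult_ac)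
    fix U \<phi> assume \<phi>: "test_function U (\<phi> :: real ^ 'n \<Rightarrow> real)"
    define I where "I k v = (LINT x|lborel. hatn k v x * \<phi> x)" for k v
    have net: "(\<Sum>i\<in>UNIV. f i (v(i := v i - 1)) - f i v) =
        2 ^ ((k + d) * s) * (\<Sum>z\<in>T. if v \<in> G z then w1 z v - w2 z v else 0)" for v
    proof -
      have "(\<Sum>i\<in>UNIV. f i (v(i := v i - 1)) - f i v) =
          2 ^ ((k + d) * s) * (\<Sum>i\<in>UNIV. \<Sum>z\<in>T. F z i (v(i := v i - 1)) - F z i v)"
        by (simp add: f_def sum_distrib_left right_diff_distrib sum_subtractf)
      also have "(\<Sum>i\<in>UNIV. \<Sum>z\<in>T. F z i (v(i := v i - 1)) - F z i v) =
          (\<Sum>z\<in>T. \<Sum>i\<in>UNIV. F z i (v(i := v i - 1)) - F z i v)" by (rule sum.swap)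
      finally show ?thesis by (simp only: F(3))
    qed
    have "(LINT x|lborel. flow_field (k + d) Z f x \<bullet> grad \<phi> x) =
        2 ^ (k + d) * (\<Sum>v\<in>Z. 2 ^ ((k + d) * s) * (\<Sum>z\<in>T. if v \<in> G z then w1 z v - w2 z v else 0) * I (k + d) v)"
    proof -
      have "(LINT x|lborel. flow_field (k + d) Z f x \<bullet> grad \<phi> x) =
          2 ^ (k + d) * (\<Sum>v\<in>Z. (\<Sum>i\<in>UNIV. f i (v(i := v i - 1)) - f i v) * I (k + d) v)"
        unfolding I_def by (rule integral_flow_field[OF \<phi> Z]) (rule supp)
      then show ?thesis by (simp only: net)
    qed
    also have "\<dots> = 2 ^ ((k + d) * N) * (\<Sum>v\<in>Z. \<Sum>z\<in>T. (if v \<in> G z then w1 z v - w2 z v else 0) * I (k + d) v)"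
      by (simp add: N power_add mult.assoc sum_distrib_left[symmetric] sum_distrib_right[symmetric])
    also have "(\<Sum>v\<in>Z. \<Sum>z\<in>T. (if v \<in> G z then w1 z v - w2 z v else 0) * I (k + d) v) =
        (\<Sum>z\<in>T. \<Sum>v\<in>Z. (if v \<in> G z then w1 z v - w2 z v else 0) * I (k + d) v)" by (rule sum.swap)
    \<comment> \<open>The first part tests the fine masses; in the second the weights
      \<open>w2\<close> recombine the fine hats into the coarse one.\<close>
    also have "\<dots> = (\<Sum>z\<in>T. (\<Sum>v\<in>{v. anc d v = z}. m (k + d) v * I (k + d) v) - m k z / (2 ^ d) ^ N * I k z)"
    proof (rule sum.cong[OF refl])
      fix z assume z: "z \<in> T"
      have "(\<Sum>v\<in>Z. (if v \<in> G z then w1 z v - w2 z v else 0) * I (k + d) v) =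
          (\<Sum>v\<in>G z. (if v \<in> G z then w1 z v - w2 z v else 0) * I (k + d) v)"
        by (rule sum.mono_neutral_right[OF Z]) (use z in \<open>auto simp: Z_def\<close>)
      also have "\<dots> = (\<Sum>v\<in>G z. w1 z v * I (k + d) v) - (\<Sum>v\<in>G z. w2 z v * I (k + d) v)"
        by (simp add: left_diff_distrib sum_subtractf)
      also have "(\<Sum>v\<in>G z. w2 z v * I (k + d) v) = m k z / (2 ^ d) ^ N * I k z"
      proof -
        have "I k z = (LINT x|lborel. (\<Sum>v\<in>G z. (\<Prod>i\<in>UNIV. hat (v i / 2 ^ d - z i)) * (hatn (k + d) v x * \<phi> x)))"
          unfolding I_def hatn_refine[of k z _ d] G_def a_def by (simp add: sum_distrib_right mult.assoc)
        also have "\<dots> = (\<Sum>v\<in>G z. (\<Prod>i\<in>UNIV. hat (v i / 2 ^ d - z i)) * I (k + d) v)"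
          unfolding I_def using integrable_mult_test(1)[OF continuous_on_hatn \<phi>] by simp
        finally show ?thesis by (simp add: w2_def sum_distrib_left mult.assoc)
      qed
      finally show "(\<Sum>v\<in>Z. (if v \<in> G z then w1 z v - w2 z v else 0) * I (k + d) v) =
          (\<Sum>v\<in>{v. anc d v = z}. m (k + d) v * I (k + d) v) - m k z / (2 ^ d) ^ N * I k z"
        by (simp only: w1_G)
    qed
    also have "\<dots> = (\<Sum>v\<in>{v. anc d v \<in> T}. m (k + d) v * I (k + d) v) - (\<Sum>z\<in>T. m k z * I k z) / (2 ^ d) ^ N"
      by (simp add: sum_subtractf sum_fibres[OF T finite_anc_fibre] sum_divide_distrib)
    also have "2 ^ ((k + d) * N) * ((\<Sum>v\<in>{v. anc d v \<in> T}. m (k + d) v * I (k + d) v) - (\<Sum>z\<in>T. m k z * I k z) / (2 ^ d) ^ N)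
        = pairing (k + d) \<phi> - pairing k \<phi>"
    proof -
      have "{v. anc d v \<in> T} = {v. anc (k + d) v = z0}" by (simp add: T_def anc_add)
      moreover have "(2::real) ^ ((k + d) * N) = 2 ^ (k * N) * (2 ^ d) ^ N"
        by (simp add: add_mult_distrib power_add power_mult)
      ultimately show ?thesis
        by (simp add: pairing_def right_diff_distrib N_def[symmetric] I_def T_def)
    qed
    finally show "(LINT x|lborel. flow_field (k + d) Z f x \<bullet> grad \<phi> x) = pairing (k + d) \<phi> - pairing k \<phi>" .
  qed
qed

text \<open>Every hat is at least (1/2)^N on the cube of side 1/2^k around its centre, whose volume
  cancels the normalisation; there \<phi> is 1. As the total mass is the same at all levels, the
  bound does not depend on \<open>k\<close>.\<close>

lemma pairing_lower_bound:
  assumes \<phi>: "test_function U \<phi>" "\<And>x. 0 \<le> \<phi> x"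
    and one: "\<And>x. (\<And>i. z0 i - 2 \<le> x $ i \<and> x $ i \<le> z0 i + 2) \<Longrightarrow> \<phi> x = 1"
  shows "(1/2) ^ CARD('n) * m 0 z0 \<le> pairing k \<phi>"
proof -
  define N where "N = CARD('n)"
  have I: "(1/2) ^ N * (1 / 2 ^ k) ^ N \<le> (LINT x|lborel. hatn k z x * \<phi> x)" if z: "anc k z = z0" for z
  proof -
    define B where "B = (cbox (\<chi> i. (z i - 1/2) / 2 ^ k) (\<chi> i. (z i + 1/2) / 2 ^ k) :: (real ^ 'n) set)"
    have "B \<noteq> {}" by (auto simp: B_def interval_ne_empty_cart divide_right_mono)
    then have mB: "measure lborel B = (1 / 2 ^ k) ^ N"
      unfolding B_def by (subst content_cbox_cart) (auto simp: N_def diff_divide_distrib[symmetric])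
    have fB: "emeasure lborel B < \<infinity>" "B \<in> sets lborel"
      unfolding B_def by (rule emeasure_lborel_cbox_finite) simp
    have "(1/2 :: real) ^ N * (1 / 2 ^ k) ^ N = (LINT x|lborel. (1/2) ^ N * indicator B x)"
      using fB by (simp add: mB integrable_real_indicator)
    also have "\<dots> \<le> (LINT x|lborel. hatn k z x * \<phi> x)"
    proof (rule integral_mono)
      show "integrable lborel (\<lambda>x. (1/2 :: real) ^ N * indicator B x)"
        using fB by (intro integrable_mult_right integrable_real_indicator) auto
      show "integrable lborel (\<lambda>x. hatn k z x * \<phi> x)" by (rule integrable_mult_test(1)[OF continuous_on_hatn \<phi>(1)])
      fix x
      show "(1/2) ^ N * indicator B x \<le> hatn k z x * \<phi> x"
      proof (cases "x \<in> B")
        case True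
        have b: "\<bar>2 ^ k * x $ i - z i\<bar> \<le> 1/2" for i
        proof -
          have "(z i - 1/2) / 2 ^ k \<le> x $ i" "x $ i \<le> (z i + 1/2) / 2 ^ k"
            using True by (auto simp: B_def mem_box_cart)
          then have "z i - 1/2 \<le> 2 ^ k * x $ i" "2 ^ k * x $ i \<le> z i + 1/2"
            by (simp_all add: field_simps)
          then show ?thesis by linarith
        qed
        have "(\<Prod>i\<in>(UNIV :: 'n set). 1/2) \<le> hatn k z x"
          unfolding hatn_def
        proof (intro prod_mono conjI)
          show "1/2 \<le> hat (2 ^ k * x $ i - z i)" for i unfolding hat_def using b[of i] by linarith
        qed simp
        moreover have "\<phi> x = 1"
        proof (rule one)
          fix i
          have "z0 i * 2 ^ k \<le> z i \<and> z i < z0 i * 2 ^ k + 2 ^ k"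
            using z int_div_eq_iff[of "2 ^ k" "z i" "z0 i"] by (auto simp: anc_def)
          then have "real_of_int (z0 i * 2 ^ k) \<le> z i" "real_of_int (z i) \<le> real_of_int (z0 i * 2 ^ k + 2 ^ k)"
            by (simp_all only: of_int_le_iff less_imp_le)
          then have 1: "z0 i * (2::real) ^ k \<le> z i" "z i \<le> z0 i * (2::real) ^ k + 2 ^ k"
            by simp_all
          define q where "q = (2::real) ^ k"
          have q: "1 \<le> q" by (simp add: q_def)
          have "z0 i * q - 2 * q \<le> q * x $ i" "q * x $ i \<le> z0 i * q + 2 * q"
            using 1 b[of i] q unfolding q_def[symmetric] by linarith+
          then have "q * (z0 i - 2) \<le> q * x $ i" "q * x $ i \<le> q * (z0 i + 2)"
            by (simp_all add: algebra_simps)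
          then show "z0 i - 2 \<le> x $ i \<and> x $ i \<le> z0 i + 2"
            using q by (auto dest!: mult_left_le_imp_le)
        qed
        ultimately show ?thesis using True by (simp add: N_def)
      next
        case False
        then show ?thesis using \<phi>(2)[of x] by (simp add: hatn_nonneg)
      qed
    qed
    finally show ?thesis .
  qed
  have "(1/2) ^ N * m 0 z0 = 2 ^ (k * N) * (\<Sum>z\<in>{z. anc k z = z0}. m k z * ((1/2) ^ N * (1 / 2 ^ k) ^ N))"
  proof -
    have "2 ^ (k * N) * (1 / 2 ^ k) ^ N = (1 :: real)" by (simp add: power_mult power_one_over)
    moreover have "2 ^ (k * N) * (M * ((1/2) ^ N * (1 / 2 ^ k) ^ N)) =
        (1/2) ^ N * M * (2 ^ (k * N) * (1 / 2 ^ k) ^ N)" for M :: real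
      by (simp only: mult_ac)
    ultimately have c: "2 ^ (k * N) * (M * ((1/2) ^ N * (1 / 2 ^ k) ^ N)) = (1/2) ^ N * M" for M :: real
      by (simp only: mult_1_right)
    show ?thesis
      unfolding sum_distrib_right[symmetric] c using m_anc[of 0 z0 k] by simp
  qed
  also have "\<dots> \<le> pairing k \<phi>"
    unfolding pairing_def N_def[symmetric]
    by (intro mult_left_mono sum_mono I m_nonneg) auto
  finally show ?thesis by (simp add: N_def)
qed

text \<open>A hat with nonzero mass belongs to a cell that meets \<open>S\<close>, so its support
  stays within a multiple of 1/2^k of \<open>S\<close>, while the support of \<phi> has positive
  distance from \<open>S\<close>.\<close>

lemma pairing_eventually_zero:
  assumes S: "closed S" and \<phi>: "test_function (- S) \<phi>" and mS: "\<And>k z. m k z \<noteq> 0 \<Longrightarrow> S \<inter> cell (k, z) \<noteq> {}"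
  shows "\<forall>\<^sub>F k in sequentially. pairing k \<phi> = 0"
proof -
  note t = test_functionD[OF \<phi>]
  let ?T = "closure {x. \<phi> x \<noteq> 0}"
  obtain d where d: "d > 0" "\<And>x y. x \<in> ?T \<Longrightarrow> y \<in> S \<Longrightarrow> d \<le> dist x y"
    using separate_compact_closed[OF t(2) S] t(3) by blast
  obtain k0 where k0: "(1/2::real) ^ k0 < d / (2 * real CARD('n))"
    using real_arch_pow_inv[of "d / (2 * real CARD('n))" "1/2"] d(1) by auto
  have "pairing k \<phi> = 0" if k: "k0 \<le> k" for k
  proof -
    have vanish: "m k z * (LINT x|lborel. hatn k z x * \<phi> x) = 0" for z
    proof (cases "m k z = 0")
      case False
      then obtain y where y: "y \<in> S" "idx k y = z" using mS[of k z] by (auto simp: cell_def)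
      have zero: "hatn k z x * \<phi> x = 0" for x
      proof (rule ccontr)
        assume "hatn k z x * \<phi> x \<noteq> 0"
        then have H: "hatn k z x \<noteq> 0" and x: "x \<in> ?T" using t(4)[of x] by auto
        have "norm (x - y) \<le> (\<Sum>i\<in>UNIV. \<bar>(x - y) $ i\<bar>)" by (rule norm_le_l1_cart)
        also have "\<dots> \<le> (\<Sum>i\<in>(UNIV :: 'n set). 2 * (1/2) ^ k)"
        proof (rule sum_mono)
          fix i
          have "hat (2 ^ k * x $ i - z i) \<noteq> 0" using H unfolding hatn_def by auto
          then have "\<bar>2 ^ k * x $ i - z i\<bar> < 1" using hat_eq_0 by force
          moreover have "z i = \<lfloor>2 ^ k * y $ i\<rfloor>" using y(2) by (auto simp: idx_def)
          ultimately have "\<bar>2 ^ k * x $ i - 2 ^ k * y $ i\<bar> \<le> 2" by linarith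
          then have "2 ^ k * \<bar>(x - y) $ i\<bar> \<le> 2"
            by (simp add: abs_mult[symmetric] right_diff_distrib[symmetric])
          then show "\<bar>(x - y) $ i\<bar> \<le> 2 * (1/2) ^ k" by (simp add: field_simps power_one_over)
        qed
        also have "\<dots> \<le> (\<Sum>i\<in>(UNIV :: 'n set). 2 * (1/2) ^ k0)"
          using k by (intro sum_mono mult_left_mono power_decreasing) auto
        also have "\<dots> < d" using k0 by (simp add: field_simps)
        finally show False using d(2)[OF x y(1)] by (simp add: dist_norm)
      qed
      show ?thesis unfolding zero by simp
    qed simp
    show ?thesis unfolding pairing_def vanish by simp
  qed
  then show ?thesis unfolding eventually_sequentially by blast
qed

end

section \<open>A test function around the unit cell, and the limit field\<close>

lemma ex_test_function:
  fixes z0 :: "'n::finite \<Rightarrow> int"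
  obtains \<phi> :: "real ^ 'n \<Rightarrow> real" where "test_function UNIV \<phi>" "\<And>x. 0 \<le> \<phi> x"
    "\<And>x. (\<And>i. z0 i - 2 \<le> x $ i \<and> x $ i \<le> z0 i + 2) \<Longrightarrow> \<phi> x = 1"
proof -
  obtain P P' L where "smooth_step P P' L" using ex_smooth_step by blast
  then interpret smooth_step P P' L .
  \<comment> \<open>Each factor rises on [z0 - 3, z0 - 2], is 1 up to z0 + 2 and vanishes beyond z0
    + 3.\<close>
  define \<phi> where "\<phi> x = (\<Prod>i\<in>UNIV. cutoff 1 (z0 i - 3) (z0 i + 2) (x $ i))" for x :: "real ^ 'n"
  define B where "B = (cbox (\<chi> i. z0 i - 3) (\<chi> i. z0 i + 3) :: (real ^ 'n) set)"
  have "smooth \<phi>"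
    unfolding \<phi>_def
    by (intro smooth_prod) (auto simp: smooth_def intro!: C_class_coordinate C_line_cutoff)
  moreover have sub: "closure {x. \<phi> x \<noteq> 0} \<subseteq> B"
  proof (rule closure_minimal)
    show "closed B" unfolding B_def by (rule closed_cbox)
    show "{x. \<phi> x \<noteq> 0} \<subseteq> B"
    proof
      fix x assume "x \<in> {x. \<phi> x \<noteq> 0}"
      then have "cutoff 1 (z0 i - 3) (z0 i + 2) (x $ i) \<noteq> 0" for i by (auto simp: \<phi>_def)
      then have "x $ i \<in> {z0 i - 3..z0 i + 2 + 1}" for i using cutoff_outside[of 1 "z0 i - 3" "z0 i + 2" "x $ i"] by force
      then show "x \<in> B" by (auto simp: B_def mem_box_cart add.assoc)
    qed
  qed
  moreover have "compact (closure {x. \<phi> x \<noteq> 0})"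
  proof -
    have "compact B" unfolding B_def by (rule compact_cbox)
    from compact_Int_closed[OF this closed_closure] show ?thesis
      using sub by (metis inf.absorb_iff2)
  qed
  ultimately have "test_function UNIV \<phi>" by (simp add: test_function_def)
  moreover have "0 \<le> \<phi> x" for x
    unfolding \<phi>_def by (intro prod_nonneg) (auto intro: cutoff_nonneg)
  moreover have "\<phi> x = 1" if "\<And>i. z0 i - 2 \<le> x $ i \<and> x $ i \<le> z0 i + 2" for x
    unfolding \<phi>_def using that by (intro prod.neutral ballI cutoff_eq_1) auto
  ultimately show ?thesis by (rule that)
qed

theorem removable_imp_sigma_finite:
  fixes S :: "(real ^ 'n) set"
  assumes S: "closed S" and rem: "C0_removable_div S"
  shows "hausdorff_sigma_finite (real (CARD('n) - 1)) S"
proof (rule ccontr)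
  assume "\<not> ?thesis"
  then obtain p and m :: "nat \<Rightarrow> ('n \<Rightarrow> int) \<Rightarrow> real" and z0 where
    p: "strict_mono p" "p 0 = 0" and m_nonneg: "\<And>k z. 0 \<le> m k z"
    and m_half: "\<And>k z. m k z = (\<Sum>w\<in>{w. half w = z}. m (Suc k) w)"
    and gr: "\<And>j k z. p j \<le> k \<Longrightarrow> m k z \<le> (1/4) ^ j * (1/2) ^ (k * (CARD('n) - 1))"
    and mS: "\<And>k z. m k z \<noteq> 0 \<Longrightarrow> S \<inter> cell (k, z) \<noteq> {}"
    and m0: "0 < m 0 z0"
    by (rule frostman_masses) (rule that)
  interpret dyadic_mass m z0
    using m_nonneg m_half by unfold_locales
  define A where "A = real CARD('n) * 2 ^ (2 * CARD('n) + 3) * ramp 1"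
  have A: "0 \<le> A" using ramp_bounds(1)[of 1] by (simp add: A_def)
  have "\<exists>W :: real ^ 'n \<Rightarrow> real ^ 'n. continuous_on UNIV W \<and> (\<forall>x. norm (W x) \<le> A * (1/4) ^ j) \<and>
     (\<forall>U \<phi>. test_function U \<phi> \<longrightarrow> (LINT x|lborel. W x \<bullet> grad \<phi> x) = pairing (p (Suc j)) \<phi> - pairing (p j) \<phi>)" for j
  proof -
    have "p j \<le> p (Suc j)" using p(1) by (simp add: strict_mono_less_eq)
    then show ?thesis
      using transition[of "p j" "(1/4) ^ j" "p (Suc j) - p j", OF gr] unfolding A_def by simp
  qed
  then have "\<exists>W. \<forall>j. continuous_on UNIV (W j) \<and> (\<forall>x. norm (W j x) \<le> A * (1/4) ^ j) \<and>
     (\<forall>U \<phi>. test_function U \<phi> \<longrightarrow> (LINT x|lborel. W j x \<bullet> grad \<phi> x) = pairing (p (Suc j)) \<phi> - pairing (p j) \<phi>)"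
    by (intro choice allI)
  then obtain W :: "nat \<Rightarrow> real ^ 'n \<Rightarrow> real ^ 'n" where W: "\<And>j. continuous_on UNIV (W j)"
    "\<And>j x. norm (W j x) \<le> A * (1/4) ^ j"
    "\<And>j U \<phi>. test_function U \<phi> \<Longrightarrow> (LINT x|lborel. W j x \<bullet> grad \<phi> x) = pairing (p (Suc j)) \<phi> - pairing (p j) \<phi>"
    by blast
  define i0 :: 'n where "i0 = undefined"
  \<comment> \<open>A positive total mass is not the divergence of a field of compact support:
    \<open>V0\<close> carries the mass of the unit cell off to infinity along one arbitrary
    direction. The sign compensates that of the integration by parts.\<close>
  define V0 where "V0 x = (- m 0 z0 * pipe 0 i0 z0 x) *\<^sub>R axis i0 (1 :: real)" for x
  have V0_cont: "continuous_on UNIV V0"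
    unfolding V0_def by (intro continuous_intros continuous_on_pipe)
  define Vn where "Vn n x = V0 x + (\<Sum>j<n. W j x)" for n x
  define V where "V x = V0 x + (\<Sum>j. W j x)" for x
  have sumA: "summable (\<lambda>j. A * (1/4) ^ j)" by (intro summable_mult summable_geometric) auto
  have unif: "uniform_limit UNIV (\<lambda>n x. \<Sum>j<n. W j x) (\<lambda>x. \<Sum>j. W j x) sequentially"
    by (rule Weierstrass_m_test[OF W(2) sumA])
  have V_cont: "continuous_on UNIV V"
    unfolding V_def
    by (intro continuous_on_add V0_cont uniform_limit_theorem[OF _ unif] always_eventually allI continuous_on_sum W) auto
  have Vn_cont: "continuous_on UNIV (Vn n)" for n
    unfolding Vn_def by (intro continuous_intros V0_cont W)
  have Vn_lim: "(\<lambda>n. Vn n x) \<longlonglongrightarrow> V x" for x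
    unfolding Vn_def V_def by (intro tendsto_intros tendsto_uniform_limitI[OF unif]) auto
  have int_Vn: "(LINT x|lborel. Vn n x \<bullet> grad \<phi> x) = pairing (p n) \<phi>" if \<phi>: "test_function U \<phi>" for n U \<phi>
  proof -
    have "(LINT x|lborel. V0 x \<bullet> grad \<phi> x) = (LINT x|lborel. - m 0 z0 * (pipe 0 i0 z0 x * partial_deriv i0 \<phi> x))"
      by (intro Bochner_Integration.integral_cong refl) (simp add: V0_def inner_axis' mult.assoc)
    also have "\<dots> = m 0 z0 * (LINT x|lborel. hatn 0 z0 x * \<phi> x)"
      using integrable_mult_test(2)[OF continuous_on_pipe \<phi>] integral_pipe[OF \<phi>, of 0 i0 z0] by simp
    also have "\<dots> = pairing (p 0) \<phi>" by (simp add: p pairing_def)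
    finally have v0: "(LINT x|lborel. V0 x \<bullet> grad \<phi> x) = pairing (p 0) \<phi>" .
    show ?thesis
    proof (induction n)
      case 0
      then show ?case using v0 by (simp add: Vn_def)
    next
      case (Suc n)
      have "(LINT x|lborel. Vn (Suc n) x \<bullet> grad \<phi> x) = (LINT x|lborel. Vn n x \<bullet> grad \<phi> x + W n x \<bullet> grad \<phi> x)"
        by (simp add: Vn_def inner_add_left add.assoc)
      also have "\<dots> = (LINT x|lborel. Vn n x \<bullet> grad \<phi> x) + (LINT x|lborel. W n x \<bullet> grad \<phi> x)"
        by (intro Bochner_Integration.integral_add integrable_inner_grad[OF _ \<phi>] Vn_cont W)
      finally show ?case using Suc W(3)[OF \<phi>] by simp
    qed
  qed
  have lim: "(\<lambda>n. pairing (p n) \<phi>) \<longlonglongrightarrow> (LINT x|lborel. V x \<bullet> grad \<phi> x)" if \<phi>: "test_function U \<phi>" for U \<phi>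
  proof -
    note t = test_functionD[OF \<phi>]
    define b where "b x = (norm (V0 x) + (\<Sum>j. A * (1/4) ^ j)) * norm (grad \<phi> x)" for x
    have "(\<lambda>n. LINT x|lborel. Vn n x \<bullet> grad \<phi> x) \<longlonglongrightarrow> (LINT x|lborel. V x \<bullet> grad \<phi> x)"
    proof (rule integral_dominated_convergence[where w = b])
      show "(\<lambda>x. V x \<bullet> grad \<phi> x) \<in> borel_measurable lborel"
        by (rule borel_measurable_integrable[OF integrable_inner_grad[OF V_cont \<phi>]])
      show "(\<lambda>x. Vn n x \<bullet> grad \<phi> x) \<in> borel_measurable lborel" for n
        by (rule borel_measurable_integrable[OF integrable_inner_grad[OF Vn_cont \<phi>]])
      show "integrable lborel b"
      proof (rule integrable_continuous_compact_support[OF _ t(2)])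
        show "continuous_on UNIV b"
          unfolding b_def by (intro continuous_intros V0_cont continuous_on_grad t(1))
        show "b x = 0" if "x \<notin> closure {x. \<phi> x \<noteq> 0}" for x
          using grad_outside_support[OF that] by (simp add: b_def)
      qed
      show "AE x in lborel. (\<lambda>n. Vn n x \<bullet> grad \<phi> x) \<longlonglongrightarrow> V x \<bullet> grad \<phi> x"
        by (intro AE_I2 tendsto_inner Vn_lim tendsto_const)
      show "AE x in lborel. norm (Vn n x \<bullet> grad \<phi> x) \<le> b x" for n
      proof (rule AE_I2)
        fix x
        have "norm (\<Sum>j<n. W j x) \<le> (\<Sum>j<n. A * (1/4) ^ j)" by (intro sum_norm_le W)
        also have "\<dots> \<le> (\<Sum>j. A * (1/4) ^ j)" by (intro sum_le_suminf sumA) (auto simp: A)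
        finally have "norm (Vn n x) \<le> norm (V0 x) + (\<Sum>j. A * (1/4) ^ j)"
          unfolding Vn_def by (intro order_trans[OF norm_triangle_ineq] add_left_mono)
        then show "norm (Vn n x \<bullet> grad \<phi> x) \<le> b x"
          unfolding b_def real_norm_def by (intro order_trans[OF Cauchy_Schwarz_ineq2] mult_right_mono) auto
      qed
    qed
    then show ?thesis by (simp add: int_Vn[OF \<phi>])
  qed
  have "div_zero_on (- S) V"
    unfolding div_zero_on_iff
  proof (intro allI impI)
    fix \<phi> :: "real ^ 'n \<Rightarrow> real" assume \<phi>: "test_function (- S) \<phi>"
    have "\<forall>\<^sub>F n in sequentially. pairing (p n) \<phi> = 0"
      using pairing_eventually_zero[OF S \<phi> mS] filterlim_subseq[OF p(1)]
      by (auto simp: filterlim_iff)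
    then have "(\<lambda>n. pairing (p n) \<phi>) \<longlonglongrightarrow> 0" by (rule tendsto_eventually)
    with lim[OF \<phi>] show "(LINT x|lborel. V x \<bullet> grad \<phi> x) = 0" by (rule LIMSEQ_unique)
  qed
  then have dz: "div_zero_on UNIV V" using rem V_cont by (simp add: C0_removable_div_def)
  obtain \<phi> :: "real ^ 'n \<Rightarrow> real" where \<phi>: "test_function UNIV \<phi>" "\<And>x. 0 \<le> \<phi> x"
    "\<And>x. (\<And>i. z0 i - 2 \<le> x $ i \<and> x $ i \<le> z0 i + 2) \<Longrightarrow> \<phi> x = 1"
    using ex_test_function[of z0] by blast
  have "(1/2) ^ CARD('n) * m 0 z0 \<le> (LINT x|lborel. V x \<bullet> grad \<phi> x)"
    by (rule LIMSEQ_le_const[OF lim[OF \<phi>(1)]]) (use pairing_lower_bound[OF \<phi>] in blast)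
  moreover have "(LINT x|lborel. V x \<bullet> grad \<phi> x) = 0" using dz \<phi>(1) by (simp add: div_zero_on_iff)
  ultimately have "(1/2) ^ CARD('n) * m 0 z0 \<le> 0" by simp
  moreover have "0 < (1/2) ^ CARD('n) * m 0 z0" using m0 by simp
  ultimately show False by linarith
qed

theorem theorem1p1:
  fixes S :: "(real ^ 'n) set"
  assumes "closed S"
  shows "C0_removable_div S \<longleftrightarrow> hausdorff_sigma_finite (real CARD('n) - 1) S"
proof -
  \<comment> \<open>The dimension is at least 1, so subtraction in the naturals and in the reals
    agree.\<close>
  have "real CARD('n) - 1 = real (CARD('n) - 1)" by (simp add: of_nat_diff Suc_leI)
  then show ?thesis
    using removable_imp_sigma_finite[OF assms] sigma_finite_imp_removable[OF assms] by auto
qed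

end
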